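(* Let $\Gamma$ be a discrete group acting on a unital C$^*$-algebra $\mathcal A$ through an action $\alpha$. If $\mathcal A\rtimes_r\Gamma$ is $\mathcal A$-$\Gamma$-nuclear (as an $\mathcal A$-$\Gamma$-module or as an $\mathcal A$-$\Gamma$-comodule) and $\mathcal A$ has the CBAP, then $\mathcal A\rtimes_r\Gamma$ has the CBAP. In fact, $\Lambda(\mathcal A\rtimes_r\Gamma)=\Lambda(\mathcal A)$.
   Context: CBAP. A C$^*$-algebra $\mathcal C$ has the completely bounded approximation property (CBAP) if there are a constant $C>0$ and a net of finite rank completely bounded maps $\Phi_j:\mathcal C\to\mathcal C$ with $\|\Phi_j(a)-a\|\to0$ for all $a\in\mathcal C$ and $\sup_j\|\Phi_j\|_{cb}\le C$. The Haagerup constant $\Lambda(\mathcal C)$ is the infimum of all $C$ for which such a net exists; $\Lambda(\mathcal C)=\infty$ if $\mathcal C$ does not have the CBAP. Abbreviations: c.p. = completely positive, c.c.p. = contractive completely positive. $\otimes$ always denotes the minimal tensor product. Setting. $\Gamma$ is a discrete group with identity $e$, acting by automorphisms $\alpha_s$ ($s\in\Gamma$) on a unital C$^*$-algebra $\mathcal A$. In the reduced crossed product $\mathcal A\rtimes_r\Gamma$ we identify $\mathcal A$ and $\Gamma$ with their canonical images, so $sas^{-1}=\alpha_s(a)$ and the elements $as$ ($a\in\mathcal A$, $s\in\Gamma$) are total. $\lambda$ is the left regular representation of $\Gamma$, generating $C^*_r(\Gamma)$. Notation. $\Gamma^\infty=\bigcup_{n\ge1}\Gamma^n$ (union of all finite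 Cartesian powers). For $t=(t_1,\dots,t_\ell)\in\Gamma^\infty$ and $r\in\Gamma$ put $\bar t=t_1\cdots t_\ell\in\Gamma$ and $rt=(rt_1,t_2,\dots,t_\ell)$. Let $e_{s,t}$ be the matrix units of $\mathbb B(\ell^2(\Gamma^\infty))$. For finite $F\subseteq\Gamma^\infty$, $P_F$ is the orthogonal projection onto $\ell^2(F)$, and $\mathbb M_F(\mathcal A)=\mathrm{span}\{a\otimes e_{s,t}:a\in\mathcal A,\ s,t\in F\}\subseteq\mathcal A\otimes\mathbb B(\ell^2(\Gamma^\infty))$. Modules and comodules. An operator $\mathcal A$-$\Gamma$-module is an operator system $\mathcal B$ with a $\Gamma$-action $\beta$ by surjective complete isometries and a right $\mathcal A$-module action such that $\beta_t(b\cdot a)=\beta_t(b)\cdot\alpha_t(a)$ (for a C$^*$-algebra $\mathcal B$, $\Gamma$ acts by automorphisms). An operator $\mathcal A$-$\Gamma$-comodule is an operator system $\mathcal B$ with a coaction $\delta_{\mathcal B}:\mathcal B\to\mathcal B\otimes C^*_r(\Gamma)$ (a non-degenerate c.p. map, a homomorphism when $\mathcal B$ is a C$^*$-algebra), a coaction $\delta_{\mathcal A}:\mathcal A\to\mathcal A\otimes C^*_r(\Gamma)$ (a non-degenerate homomorphism), and a right $\mathcal A$-module structure with $\delta_{\mathcal B}(b\cdot a)=\delta_{\mathcal B}(b)\cdot\delta_{\mathcal A}(a)$. Here $\delta_{\mathcal A}(a)=a\otimes\lambda_e$. Structures used. On $\mathcal A\rtimes_r\Gamma$: right multiplication by $\mathcal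 A$, the action $r\cdot x=rxr^{-1}$, and the coaction $\delta(as)=as\otimes\lambda_s$. On $\mathcal A\otimes\mathbb B(\ell^2(\Gamma^\infty))$: the module action and $\Gamma$-action extending $(a\otimes e_{s,t})\cdot b=(a\otimes e_{s,t})\pi(b)=a\alpha_{\bar t^{-1}}(b)\otimes e_{s,t}$, where $\pi(b)=\sum_{s\in\Gamma^\infty}\alpha_{\bar s^{-1}}(b)\otimes e_{s,s}$, and $r\cdot(a\otimes e_{s,t})=U_r(a\otimes e_{s,t})U_r^*=a\otimes e_{rs,rt}$, where $U_r\delta_s=\delta_{rs}$. Each $\mathbb M_F(\mathcal A)$ gets its $\mathcal A$-module structure as a subspace, and $r\cdot\mathbb M_F(\mathcal A)=\mathbb M_{rF}(\mathcal A)$. In the comodule case $\mathcal A\otimes\mathbb B(\ell^2(\Gamma^\infty))$ is regarded as an $\mathcal A$-$\Gamma$-comodule whose coaction is given on each $\mathbb M_F(\mathcal A)$ by $\delta_F(a\otimes e_{s,t})=(a\otimes\lambda_{\bar s\bar t^{-1}})\otimes e_{s,t}$, with $\mathbb M_F(\mathcal A)\otimes C^*_r(\Gamma)$ identified with $\mathbb M_F(\mathcal A\otimes C^*_r(\Gamma))$. $\mathcal A$-admissible maps. For operator systems $\mathcal B,\mathcal D$ with right $\mathcal A$-module structures, the class of $\mathcal A$-admissible c.p. maps is determined by the rules: (1) every c.p. $\mathcal A$-module map $\mathcal B\to\mathcal D$ is $\mathcal A$-admissible; (2) if $\varphi:\mathcal B\to\mathcal D$ is $\mathcal A$-admissible,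 so are $x\mapsto\varphi(bxb^* )$ and $x\mapsto d\varphi(x)d^*$ for $b\in\mathcal B$, $d\in\mathcal D$; (3) the maps $x\mapsto\rho(x)d$ with $\rho$ a positive functional on $\mathcal B$ and $d\in\mathcal D^+$ are $\mathcal A$-admissible; (4) compositions, positive multiples and finite sums of $\mathcal A$-admissible maps are $\mathcal A$-admissible. $\Gamma$-families. Let $\mathcal B,\mathcal D$ have $\Gamma$-actions $\alpha^{\mathcal B},\alpha^{\mathcal D}$. A $\Gamma$-family of operator subsystems of $\mathcal B$ is a family $\{\mathcal B_i\}_{i\in I}$ with an action of $\Gamma$ on $I$ such that $\alpha^{\mathcal B}_t(\mathcal B_i)\subseteq\mathcal B_{t\cdot i}$. A $\Gamma$-family of maps on it is a family of c.p. maps $\psi_i:\mathcal B_i\to\mathcal D$ with $\psi_{t\cdot i}(\alpha^{\mathcal B}_t(b))=\alpha^{\mathcal D}_t(\psi_i(b))$. For $\{\mathbb M_F(\mathcal A)\}_F$ the index set is the set of finite subsets of $\Gamma^\infty$ with action $F\mapsto rF$. $\Gamma$-cofamilies. Let $\mathcal B,\mathcal D$ have coactions $\delta_{\mathcal B},\delta_{\mathcal D}$. A $\Gamma$-cofamily of operator subsystems of $\mathcal B$ is a family $\{\mathcal B_i\}_{i\in I}$ with a map $\delta:I\to I$ such that $\delta_{\mathcal B}(\mathcal B_i)\subseteq\mathcal B_{\delta(i)}\otimes C^*_r(\Gamma)$. A $\Gamma$-cofamily of maps on it is a family of c.p. maps $\psi_i:\mathcal B_i\to\mathcal D$ with $(\psi_{\delta(i)}\otimes\mathrm{id})(\delta_{\mathcal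 B}(b))=\delta_{\mathcal D}(\psi_i(b))$. (Co)admissible families. The class of $\Gamma$-admissible families of c.p. maps is determined by: (i) every $\Gamma$-family of maps is $\Gamma$-admissible; (ii) a $\Gamma$-admissible family $\{\psi_i:\mathcal B_i\to\mathcal D\}_{i\in I}$ stays so if one adds $x\mapsto\psi_i(bxb^* )$ or $x\mapsto d\psi_i(x)d^*$ ($b\in\mathcal B$, $d\in\mathcal D$), or a finite sum of maps in the family, or $x\mapsto\alpha^{\mathcal D}_t(\psi_i(x))$ or $x\mapsto\psi_{t\cdot i}(\alpha^{\mathcal B}_t(x))$ ($t\in\Gamma$); (iii) for $\Gamma$-admissible families $\{\phi_i:\mathcal B_i\to\mathcal D\}$, $\{\psi_j:\mathcal D_j\to\mathcal C\}$, the family of all $\psi_j\circ\phi_i$ with $\phi_i(\mathcal B_i)\subseteq\mathcal D_j$ is $\Gamma$-admissible; (iv) the union of two $\Gamma$-admissible families is $\Gamma$-admissible. $\Gamma$-coadmissible families of c.p. maps are determined by the same rules with $\Gamma$-cofamilies in (i) and with the last pair of maps in (ii) replaced by $x\mapsto(\mathrm{id}\otimes f)\delta_{\mathcal D}(\psi_i(x))$ or $x\mapsto\psi_{\delta(i)}((\mathrm{id}\otimes f)\delta_{\mathcal B}(x))$, $f\in C^*_r(\Gamma)^*$. A family is (co)admissible if it is $\Gamma$-(co)admissible and all its members are $\mathcal A$-admissible; a single map is (co)admissible if it belongs to a (co)admissible family. Nuclearity. $\mathcal B=\mathcal A\rtimes_r\Gamma$ is $\mathcal A$-$\Gamma$-nuclear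 as an $\mathcal A$-$\Gamma$-module (respectively, comodule) if for every $\varepsilon>0$ and finite $S\subseteq\mathcal B$ there are an admissible (respectively, coadmissible) c.c.p. map $\varphi:\mathcal B\to\mathcal A\otimes\mathbb B(\ell^2(\Gamma^\infty))$ and an admissible (respectively, coadmissible) family $\{\psi_F:\mathbb M_F(\mathcal A)\to\mathcal B\}_F$ ($F$ ranging over the finite subsets of $\Gamma^\infty$) of c.c.p. maps such that, for some $F$, $\|\psi_F\varphi_F(b)-b\|\le\varepsilon$ for all $b\in S$, where the c.c.p. admissible (respectively, coadmissible) map $\varphi_F:\mathcal B\to\mathbb M_F(\mathcal A)$ is $\varphi_F(b)=(1\otimes P_F)\varphi(b)(1\otimes P_F)$. "$\mathcal A$-$\Gamma$-nuclear" without qualification means: as an $\mathcal A$-$\Gamma$-module or as an $\mathcal A$-$\Gamma$-comodule. *)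

theory Defs
  imports "HOL-Analysis.Analysis"
begin

class scaleC =
  fixes scaleC :: "complex \<Rightarrow> 'a \<Rightarrow> 'a" (infixr "*\<^sub>C" 75)

class complex_vector = real_vector + scaleC +
  assumes scaleC_add_right: "c *\<^sub>C (x + y) = c *\<^sub>C x + c *\<^sub>C y"
    and scaleC_add_left: "(c + d) *\<^sub>C x = c *\<^sub>C x + d *\<^sub>C x"
    and scaleC_scaleC: "c *\<^sub>C d *\<^sub>C x = (c * d) *\<^sub>C x"
    and scaleC_one: "1 *\<^sub>C x = x"
    and scaleR_scaleC: "r *\<^sub>R x = complex_of_real r *\<^sub>C x"

class complex_normed_vector = complex_vector + real_normed_vector +
  assumes norm_scaleC: "norm (c *\<^sub>C x) = cmod c * norm x"

class chilbert_space = complex_normed_vector + real_inner + complete_space +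
  assumes inner_scaleC_left: "inner (c *\<^sub>C x) y = inner x (cnj c *\<^sub>C y)"

global_interpretation complex_vector: vector_space "scaleC :: complex \<Rightarrow> 'a \<Rightarrow> 'a::complex_vector"
  defines cspan = complex_vector.span and csubspace = complex_vector.subspace
  by standard (auto simp: scaleC_add_right scaleC_add_left scaleC_scaleC scaleC_one)

text \<open>The real inner product is the real part of the complex one, which is linear in the second
  argument.\<close>
definition cinner :: "'h::chilbert_space \<Rightarrow> 'h \<Rightarrow> complex"
  where "cinner x y = Complex (inner x y) (inner (\<i> *\<^sub>C x) y)"

instantiation complex :: chilbert_space
begin
definition scaleC_complex :: "complex \<Rightarrow> complex \<Rightarrow> complex"
  where "scaleC_complex = (*)"
instance
  by standard (auto simp: scaleC_complex_def algebra_simps scaleR_conv_of_real norm_mult inner_complex_def)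
end

instantiation prod :: (chilbert_space, chilbert_space) chilbert_space
begin
definition scaleC_prod :: "complex \<Rightarrow> 'a \<times> 'b \<Rightarrow> 'a \<times> 'b"
  where "scaleC_prod c p = (c *\<^sub>C fst p, c *\<^sub>C snd p)"
instance
proof
  fix c :: complex and p :: "'a \<times> 'b"
  have "sqrt ((cmod c * norm (fst p))\<^sup>2 + (cmod c * norm (snd p))\<^sup>2)
      = cmod c * sqrt ((norm (fst p))\<^sup>2 + (norm (snd p))\<^sup>2)"
    by (simp add: power_mult_distrib real_sqrt_mult flip: distrib_left)
  then show "norm (c *\<^sub>C p) = cmod c * norm p"
    by (simp add: norm_prod_def scaleC_prod_def norm_scaleC)
qed (auto simp: scaleC_prod_def scaleC_add_right scaleC_add_left scaleC_scaleC scaleC_one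
    scaleR_scaleC inner_prod_def inner_scaleC_left prod_eq_iff)
end

typedef (overloaded) ('x, 'h::real_normed_vector) ell2 =
    "{f :: 'x \<Rightarrow> 'h. (\<lambda>x. (norm (f x))\<^sup>2) summable_on UNIV}"
  by (intro exI[of _ "\<lambda>_. 0"]) simp

setup_lifting type_definition_ell2

lemma ell2_add:
  fixes f g :: "'x \<Rightarrow> 'h::real_normed_vector"
  assumes "(\<lambda>x. (norm (f x))\<^sup>2) summable_on UNIV" "(\<lambda>x. (norm (g x))\<^sup>2) summable_on UNIV"
  shows "(\<lambda>x. (norm (f x + g x))\<^sup>2) summable_on UNIV"
proof (rule summable_on_comparison_test)
  show "(\<lambda>x. 2 * (norm (f x))\<^sup>2 + 2 * (norm (g x))\<^sup>2) summable_on UNIV"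
    using assms by (intro summable_on_add summable_on_cmult_right)
  fix x
  have "(norm (f x + g x))\<^sup>2 \<le> (norm (f x) + norm (g x))\<^sup>2"
    by (intro power_mono norm_triangle_ineq) auto
  also have "\<dots> \<le> 2 * (norm (f x))\<^sup>2 + 2 * (norm (g x))\<^sup>2"
    using sum_squares_bound[of "norm (f x)" "norm (g x)"] by (simp add: power2_sum)
  finally show "(norm (f x + g x))\<^sup>2 \<le> 2 * (norm (f x))\<^sup>2 + 2 * (norm (g x))\<^sup>2" .
qed auto

lemma ell2_inner:
  fixes f g :: "'x \<Rightarrow> 'h::real_inner"
  assumes "(\<lambda>x. (norm (f x))\<^sup>2) summable_on UNIV" "(\<lambda>x. (norm (g x))\<^sup>2) summable_on UNIV"
  shows "(\<lambda>x. inner (f x) (g x)) summable_on UNIV"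
proof -
  have "(\<lambda>x. norm (inner (f x) (g x))) summable_on UNIV"
  proof (rule summable_on_comparison_test)
    show "(\<lambda>x. (norm (f x))\<^sup>2 + (norm (g x))\<^sup>2) summable_on UNIV"
      using assms by (intro summable_on_add)
    fix x
    have "norm (inner (f x) (g x)) \<le> norm (f x) * norm (g x)"
      by (simp add: Cauchy_Schwarz_ineq2)
    also have "\<dots> \<le> (norm (f x))\<^sup>2 + (norm (g x))\<^sup>2"
      using sum_squares_bound[of "norm (f x)" "norm (g x)"]
        mult_nonneg_nonneg[of "norm (f x)" "norm (g x)"] by (simp del: mult_nonneg_nonneg)
    finally show "norm (inner (f x) (g x)) \<le> (norm (f x))\<^sup>2 + (norm (g x))\<^sup>2" .
  qed auto
  then show ?thesis using summable_on_iff_abs_summable_on_real by blast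
qed

instantiation ell2 :: (type, real_inner) real_inner
begin
lift_definition zero_ell2 :: "('a, 'b) ell2" is "\<lambda>_. 0" by simp
lift_definition plus_ell2 :: "('a, 'b) ell2 \<Rightarrow> ('a, 'b) ell2 \<Rightarrow> ('a, 'b) ell2"
  is "\<lambda>f g x. f x + g x" by (rule ell2_add)
lift_definition uminus_ell2 :: "('a, 'b) ell2 \<Rightarrow> ('a, 'b) ell2" is "\<lambda>f x. - f x" by simp
lift_definition minus_ell2 :: "('a, 'b) ell2 \<Rightarrow> ('a, 'b) ell2 \<Rightarrow> ('a, 'b) ell2"
  is "\<lambda>f g x. f x - g x"
  by (subst diff_conv_add_uminus, rule ell2_add) auto
lift_definition scaleR_ell2 :: "real \<Rightarrow> ('a, 'b) ell2 \<Rightarrow> ('a, 'b) ell2" is "\<lambda>r f x. r *\<^sub>R f x"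
  by (simp add: power_mult_distrib summable_on_cmult_right)
lift_definition inner_ell2 :: "('a, 'b) ell2 \<Rightarrow> ('a, 'b) ell2 \<Rightarrow> real"
  is "\<lambda>f g. infsum (\<lambda>x. inner (f x) (g x)) UNIV" .
definition norm_ell2 :: "('a, 'b) ell2 \<Rightarrow> real" where "norm_ell2 x = sqrt (inner x x)"
definition sgn_ell2 :: "('a, 'b) ell2 \<Rightarrow> ('a, 'b) ell2" where "sgn_ell2 x = inverse (norm x) *\<^sub>R x"
definition dist_ell2 :: "('a, 'b) ell2 \<Rightarrow> ('a, 'b) ell2 \<Rightarrow> real" where "dist_ell2 x y = norm (x - y)"
definition uniformity_ell2 :: "(('a, 'b) ell2 \<times> ('a, 'b) ell2) filter"
  where "uniformity_ell2 = (INF e\<in>{0<..}. principal {(x, y). dist x y < e})"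
definition open_ell2 :: "('a, 'b) ell2 set \<Rightarrow> bool"
  where "open_ell2 S = (\<forall>x\<in>S. \<forall>\<^sub>F (x', y) in uniformity. x' = x \<longrightarrow> y \<in> S)"
instance
proof
  fix x y z :: "('a, 'b) ell2" and r s :: real
  show "x + y + z = x + (y + z)" "x + y = y + x" "0 + x = x" "- x + x = 0" "x - y = x + - y"
    "r *\<^sub>R (x + y) = r *\<^sub>R x + r *\<^sub>R y" "(r + s) *\<^sub>R x = r *\<^sub>R x + s *\<^sub>R x"
    "r *\<^sub>R s *\<^sub>R x = (r * s) *\<^sub>R x" "1 *\<^sub>R x = x"
    by (transfer; auto simp: algebra_simps)+
  show "inner x y = inner y x" by transfer (simp add: inner_commute)
  show "inner (x + y) z = inner x z + inner y z"
    by transfer (simp add: inner_add_left infsum_add ell2_inner)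
  show "inner (r *\<^sub>R x) y = r * inner x y"
    by transfer (simp add: infsum_cmult_right')
  show "0 \<le> inner x x" by transfer (simp add: infsum_nonneg)
  show "inner x x = 0 \<longleftrightarrow> x = 0"
  proof transfer
    fix f :: "'a \<Rightarrow> 'b"
    assume f: "(\<lambda>x. (norm (f x))\<^sup>2) summable_on UNIV"
    show "(\<Sum>\<^sub>\<infinity>x. inner (f x) (f x)) = 0 \<longleftrightarrow> f = (\<lambda>_. 0)"
    proof
      assume "(\<Sum>\<^sub>\<infinity>x. inner (f x) (f x)) = 0"
      then have "inner (f x) (f x) = 0" for x
        using nonneg_infsum_le_0D[of "\<lambda>x. inner (f x) (f x)" UNIV x] f
        by (auto simp: power2_norm_eq_inner)
      then show "f = (\<lambda>_. 0)" by auto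
    qed auto
  qed
qed (simp_all add: norm_ell2_def sgn_ell2_def dist_ell2_def uniformity_ell2_def open_ell2_def)
end

lemma norm_ell2_sq: "(norm x)\<^sup>2 = (\<Sum>\<^sub>\<infinity>i. (norm (Rep_ell2 x i))\<^sup>2)"
  unfolding power2_norm_eq_inner by transfer (simp add: power2_norm_eq_inner)

lemma summable_ell2: "(\<lambda>i. (norm (Rep_ell2 x i))\<^sup>2) summable_on UNIV"
  using Rep_ell2 by auto

lemma sum_le_norm_ell2: "finite F \<Longrightarrow> (\<Sum>i\<in>F. (norm (Rep_ell2 x i))\<^sup>2) \<le> (norm x)\<^sup>2"
  unfolding norm_ell2_sq by (rule finite_sum_le_infsum[OF summable_ell2]) auto

lemma norm_Rep_ell2_le: "norm (Rep_ell2 x i) \<le> norm x"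
  using sum_le_norm_ell2[of "{i}" x] by (auto intro: power2_le_imp_le)

instance ell2 :: (type, "{real_inner, complete_space}") complete_space
proof
  fix X :: "nat \<Rightarrow> ('a, 'b) ell2"
  assume X: "Cauchy X"
  have diff: "Rep_ell2 (x - y) i = Rep_ell2 x i - Rep_ell2 y i" for x y :: "('a, 'b) ell2" and i
    by transfer simp
  have "Cauchy (\<lambda>n. Rep_ell2 (X n) i)" for i
  proof (rule CauchyI)
    fix e :: real assume "e > 0"
    then obtain M where "\<forall>m\<ge>M. \<forall>n\<ge>M. norm (X m - X n) < e" using CauchyD[OF X] by blast
    then show "\<exists>M. \<forall>m\<ge>M. \<forall>n\<ge>M. norm (Rep_ell2 (X m) i - Rep_ell2 (X n) i) < e"
      by (metis diff norm_Rep_ell2_le order_le_less_trans)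
  qed
  then have "\<exists>l. (\<lambda>n. Rep_ell2 (X n) i) \<longlonglongrightarrow> l" for i
    using Cauchy_convergent convergent_def by blast
  then obtain f where f: "\<And>i. (\<lambda>n. Rep_ell2 (X n) i) \<longlonglongrightarrow> f i" by metis
  have key: "(\<Sum>i\<in>F. (norm (Rep_ell2 (X n) i - f i))\<^sup>2) \<le> e\<^sup>2"
    if "finite F" "\<forall>m\<ge>M. \<forall>n\<ge>M. norm (X m - X n) < e" "n \<ge> M" for F n M and e :: real
  proof (rule tendsto_upperbound)
    show "(\<lambda>m. \<Sum>i\<in>F. (norm (Rep_ell2 (X n) i - Rep_ell2 (X m) i))\<^sup>2)
      \<longlonglongrightarrow> (\<Sum>i\<in>F. (norm (Rep_ell2 (X n) i - f i))\<^sup>2)"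
      by (intro tendsto_intros f)
    show "\<forall>\<^sub>F m in sequentially. (\<Sum>i\<in>F. (norm (Rep_ell2 (X n) i - Rep_ell2 (X m) i))\<^sup>2) \<le> e\<^sup>2"
    proof (rule eventually_sequentiallyI[of M])
      fix m assume "m \<ge> M"
      have "(\<Sum>i\<in>F. (norm (Rep_ell2 (X n - X m) i))\<^sup>2) \<le> (norm (X n - X m))\<^sup>2"
        by (rule sum_le_norm_ell2) fact
      also have "\<dots> \<le> e\<^sup>2" using that \<open>m \<ge> M\<close> by (intro power_mono) (auto intro: less_imp_le)
      finally show "(\<Sum>i\<in>F. (norm (Rep_ell2 (X n) i - Rep_ell2 (X m) i))\<^sup>2) \<le> e\<^sup>2" by (simp add: diff)
    qed
  qed auto
  have sm: "(\<lambda>i. (norm (Rep_ell2 (X n) i - f i))\<^sup>2) summable_on UNIV"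
    if "\<forall>m\<ge>M. \<forall>n\<ge>M. norm (X m - X n) < e" "n \<ge> M" for n M and e :: real
    using key[OF _ that] by (intro nonneg_bdd_above_summable_on) (auto intro!: bdd_aboveI)
  have summ: "(\<lambda>i. (norm (f i))\<^sup>2) summable_on UNIV"
  proof -
    obtain M where M: "\<forall>m\<ge>M. \<forall>n\<ge>M. norm (X m - X n) < 1" using CauchyD[OF X] zero_less_one by blast
    have "(\<lambda>i. (norm (f i - Rep_ell2 (X M) i))\<^sup>2) summable_on UNIV"
      using sm[OF M order_refl] by (simp add: norm_minus_commute)
    from ell2_add[OF this summable_ell2[of "X M"]] show ?thesis by simp
  qed
  define l where "l = Abs_ell2 f"
  have l: "Rep_ell2 l = f" unfolding l_def using summ by (simp add: Abs_ell2_inverse)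
  have "X \<longlonglongrightarrow> l"
  proof (rule LIMSEQ_I)
    fix r :: real assume "r > 0"
    then obtain M where M: "\<forall>m\<ge>M. \<forall>n\<ge>M. norm (X m - X n) < r/2"
      using CauchyD[OF X, of "r/2"] by auto
    show "\<exists>no. \<forall>n\<ge>no. norm (X n - l) < r"
    proof (intro exI allI impI)
      fix n assume n: "n \<ge> M"
      have "(norm (X n - l))\<^sup>2 \<le> (r/2)\<^sup>2"
        unfolding norm_ell2_sq diff l using key[OF _ M n] sm[OF M n]
        by (intro infsum_le_finite_sums) auto
      then have "norm (X n - l) \<le> r/2" using \<open>r > 0\<close> by (auto intro: power2_le_imp_le)
      then show "norm (X n - l) < r" using \<open>r > 0\<close> by simp
    qed
  qed
  then show "convergent X" by (auto simp: convergent_def)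
qed

instantiation ell2 :: (type, chilbert_space) chilbert_space
begin
lift_definition scaleC_ell2 :: "complex \<Rightarrow> ('a, 'b) ell2 \<Rightarrow> ('a, 'b) ell2" is "\<lambda>c f x. c *\<^sub>C f x"
  by (simp add: norm_scaleC power_mult_distrib summable_on_cmult_right)
instance
proof
  fix x y :: "('a, 'b) ell2" and c d :: complex and r :: real
  show "c *\<^sub>C (x + y) = c *\<^sub>C x + c *\<^sub>C y" "(c + d) *\<^sub>C x = c *\<^sub>C x + d *\<^sub>C x"
    "c *\<^sub>C d *\<^sub>C x = (c * d) *\<^sub>C x" "1 *\<^sub>C x = x" "r *\<^sub>R x = complex_of_real r *\<^sub>C x"
    by (transfer; simp add: scaleC_add_right scaleC_add_left scaleC_scaleC scaleC_one scaleR_scaleC)+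
  show "inner (c *\<^sub>C x) y = inner x (cnj c *\<^sub>C y)"
    by transfer (simp add: inner_scaleC_left)
  have "Rep_ell2 (c *\<^sub>C x) i = c *\<^sub>C Rep_ell2 x i" for i by transfer simp
  then have "(norm (c *\<^sub>C x))\<^sup>2 = (cmod c * norm x)\<^sup>2"
    by (simp add: norm_ell2_sq norm_scaleC power_mult_distrib infsum_cmult_right')
  then show "norm (c *\<^sub>C x) = cmod c * norm x"
    by (rule power2_eq_imp_eq) auto
qed
end

lemma bounded_linear_scaleC: "bounded_linear (\<lambda>x::'a::complex_normed_vector. c *\<^sub>C x)"
  by (rule bounded_linear_intro[where K = "cmod c"])
    (auto simp: scaleC_add_right scaleR_scaleC scaleC_scaleC norm_scaleC mult.commute)

instantiation blinfun :: (real_normed_vector, complex_normed_vector) complex_normed_vector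
begin
lift_definition scaleC_blinfun :: "complex \<Rightarrow> 'a \<Rightarrow>\<^sub>L 'b \<Rightarrow> 'a \<Rightarrow>\<^sub>L 'b" is "\<lambda>c f x. c *\<^sub>C f x"
  by (rule bounded_linear_compose[OF bounded_linear_scaleC])
instance
proof
  fix S T :: "'a \<Rightarrow>\<^sub>L 'b" and c d :: complex and r :: real
  show "c *\<^sub>C (S + T) = c *\<^sub>C S + c *\<^sub>C T" "(c + d) *\<^sub>C S = c *\<^sub>C S + d *\<^sub>C S"
    "c *\<^sub>C d *\<^sub>C S = (c * d) *\<^sub>C S" "1 *\<^sub>C S = S" "r *\<^sub>R S = complex_of_real r *\<^sub>C S"
    by (transfer; simp add: scaleC_add_right scaleC_add_left scaleC_scaleC scaleC_one scaleR_scaleC)+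
  have le: "norm (c *\<^sub>C S) \<le> cmod c * norm S" for c and S :: "'a \<Rightarrow>\<^sub>L 'b"
    by (rule norm_blinfun_bound)
      (auto simp: scaleC_blinfun.rep_eq norm_scaleC mult.assoc norm_blinfun mult_left_mono)
  show "norm (c *\<^sub>C S) = cmod c * norm S"
  proof (cases "c = 0")
    case False
    have "inverse c *\<^sub>C c *\<^sub>C S = S"
      using False by transfer (simp add: scaleC_scaleC scaleC_one)
    then have "cmod c * norm S \<le> cmod c * (cmod (inverse c) * norm (c *\<^sub>C S))"
      using le[of "inverse c" "c *\<^sub>C S"] by (simp add: mult_left_mono)
    also have "\<dots> = norm (c *\<^sub>C S)" using False by (simp add: norm_inverse)
    finally show ?thesis using le[of c S] by simp
  next
    case True then show ?thesis using le[of 0 S] by simp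
  qed
qed
end


type_synonym 'k op = "'k \<Rightarrow>\<^sub>L 'k"


section \<open>Algebras and spaces of operators\<close>

text \<open>\<open>\<Rightarrow>\<^sub>L\<close> consists of the real-linear bounded maps; the operators that matter are the
  complex-linear ones. All operator spaces are concrete: subsets of the bounded operators on a
  complex Hilbert space.\<close>

definition clinear_op :: "('k::chilbert_space \<Rightarrow>\<^sub>L 'l::chilbert_space) \<Rightarrow> bool"
  where "clinear_op T \<longleftrightarrow> (\<forall>c x. T (c *\<^sub>C x) = c *\<^sub>C T x)"

definition is_adjoint :: "'k::chilbert_space op \<Rightarrow> 'k op \<Rightarrow> bool"
  where "is_adjoint T T' \<longleftrightarrow> (\<forall>x y. cinner (T x) y = cinner x (T' y))"

definition cstar_algebra :: "'k::chilbert_space op set \<Rightarrow> bool" where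
  "cstar_algebra A \<longleftrightarrow> (\<forall>a\<in>A. clinear_op a) \<and> csubspace A \<and> closed A \<and>
     (\<forall>a\<in>A. \<forall>b\<in>A. a o\<^sub>L b \<in> A) \<and> (\<forall>a\<in>A. \<exists>a'\<in>A. is_adjoint a a')"

definition unital_cstar_algebra :: "'k::chilbert_space op set \<Rightarrow> bool"
  where "unital_cstar_algebra A \<longleftrightarrow> cstar_algebra A \<and> id_blinfun \<in> A"

definition is_unit :: "'k::chilbert_space op set \<Rightarrow> 'k op \<Rightarrow> bool"
  where "is_unit S p \<longleftrightarrow> p \<in> S \<and> (\<forall>x\<in>S. p o\<^sub>L x = x \<and> x o\<^sub>L p = x)"

text \<open>The unit of an operator system is a projection, not necessarily the identity operator: the
  system is regarded as acting on the range of its unit. This lets the matrix algebras over finite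
  index sets be subsystems of a bigger operator system.\<close>

definition operator_system :: "'k::chilbert_space op set \<Rightarrow> bool" where
  "operator_system S \<longleftrightarrow> (\<forall>x\<in>S. clinear_op x) \<and> csubspace S \<and>
     (\<forall>x\<in>S. \<exists>x'\<in>S. is_adjoint x x') \<and> (\<exists>p. is_unit S p)"

definition linear_on :: "'a::complex_vector set \<Rightarrow> ('a \<Rightarrow> 'b::complex_vector) \<Rightarrow> bool" where
  "linear_on S \<phi> \<longleftrightarrow> (\<forall>x\<in>S. \<forall>y\<in>S. \<phi> (x + y) = \<phi> x + \<phi> y) \<and> (\<forall>x\<in>S. \<forall>c. \<phi> (c *\<^sub>C x) = c *\<^sub>C \<phi> x)"

definition bounded_on :: "'a::real_normed_vector set \<Rightarrow> ('a \<Rightarrow> 'b::real_normed_vector) \<Rightarrow> bool"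
  where "bounded_on S \<phi> \<longleftrightarrow> (\<exists>M. \<forall>x\<in>S. norm (\<phi> x) \<le> M * norm x)"

definition star_automorphism :: "'k::chilbert_space op set \<Rightarrow> ('k op \<Rightarrow> 'k op) \<Rightarrow> bool" where
  "star_automorphism A \<theta> \<longleftrightarrow> bij_betw \<theta> A A \<and> linear_on A \<theta> \<and>
     (\<forall>a\<in>A. \<forall>b\<in>A. \<theta> (a o\<^sub>L b) = \<theta> a o\<^sub>L \<theta> b) \<and>
     (\<forall>a\<in>A. \<forall>b\<in>A. is_adjoint a b \<longrightarrow> is_adjoint (\<theta> a) (\<theta> b))"

text \<open>Groups are written additively, but they are not assumed to be abelian.\<close>

definition cstar_action :: "'k::chilbert_space op set \<Rightarrow> ('g::group_add \<Rightarrow> 'k op \<Rightarrow> 'k op) \<Rightarrow> bool"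
  where "cstar_action A \<alpha> \<longleftrightarrow> (\<forall>s. star_automorphism A (\<alpha> s)) \<and>
     (\<forall>a\<in>A. \<alpha> 0 a = a) \<and> (\<forall>s t. \<forall>a\<in>A. \<alpha> (s + t) a = \<alpha> s (\<alpha> t a))"


section \<open>Completely positive and completely bounded maps\<close>

text \<open>An \<open>n \<times> n\<close> matrix of operators is a function of two indices, of which only the values below
  \<open>n\<close> matter; it acts on the \<open>n\<close>-fold direct sum of the Hilbert space.\<close>

definition mat_in :: "nat \<Rightarrow> 'a set \<Rightarrow> (nat \<Rightarrow> nat \<Rightarrow> 'a) \<Rightarrow> bool"
  where "mat_in n S X \<longleftrightarrow> (\<forall>i<n. \<forall>j<n. X i j \<in> S)"

definition mat_norm :: "nat \<Rightarrow> (nat \<Rightarrow> nat \<Rightarrow> 'k::chilbert_space op) \<Rightarrow> real" where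
  "mat_norm n X = (SUP \<xi> \<in> {\<xi> :: nat \<Rightarrow> 'k. L2_set (\<lambda>j. norm (\<xi> j)) {..<n} \<le> 1}.
     L2_set (\<lambda>i. norm (\<Sum>j<n. X i j (\<xi> j))) {..<n})"

definition mat_pos :: "nat \<Rightarrow> (nat \<Rightarrow> nat \<Rightarrow> 'k::chilbert_space op) \<Rightarrow> bool" where
  "mat_pos n X \<longleftrightarrow> (\<forall>\<xi> :: nat \<Rightarrow> 'k. (\<Sum>i<n. \<Sum>j<n. cinner (\<xi> i) (X i j (\<xi> j))) \<in> \<real>\<^sub>\<ge>\<^sub>0)"

definition positive_op :: "'k::chilbert_space op \<Rightarrow> bool"
  where "positive_op T \<longleftrightarrow> (\<forall>\<xi>. cinner \<xi> (T \<xi>) \<in> \<real>\<^sub>\<ge>\<^sub>0)"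

definition cp_map ::
    "'k::chilbert_space op set \<Rightarrow> 'l::chilbert_space op set \<Rightarrow> ('k op \<Rightarrow> 'l op) \<Rightarrow> bool" where
  "cp_map S T \<phi> \<longleftrightarrow> \<phi> ` S \<subseteq> T \<and> linear_on S \<phi> \<and>
     (\<forall>n X. mat_in n S X \<and> mat_pos n X \<longrightarrow> mat_pos n (\<lambda>i j. \<phi> (X i j)))"

definition ccp_map ::
    "'k::chilbert_space op set \<Rightarrow> 'l::chilbert_space op set \<Rightarrow> ('k op \<Rightarrow> 'l op) \<Rightarrow> bool"
  where "ccp_map S T \<phi> \<longleftrightarrow> cp_map S T \<phi> \<and> (\<forall>x\<in>S. norm (\<phi> x) \<le> norm x)"

definition cb_norm ::
    "'k::chilbert_space op set \<Rightarrow> ('k op \<Rightarrow> 'l::chilbert_space op) \<Rightarrow> ennreal" where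
  "cb_norm S \<phi> = (SUP (n, X) \<in> {(n, X). mat_in n S X \<and> mat_norm n X \<le> 1}.
     ennreal (mat_norm n (\<lambda>i j. \<phi> (X i j))))"

definition complete_isometry ::
    "'k::chilbert_space op set \<Rightarrow> ('k op \<Rightarrow> 'l::chilbert_space op) \<Rightarrow> bool" where
  "complete_isometry S \<phi> \<longleftrightarrow> linear_on S \<phi> \<and>
     (\<forall>n X. mat_in n S X \<longrightarrow> mat_norm n (\<lambda>i j. \<phi> (X i j)) = mat_norm n X)"

definition finite_rank :: "'a set \<Rightarrow> ('a \<Rightarrow> 'b::complex_vector) \<Rightarrow> bool"
  where "finite_rank S \<phi> \<longleftrightarrow> (\<exists>E. finite E \<and> \<phi> ` S \<subseteq> cspan E)"

text \<open>A net of maps is given by the filter on the set of maps that is generated by its tails;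
  conversely every proper filter arises from a net in this way.\<close>

definition approximable_with :: "'k::chilbert_space op set \<Rightarrow> real \<Rightarrow> bool" where
  "approximable_with A C \<longleftrightarrow> (\<exists>\<N> :: ('k op \<Rightarrow> 'k op) filter. \<N> \<noteq> bot \<and>
     (\<forall>\<^sub>F \<Phi> in \<N>. \<Phi> ` A \<subseteq> A \<and> linear_on A \<Phi> \<and> finite_rank A \<Phi> \<and> cb_norm A \<Phi> \<le> ennreal C) \<and>
     (\<forall>a\<in>A. ((\<lambda>\<Phi>. norm (\<Phi> a - a)) \<longlongrightarrow> 0) \<N>))"

definition CBAP :: "'k::chilbert_space op set \<Rightarrow> bool"
  where "CBAP A \<longleftrightarrow> (\<exists>C>0. approximable_with A C)"

definition Haagerup_constant :: "'k::chilbert_space op set \<Rightarrow> ennreal"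
  where "Haagerup_constant A = (INF C \<in> {C. C > 0 \<and> approximable_with A C}. ennreal C)"


section \<open>Operators on \<open>H \<otimes> \<ell>\<^sup>2(X)\<close>\<close>

text \<open>\<open>('x, 'h) ell2\<close> is \<open>H \<otimes> \<ell>\<^sup>2(X)\<close>, and \<open>\<ell>\<^sup>2(X)\<close> itself is \<open>('x, complex) ell2\<close>.\<close>

definition tens :: "'h::chilbert_space \<Rightarrow> ('x, complex) ell2 \<Rightarrow> ('x, 'h) ell2"
  where "tens v \<eta> = Abs_ell2 (\<lambda>x. Rep_ell2 \<eta> x *\<^sub>C v)"

text \<open>\<open>is_op_tensor R a T\<close> states \<open>R = a \<otimes> T\<close>.\<close>

definition is_op_tensor ::
    "('x, 'h::chilbert_space) ell2 op \<Rightarrow> 'h op \<Rightarrow> ('x, complex) ell2 op \<Rightarrow> bool"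
  where "is_op_tensor R a T \<longleftrightarrow> (\<forall>v \<eta>. R (tens v \<eta>) = tens (a v) (T \<eta>))"

definition min_tensor ::
    "'h::chilbert_space op set \<Rightarrow> ('x, complex) ell2 op set \<Rightarrow> ('x, 'h) ell2 op set"
  where "min_tensor S C = closure (cspan {R. \<exists>a\<in>S. \<exists>T\<in>C. is_op_tensor R a T})"

definition diag :: "('x \<Rightarrow> 'h::chilbert_space \<Rightarrow>\<^sub>L 'k::chilbert_space) \<Rightarrow> ('x, 'h) ell2 \<Rightarrow>\<^sub>L ('x, 'k) ell2"
  where "diag T = Blinfun (\<lambda>\<xi>. Abs_ell2 (\<lambda>x. T x (Rep_ell2 \<xi> x)))"

text \<open>\<open>ampl T\<close> is \<open>T \<otimes> 1\<close>.\<close>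

definition ampl :: "('h::chilbert_space \<Rightarrow>\<^sub>L 'k::chilbert_space) \<Rightarrow> ('x, 'h) ell2 \<Rightarrow>\<^sub>L ('x, 'k) ell2"
  where "ampl T = diag (\<lambda>_. T)"

text \<open>\<open>reindex p\<close> maps \<open>v \<otimes> \<delta>\<^bsub>p x\<^esub>\<close> to \<open>v \<otimes> \<delta>\<^bsub>x\<^esub>\<close>, for a bijection \<open>p\<close>.\<close>

definition reindex :: "('x \<Rightarrow> 'x) \<Rightarrow> ('x, 'h::chilbert_space) ell2 op"
  where "reindex p = Blinfun (\<lambda>\<xi>. Abs_ell2 (\<lambda>x. Rep_ell2 \<xi> (p x)))"

text \<open>\<open>matrix_unit a s t\<close> is \<open>a \<otimes> e\<^bsub>s,t\<^esub>\<close>.\<close>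

definition matrix_unit :: "'h::chilbert_space op \<Rightarrow> 'x \<Rightarrow> 'x \<Rightarrow> ('x, 'h) ell2 op"
  where "matrix_unit a s t =
    Blinfun (\<lambda>\<xi>. Abs_ell2 (\<lambda>x. if x = s then a (Rep_ell2 \<xi> t) else 0))"

text \<open>\<open>proj_on F\<close> is \<open>1 \<otimes> P\<^bsub>F\<^esub>\<close>.\<close>

definition proj_on :: "'x set \<Rightarrow> ('x, 'h::chilbert_space) ell2 op"
  where "proj_on F = diag (\<lambda>x. if x \<in> F then id_blinfun else 0)"

definition matrix_alg :: "'h::chilbert_space op set \<Rightarrow> 'x set \<Rightarrow> ('x, 'h) ell2 op set"
  where "matrix_alg A F = cspan {matrix_unit a s t |a s t. a \<in> A \<and> s \<in> F \<and> t \<in> F}"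

definition stable_alg :: "'h::chilbert_space op set \<Rightarrow> ('x, 'h) ell2 op set"
  where "stable_alg A = min_tensor A {T. clinear_op T}"


section \<open>The reduced crossed product\<close>

definition left_reg :: "'g::group_add \<Rightarrow> ('g, 'h::chilbert_space) ell2 op"
  where "left_reg r = reindex (\<lambda>s. - r + s)"

definition group_alg :: "('g::group_add, complex) ell2 op set"
  where "group_alg = closure (cspan (range left_reg))"

definition cross_embed ::
    "('g::group_add \<Rightarrow> 'h::chilbert_space op \<Rightarrow> 'h op) \<Rightarrow> 'h op \<Rightarrow> ('g, 'h) ell2 op"
  where "cross_embed \<alpha> a = diag (\<lambda>s. \<alpha> (- s) a)"

definition crossed_product ::
    "'h::chilbert_space op set \<Rightarrow> ('g::group_add \<Rightarrow> 'h op \<Rightarrow> 'h op) \<Rightarrow> ('g, 'h) ell2 op set"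
  where "crossed_product A \<alpha> = closure (cspan {cross_embed \<alpha> a o\<^sub>L left_reg s |a s. a \<in> A})"


section \<open>Tuples of group elements\<close>

text \<open>A nonempty tuple \<open>(t\<^sub>1, \<dots>, t\<^sub>l)\<close> is encoded as the pair of \<open>t\<^sub>1\<close> and the list \<open>[t\<^sub>2, \<dots>, t\<^sub>l]\<close>.\<close>

type_synonym 'g tuples = "'g \<times> 'g list"

definition tuple_prod :: "'g::group_add tuples \<Rightarrow> 'g"
  where "tuple_prod t = fst t + sum_list (snd t)"

definition tuple_shift :: "'g::group_add \<Rightarrow> 'g tuples \<Rightarrow> 'g tuples"
  where "tuple_shift r t = (r + fst t, snd t)"

definition tuple_unitary :: "'g::group_add \<Rightarrow> ('g tuples, 'h::chilbert_space) ell2 op"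
  where "tuple_unitary r = reindex (tuple_shift (- r))"

definition tuple_embed ::
    "('g::group_add \<Rightarrow> 'h::chilbert_space op \<Rightarrow> 'h op) \<Rightarrow> 'h op \<Rightarrow> ('g tuples, 'h) ell2 op"
  where "tuple_embed \<alpha> b = diag (\<lambda>s. \<alpha> (- tuple_prod s) b)"


section \<open>Coactions implemented by a grading of the index set\<close>

text \<open>For \<open>g : X \<rightarrow> \<Gamma>\<close> let \<open>W\<close> be the unitary \<open>\<delta>\<^bsub>x\<^esub> \<otimes> \<delta>\<^bsub>t\<^esub> \<mapsto> \<delta>\<^bsub>x\<^esub> \<otimes> \<delta>\<^bsub>g(x)t\<^esub>\<close> on \<open>H \<otimes> \<ell>\<^sup>2(X) \<otimes> \<ell>\<^sup>2(\<Gamma>)\<close>.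
  Then \<open>y \<mapsto> W(y \<otimes> 1)W\<^sup>*\<close> maps \<open>a \<otimes> e\<^bsub>s,t\<^esub>\<close> to \<open>a \<otimes> e\<^bsub>s,t\<^esub> \<otimes> \<lambda>\<^bsub>g(s)g(t)\<^sup>-\<^sup>1\<^esub>\<close>. For \<open>X = \<Gamma>\<close> and \<open>g = id\<close>
  it maps \<open>as\<close> to \<open>as \<otimes> \<lambda>\<^bsub>s\<^esub>\<close> on the crossed product.\<close>

definition grading_unitary ::
    "('x \<Rightarrow> 'g::group_add) \<Rightarrow> ('g, ('x, 'h::chilbert_space) ell2) ell2 op" where
  "grading_unitary g =
     Blinfun (\<lambda>\<xi>. Abs_ell2 (\<lambda>t. Abs_ell2 (\<lambda>x. Rep_ell2 (Rep_ell2 \<xi> (- g x + t)) x)))"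

definition grading_coaction :: "('x \<Rightarrow> 'g::group_add) \<Rightarrow> ('x, 'h::chilbert_space) ell2 op \<Rightarrow>
    ('g, ('x, 'h) ell2) ell2 op"
  where "grading_coaction g y = grading_unitary g o\<^sub>L ampl y o\<^sub>L grading_unitary (\<lambda>x. - g x)"


subsection \<open>Evaluation of the operators defined above\<close>

lemma Rep_Abs: "(\<lambda>x. (norm (f x))\<^sup>2) summable_on UNIV \<Longrightarrow> Rep_ell2 (Abs_ell2 f) = f"
  by (simp add: Abs_ell2_inverse)

lemma Rep_simps: "Rep_ell2 (\<xi> + \<eta>) x = Rep_ell2 \<xi> x + Rep_ell2 \<eta> x" "Rep_ell2 (r *\<^sub>R \<xi>) x = r *\<^sub>R Rep_ell2 \<xi> x"
  "Rep_ell2 (c *\<^sub>C (\<zeta>::('x,'k::chilbert_space) ell2)) x = c *\<^sub>C Rep_ell2 \<zeta> x"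
  by (transfer; simp)+

lemma Rep_Blinfun:
  fixes F :: "('x \<Rightarrow> 'h::chilbert_space) \<Rightarrow> 'y \<Rightarrow> 'k::chilbert_space"
  assumes add: "\<And>f g. F (\<lambda>x. f x + g x) = (\<lambda>y. F f y + F g y)"
    and sc: "\<And>r f. F (\<lambda>x. r *\<^sub>R f x) = (\<lambda>y. r *\<^sub>R F f y)"
    and s: "\<And>\<xi>. (\<lambda>y. (norm (F (Rep_ell2 \<xi>) y))\<^sup>2) summable_on UNIV"
    and b: "\<And>\<xi>. (\<Sum>\<^sub>\<infinity>y. (norm (F (Rep_ell2 \<xi>) y))\<^sup>2) \<le> (M * norm \<xi>)\<^sup>2" and M: "M \<ge> 0"
  shows "Rep_ell2 (Blinfun (\<lambda>\<xi>. Abs_ell2 (F (Rep_ell2 \<xi>))) \<xi>) = F (Rep_ell2 \<xi>)"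
proof -
  have R: "Rep_ell2 (Abs_ell2 (F (Rep_ell2 \<xi>))) = F (Rep_ell2 \<xi>)" for \<xi> using Rep_Abs[OF s] .
  have "bounded_linear (\<lambda>\<xi>. Abs_ell2 (F (Rep_ell2 \<xi>)))"
  proof (rule bounded_linear_intro[where K=M])
    fix \<xi> \<eta> :: "('x,'h) ell2" and r :: real
    have "Rep_ell2 (\<xi> + \<eta>) = (\<lambda>x. Rep_ell2 \<xi> x + Rep_ell2 \<eta> x)" by (auto simp: Rep_simps)
    then have "Rep_ell2 (Abs_ell2 (F (Rep_ell2 (\<xi> + \<eta>)))) = Rep_ell2 (Abs_ell2 (F (Rep_ell2 \<xi>)) + Abs_ell2 (F (Rep_ell2 \<eta>)))"
      unfolding R by (auto simp: add Rep_simps R)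
    then show "Abs_ell2 (F (Rep_ell2 (\<xi> + \<eta>))) = Abs_ell2 (F (Rep_ell2 \<xi>)) + Abs_ell2 (F (Rep_ell2 \<eta>))"
      by (simp add: Rep_ell2_inject)
    have "Rep_ell2 (r *\<^sub>R \<xi>) = (\<lambda>x. r *\<^sub>R Rep_ell2 \<xi> x)" by (auto simp: Rep_simps)
    then have "Rep_ell2 (Abs_ell2 (F (Rep_ell2 (r *\<^sub>R \<xi>)))) = Rep_ell2 (r *\<^sub>R Abs_ell2 (F (Rep_ell2 \<xi>)))"
      unfolding R by (auto simp: sc Rep_simps R)
    then show "Abs_ell2 (F (Rep_ell2 (r *\<^sub>R \<xi>))) = r *\<^sub>R Abs_ell2 (F (Rep_ell2 \<xi>))"
      by (simp add: Rep_ell2_inject)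
    have "(norm (Abs_ell2 (F (Rep_ell2 \<xi>))))\<^sup>2 \<le> (M * norm \<xi>)\<^sup>2"
      unfolding norm_ell2_sq R by (rule b)
    then show "norm (Abs_ell2 (F (Rep_ell2 \<xi>))) \<le> norm \<xi> * M"
      using M by (auto simp: mult.commute intro!: power2_le_imp_le)
  qed
  then show ?thesis by (simp add: bounded_linear_Blinfun_apply R)
qed

lemma Rep_diag:
  assumes "\<And>x. norm (T x) \<le> M"
  shows "Rep_ell2 (diag T \<xi>) x = T x (Rep_ell2 \<xi> x)"
proof -
  have M: "M \<ge> 0" using assms[of undefined] norm_ge_zero order_trans by blast
  have le: "(norm (T x (Rep_ell2 \<xi> x)))\<^sup>2 \<le> M\<^sup>2 * (norm (Rep_ell2 \<xi> x))\<^sup>2" for \<xi> x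
    unfolding power_mult_distrib[symmetric]
    by (intro power_mono order_trans[OF norm_blinfun] mult_right_mono assms) auto
  have sm: "(\<lambda>x. M\<^sup>2 * (norm (Rep_ell2 \<xi> x))\<^sup>2) summable_on UNIV" for \<xi> :: "('a,'b) ell2"
    by (intro summable_on_cmult_right summable_ell2)
  have s: "(\<lambda>y. (norm (T y (Rep_ell2 \<xi> y)))\<^sup>2) summable_on UNIV" for \<xi>
    by (rule summable_on_comparison_test[OF sm le]) auto
  have "Rep_ell2 (diag T \<xi>) = (\<lambda>x. T x (Rep_ell2 \<xi> x))"
    unfolding diag_def
  proof (rule Rep_Blinfun[where F = "\<lambda>f x. T x (f x)", OF _ _ s _ M])
    fix \<xi>
    have "(\<Sum>\<^sub>\<infinity>y. (norm (T y (Rep_ell2 \<xi> y)))\<^sup>2) \<le> (\<Sum>\<^sub>\<infinity>y. M\<^sup>2 * (norm (Rep_ell2 \<xi> y))\<^sup>2)"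
      by (rule infsum_mono[OF s sm le])
    also have "\<dots> = (M * norm \<xi>)\<^sup>2" by (simp add: infsum_cmult_right' norm_ell2_sq power_mult_distrib)
    finally show "(\<Sum>\<^sub>\<infinity>y. (norm (T y (Rep_ell2 \<xi> y)))\<^sup>2) \<le> (M * norm \<xi>)\<^sup>2" .
  qed (auto simp: blinfun.add_right blinfun.scaleR_right)
  then show ?thesis by simp
qed

lemma Rep_reindex:
  fixes p :: "'x \<Rightarrow> 'x" and \<xi> :: "('x, 'h::chilbert_space) ell2"
  assumes "bij p"
  shows "Rep_ell2 (reindex p \<xi>) x = Rep_ell2 \<xi> (p x)"
proof -
  have s: "(\<lambda>y. (norm (Rep_ell2 \<xi> (p y)))\<^sup>2) summable_on UNIV" for \<xi> :: "('x,'h) ell2"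
    using summable_on_reindex_bij_betw[OF assms, of "\<lambda>y. (norm (Rep_ell2 \<xi> y))\<^sup>2"] summable_ell2 by simp
  have "Rep_ell2 (reindex p \<xi>) = (\<lambda>x. Rep_ell2 \<xi> (p x))"
    unfolding reindex_def
  proof (rule Rep_Blinfun[where F = "\<lambda>f x. f (p x)" and M=1, OF _ _ s])
    fix \<xi> :: "('x,'h) ell2"
    show "(\<Sum>\<^sub>\<infinity>y. (norm (Rep_ell2 \<xi> (p y)))\<^sup>2) \<le> (1 * norm \<xi>)\<^sup>2"
      using infsum_reindex_bij_betw[OF assms, of "\<lambda>y. (norm (Rep_ell2 \<xi> y))\<^sup>2"] by (simp add: norm_ell2_sq)
  qed auto
  then show ?thesis by simp
qed

lemma Rep_tens: "Rep_ell2 (tens v \<eta>) x = Rep_ell2 \<eta> x *\<^sub>C v"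
  unfolding tens_def
  by (subst Rep_Abs) (auto simp: norm_scaleC power_mult_distrib intro!: summable_on_cmult_left summable_ell2)

lemma grad_summ:
  fixes \<xi> :: "('g::group_add, ('x,'h::chilbert_space) ell2) ell2"
  shows "(\<lambda>x. (norm (Rep_ell2 (Rep_ell2 \<xi> (- g x + t)) x))\<^sup>2) summable_on UNIV"
    and "(\<lambda>t. \<Sum>\<^sub>\<infinity>x. (norm (Rep_ell2 (Rep_ell2 \<xi> (- g x + t)) x))\<^sup>2) summable_on UNIV"
    and "(\<Sum>\<^sub>\<infinity>t. \<Sum>\<^sub>\<infinity>x. (norm (Rep_ell2 (Rep_ell2 \<xi> (- g x + t)) x))\<^sup>2) = (norm \<xi>)\<^sup>2"
proof -
  define h where "h = (\<lambda>(t,x). (norm (Rep_ell2 (Rep_ell2 \<xi> t) x))\<^sup>2)"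
  have h: "h summable_on UNIV \<times> UNIV"
    unfolding h_def
    by (rule summable_on_SigmaI[where g = "\<lambda>t. (norm (Rep_ell2 \<xi> t))\<^sup>2"])
      (auto simp: norm_ell2_sq[of "Rep_ell2 \<xi> _"] intro!: has_sum_infsum summable_ell2 summable_ell2[of \<xi>, simplified norm_ell2_sq[of "Rep_ell2 \<xi> _"]])
  have bij: "bij_betw (\<lambda>(t,x). (- g x + t, x)) (UNIV \<times> UNIV) (UNIV \<times> UNIV)"
    by (rule bij_betw_byWitness[where f' = "\<lambda>(t,x). (g x + t, x)"]) (auto simp flip: add.assoc)
  have h': "(\<lambda>(t,x). h (- g x + t, x)) summable_on UNIV \<times> UNIV"
    using summable_on_reindex_bij_betw[OF bij, of h] h by (simp add: case_prod_unfold)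
  show "(\<lambda>x. (norm (Rep_ell2 (Rep_ell2 \<xi> (- g x + t)) x))\<^sup>2) summable_on UNIV" for t
    using summable_on_SigmaD1[of "\<lambda>t x. h (- g x + t, x)" UNIV "\<lambda>_. UNIV" t] h' by (simp add: h_def)
  show "(\<lambda>t. \<Sum>\<^sub>\<infinity>x. (norm (Rep_ell2 (Rep_ell2 \<xi> (- g x + t)) x))\<^sup>2) summable_on UNIV"
    using summable_on_Sigma_banach[of "\<lambda>t x. h (- g x + t, x)" UNIV "\<lambda>_. UNIV"] h' by (simp add: h_def)
  have "(\<Sum>\<^sub>\<infinity>t. \<Sum>\<^sub>\<infinity>x. h (- g x + t, x)) = infsum (\<lambda>(t,x). h (- g x + t, x)) (UNIV \<times> UNIV)"
    using infsum_Sigma'_banach[OF h'] by simp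
  also have "\<dots> = infsum h (UNIV \<times> UNIV)"
    using infsum_reindex_bij_betw[OF bij, of h] by (simp add: case_prod_unfold)
  also have "\<dots> = (\<Sum>\<^sub>\<infinity>t. \<Sum>\<^sub>\<infinity>x. h (t,x))"
    using infsum_Sigma'_banach[of "\<lambda>t x. h (t,x)"] h by (simp add: case_prod_unfold)
  finally show "(\<Sum>\<^sub>\<infinity>t. \<Sum>\<^sub>\<infinity>x. (norm (Rep_ell2 (Rep_ell2 \<xi> (- g x + t)) x))\<^sup>2) = (norm \<xi>)\<^sup>2"
    by (simp add: h_def norm_ell2_sq)
qed

lemma ell2_ell2_eqI:
  assumes "\<And>t x. Rep_ell2 (Rep_ell2 \<xi> t) x = Rep_ell2 (Rep_ell2 \<eta> t) x"
  shows "\<xi> = \<eta>"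
proof -
  have "Rep_ell2 \<xi> t = Rep_ell2 \<eta> t" for t
    using assms[of t] by (simp add: fun_eq_iff flip: Rep_ell2_inject)
  then show ?thesis by (simp add: fun_eq_iff flip: Rep_ell2_inject[of \<xi>])
qed

lemma Rep_grading_unitary:
  fixes \<xi> :: "('g::group_add, ('x,'h::chilbert_space) ell2) ell2"
  shows "Rep_ell2 (Rep_ell2 (grading_unitary g \<xi>) t) x = Rep_ell2 (Rep_ell2 \<xi> (- g x + t)) x"
proof -
  have inner: "Rep_ell2 (Abs_ell2 (\<lambda>x. Rep_ell2 (Rep_ell2 \<xi> (- g x + t)) x)) = (\<lambda>x. Rep_ell2 (Rep_ell2 \<xi> (- g x + t)) x)"
    for \<xi> :: "('g::group_add, ('x,'h::chilbert_space) ell2) ell2" and t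
    by (rule Rep_Abs) (rule grad_summ)
  have nn: "(norm (Abs_ell2 (\<lambda>x. Rep_ell2 (Rep_ell2 \<xi> (- g x + t)) x)))\<^sup>2 = (\<Sum>\<^sub>\<infinity>x. (norm (Rep_ell2 (Rep_ell2 \<xi> (- g x + t)) x))\<^sup>2)"
    for \<xi> :: "('g::group_add, ('x,'h::chilbert_space) ell2) ell2" and t
    by (simp add: norm_ell2_sq inner)
  have out: "Rep_ell2 (Abs_ell2 (\<lambda>t. Abs_ell2 (\<lambda>x. Rep_ell2 (Rep_ell2 \<xi> (- g x + t)) x)))
     = (\<lambda>t. Abs_ell2 (\<lambda>x. Rep_ell2 (Rep_ell2 \<xi> (- g x + t)) x))"
    for \<xi> :: "('g::group_add, ('x,'h::chilbert_space) ell2) ell2"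
    by (rule Rep_Abs) (simp add: nn grad_summ)
  have "bounded_linear (\<lambda>\<xi>::('g::group_add, ('x,'h::chilbert_space) ell2) ell2. Abs_ell2 (\<lambda>t. Abs_ell2 (\<lambda>x. Rep_ell2 (Rep_ell2 \<xi> (- g x + t)) x)))"
  proof (rule bounded_linear_intro[where K=1])
    fix \<xi> :: "('g::group_add, ('x,'h::chilbert_space) ell2) ell2"
    have "(norm (Abs_ell2 (\<lambda>t. Abs_ell2 (\<lambda>x. Rep_ell2 (Rep_ell2 \<xi> (- g x + t)) x))))\<^sup>2 = (norm \<xi>)\<^sup>2"
      by (subst norm_ell2_sq) (simp add: out nn grad_summ)
    then show "norm (Abs_ell2 (\<lambda>t. Abs_ell2 (\<lambda>x. Rep_ell2 (Rep_ell2 \<xi> (- g x + t)) x))) \<le> norm \<xi> * 1"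
      by (simp add: power2_eq_iff_nonneg)
  next
    fix x y :: "('g, ('x,'h) ell2) ell2" and r :: real
    let ?G = "\<lambda>\<xi>::('g, ('x,'h) ell2) ell2. Abs_ell2 (\<lambda>t. Abs_ell2 (\<lambda>x. Rep_ell2 (Rep_ell2 \<xi> (- g x + t)) x))"
    have G: "Rep_ell2 (Rep_ell2 (?G z) t) i = Rep_ell2 (Rep_ell2 z (- g i + t)) i" for z t i
      by (simp only: out inner)
    show "?G (x + y) = ?G x + ?G y" by (rule ell2_ell2_eqI, subst G) (simp only: G Rep_simps)
    show "?G (r *\<^sub>R x) = r *\<^sub>R ?G x" by (rule ell2_ell2_eqI, subst G) (simp only: G Rep_simps)
  qed
  then show ?thesis unfolding grading_unitary_def
    by (simp add: bounded_linear_Blinfun_apply out inner)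
qed

lemma Rep_ampl: "Rep_ell2 (ampl T \<xi>) x = T (Rep_ell2 \<xi> x)"
  unfolding ampl_def by (rule Rep_diag[of _ "norm T"]) simp

lemma bij_shift: "bij (\<lambda>s. - r + s :: 'g::group_add)"
  by (rule bij_betw_byWitness[where f' = "\<lambda>s. r + s"]) (auto simp flip: add.assoc)

lemma coact_crossed:
  fixes \<alpha> :: "'g::group_add \<Rightarrow> 'h::chilbert_space op \<Rightarrow> 'h op"
  assumes "\<And>s. norm (\<alpha> s a) \<le> M" and cl: "\<And>s. clinear_op (\<alpha> s a)"
  shows "is_op_tensor (grading_coaction (\<lambda>s. s) (cross_embed \<alpha> a o\<^sub>L left_reg r))
           (cross_embed \<alpha> a o\<^sub>L left_reg r) (left_reg r)"
  unfolding is_op_tensor_def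
proof (intro allI)
  fix v :: "('g,'h) ell2" and \<eta> :: "('g,complex) ell2"
  let ?l = "grading_coaction (\<lambda>s. s) (cross_embed \<alpha> a o\<^sub>L left_reg r) (tens v \<eta>)"
  let ?r = "tens ((cross_embed \<alpha> a o\<^sub>L left_reg r) v) (left_reg r \<eta>)"
  have c: "Rep_ell2 (cross_embed \<alpha> a \<xi>) s = \<alpha> (- s) a (Rep_ell2 \<xi> s)" for \<xi> s
    unfolding cross_embed_def by (rule Rep_diag[where M = M]) (rule assms)
  have "Rep_ell2 (Rep_ell2 ?l t) s = Rep_ell2 (Rep_ell2 ?r t) s" for t s
    using cl unfolding grading_coaction_def left_reg_def clinear_op_def
    by (simp add: Rep_grading_unitary Rep_ampl Rep_tens c Rep_reindex[OF bij_shift] Rep_simps) (simp add: algebra_simps flip: add.assoc)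
  then show "?l = ?r" by (rule ell2_ell2_eqI)
qed

lemma Rep_matrix_unit: "Rep_ell2 (matrix_unit a s t \<xi>) x = (if x = s then a (Rep_ell2 \<xi> t) else 0)"
proof -
  have s: "(\<lambda>y. (norm (if y = s then a (Rep_ell2 \<xi> t) else 0))\<^sup>2) summable_on UNIV" for \<xi>
    by (rule finite_nonzero_values_imp_summable_on) (auto intro: finite_subset[of _ "{s}"])
  have "Rep_ell2 (matrix_unit a s t \<xi>) = (\<lambda>x. if x = s then a (Rep_ell2 \<xi> t) else 0)"
    unfolding matrix_unit_def
  proof (rule Rep_Blinfun[where F = "\<lambda>f x. if x = s then a (f t) else 0" and M="norm a", OF _ _ s])
    fix \<xi>
    have "(\<Sum>\<^sub>\<infinity>y. (norm (if y = s then a (Rep_ell2 \<xi> t) else 0))\<^sup>2) = (\<Sum>\<^sub>\<infinity>y\<in>{s}. (norm (a (Rep_ell2 \<xi> t)))\<^sup>2)"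
      by (rule infsum_cong_neutral) auto
    also have "\<dots> \<le> (norm a * norm \<xi>)\<^sup>2"
      by (simp) (intro power_mono order_trans[OF norm_blinfun] mult_left_mono norm_Rep_ell2_le, auto)
    finally show "(\<Sum>\<^sub>\<infinity>y. (norm (if y = s then a (Rep_ell2 \<xi> t) else 0))\<^sup>2) \<le> (norm a * norm \<xi>)\<^sup>2" .
  qed (auto simp: blinfun.add_right blinfun.scaleR_right)
  then show ?thesis by simp
qed

lemma Rep_left_reg: "Rep_ell2 (left_reg r \<eta>) u = Rep_ell2 \<eta> (- r + u)" unfolding left_reg_def by (rule Rep_reindex[OF bij_shift])

lemma coact_stable:
  assumes cl: "clinear_op a"
  shows "is_op_tensor (grading_coaction g (matrix_unit a s t)) (matrix_unit a s t) (left_reg (g s - g t))"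
  unfolding is_op_tensor_def
proof (intro allI)
  fix v \<eta>
  let ?l = "grading_coaction g (matrix_unit a s t) (tens v \<eta>)"
  let ?r = "tens (matrix_unit a s t v) (left_reg (g s - g t) \<eta>)"
  have e: "- (g s - g t) + u = g t + (- g s + u)" for u
    by (metis minus_diff_eq diff_conv_add_uminus add.assoc)
  have "Rep_ell2 (Rep_ell2 ?l u) x = Rep_ell2 (Rep_ell2 ?r u) x" for u x
    using cl unfolding grading_coaction_def clinear_op_def
    by (simp only: Rep_left_reg Rep_grading_unitary Rep_ampl Rep_tens blinfun_apply_blinfun_compose
        o_apply Rep_matrix_unit Rep_simps e minus_minus if_distrib[of "scaleC _"]
        complex_vector.scale_zero_right cong: if_cong)
  then show "?l = ?r" by (rule ell2_ell2_eqI)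
qed


section \<open>Admissible maps\<close>

text \<open>The classes of admissible maps and families range over arbitrary operator systems. Here all
  operator systems live on one Hilbert space of type \<open>'u\<close>. In a right module \<open>(S, m)\<close> the element
  \<open>m x a\<close> is \<open>x \<cdot> a\<close>.\<close>

type_synonym ('u, 'h) module_sys = "'u op set \<times> ('u op \<Rightarrow> 'h op \<Rightarrow> 'u op)"

definition right_module ::
    "'h::chilbert_space op set \<Rightarrow> 'u::chilbert_space op set \<Rightarrow> ('u op \<Rightarrow> 'h op \<Rightarrow> 'u op) \<Rightarrow> bool" where
  "right_module A S m \<longleftrightarrow> (\<forall>x\<in>S. \<forall>a\<in>A. m x a \<in> S) \<and>
     (\<forall>a\<in>A. linear_on S (\<lambda>x. m x a)) \<and> (\<forall>x\<in>S. linear_on A (m x)) \<and>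
     (\<forall>x\<in>S. m x id_blinfun = x) \<and> (\<forall>x\<in>S. \<forall>a\<in>A. \<forall>b\<in>A. m (m x a) b = m x (a o\<^sub>L b))"

text \<open>\<open>\<MM>\<close> is the class of operator systems with a right \<open>A\<close>-module structure under consideration. It
  will contain one element for which \<open>m x a\<close> may fall outside of the system; hence the proviso in
  \<open>module_map\<close>.\<close>

inductive A_admissible :: "'h::chilbert_space op set \<Rightarrow> ('u::chilbert_space, 'h) module_sys set \<Rightarrow>
    ('u, 'h) module_sys \<Rightarrow> ('u, 'h) module_sys \<Rightarrow> ('u op \<Rightarrow> 'u op) \<Rightarrow> bool"
  for A :: "'h op set" and \<MM> :: "('u, 'h) module_sys set" where
  module_map: "A_admissible A \<MM> (S, m) (T, n) \<phi>"
    if "(S, m) \<in> \<MM>" "(T, n) \<in> \<MM>" "cp_map S T \<phi>"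
      "\<And>x a. x \<in> S \<Longrightarrow> a \<in> A \<Longrightarrow> m x a \<in> S \<Longrightarrow> \<phi> (m x a) = n (\<phi> x) a"
| conj_source: "A_admissible A \<MM> (S, m) (T, n) (\<lambda>x. \<phi> (b o\<^sub>L x o\<^sub>L b'))"
    if "A_admissible A \<MM> (S, m) (T, n) \<phi>" "b \<in> S" "is_adjoint b b'"
      "\<And>x. x \<in> S \<Longrightarrow> b o\<^sub>L x o\<^sub>L b' \<in> S"
| conj_target: "A_admissible A \<MM> (S, m) (T, n) (\<lambda>x. d o\<^sub>L \<phi> x o\<^sub>L d')"
    if "A_admissible A \<MM> (S, m) (T, n) \<phi>" "d \<in> T" "is_adjoint d d'"
      "\<And>x. x \<in> S \<Longrightarrow> d o\<^sub>L \<phi> x o\<^sub>L d' \<in> T"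
| functional: "A_admissible A \<MM> (S, m) (T, n) (\<lambda>x. \<rho> x *\<^sub>C d)"
    if "(S, m) \<in> \<MM>" "(T, n) \<in> \<MM>" "linear_on S \<rho>"
      "\<And>x. x \<in> S \<Longrightarrow> positive_op x \<Longrightarrow> \<rho> x \<in> \<real>\<^sub>\<ge>\<^sub>0" "d \<in> T" "positive_op d"
| compose: "A_admissible A \<MM> L N (\<lambda>x. \<psi> (\<phi> x))"
    if "A_admissible A \<MM> L M \<phi>" "A_admissible A \<MM> M N \<psi>"
| scale: "A_admissible A \<MM> M N (\<lambda>x. r *\<^sub>R \<phi> x)" if "A_admissible A \<MM> M N \<phi>" "r > 0"
| add: "A_admissible A \<MM> M N (\<lambda>x. \<phi> x + \<psi> x)"
    if "A_admissible A \<MM> M N \<phi>" "A_admissible A \<MM> M N \<psi>"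
| cong: "A_admissible A \<MM> (S, m) N \<psi>"
    if "A_admissible A \<MM> (S, m) N \<phi>" "\<And>x. x \<in> S \<Longrightarrow> \<psi> x = \<phi> x"


section \<open>Admissible families\<close>

text \<open>A family of maps is the set of its members; a member is a pair of its domain \<open>S\<close> and a function
  that is \<open>undefined\<close> outside of \<open>S\<close>. Index sets are subsets of a type \<open>'i\<close>.\<close>

type_synonym 'u family = "('u op set \<times> ('u op \<Rightarrow> 'u op)) set"

definition members :: "'i set \<Rightarrow> ('i \<Rightarrow> 'u::chilbert_space op set) \<Rightarrow> ('i \<Rightarrow> 'u op \<Rightarrow> 'u op) \<Rightarrow> 'u family"
  where "members I S \<psi> = (\<lambda>i. (S i, restrict (\<psi> i) (S i))) ` I"

definition composites :: "'u::chilbert_space family \<Rightarrow> 'u family \<Rightarrow> 'u family" where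
  "composites \<FF> \<GG> =
     {(S, restrict (\<lambda>x. \<psi> (\<phi> x)) S) |S \<phi> T \<psi>. (S, \<phi>) \<in> \<FF> \<and> (T, \<psi>) \<in> \<GG> \<and> \<phi> ` S \<subseteq> T}"

text \<open>A map added to a family may be given any domain on which the defining expression makes
  sense.\<close>

definition new_member :: "'u::chilbert_space op set \<Rightarrow> 'u op set \<Rightarrow> 'u op set \<Rightarrow> ('u op \<Rightarrow> 'u op) \<Rightarrow> bool"
  where "new_member B D S \<theta> \<longleftrightarrow>
     operator_system S \<and> S \<subseteq> B \<and> cp_map S D \<theta> \<and> \<theta> \<in> extensional S"

inductive_set algebraic_additions ::
    "'u::chilbert_space op set \<Rightarrow> 'u op set \<Rightarrow> 'u family \<Rightarrow> 'u family"
  for B D :: "'u op set" and \<FF> :: "'u family" where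
  conj_source: "(S, \<theta>) \<in> algebraic_additions B D \<FF>"
    if "new_member B D S \<theta>" "(T, \<psi>) \<in> \<FF>" "b \<in> B" "is_adjoint b b'"
      "\<And>x. x \<in> S \<Longrightarrow> b o\<^sub>L x o\<^sub>L b' \<in> T \<and> \<theta> x = \<psi> (b o\<^sub>L x o\<^sub>L b')"
| conj_target: "(S, \<theta>) \<in> algebraic_additions B D \<FF>"
    if "new_member B D S \<theta>" "(S, \<psi>) \<in> \<FF>" "d \<in> D" "is_adjoint d d'"
      "\<And>x. x \<in> S \<Longrightarrow> \<theta> x = d o\<^sub>L \<psi> x o\<^sub>L d'"
| finite_sum: "(S, \<theta>) \<in> algebraic_additions B D \<FF>"
    if "new_member B D S \<theta>" "\<Psi> \<noteq> []" "\<And>\<psi>. \<psi> \<in> set \<Psi> \<Longrightarrow> (S, \<psi>) \<in> \<FF>"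
      "\<And>x. x \<in> S \<Longrightarrow> \<theta> x = (\<Sum>\<psi>\<leftarrow>\<Psi>. \<psi> x)"

subsection \<open>Actions\<close>

type_synonym ('u, 'g) action_sys = "'u op set \<times> ('g \<Rightarrow> 'u op \<Rightarrow> 'u op)"

definition action_system ::
    "'u::chilbert_space op set \<Rightarrow> ('g::group_add \<Rightarrow> 'u op \<Rightarrow> 'u op) \<Rightarrow> bool" where
  "action_system S \<beta> \<longleftrightarrow> operator_system S \<and>
     (\<forall>t. \<beta> t ` S = S \<and> complete_isometry S (\<beta> t)) \<and>
     (\<forall>x\<in>S. \<beta> 0 x = x) \<and> (\<forall>s t. \<forall>x\<in>S. \<beta> (s + t) x = \<beta> s (\<beta> t x)) \<and>
     (cstar_algebra S \<longrightarrow> (\<forall>t. star_automorphism S (\<beta> t)))"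

definition index_action :: "'i set \<Rightarrow> ('g::group_add \<Rightarrow> 'i \<Rightarrow> 'i) \<Rightarrow> bool" where
  "index_action I act \<longleftrightarrow> (\<forall>t. \<forall>i\<in>I. act t i \<in> I) \<and> (\<forall>i\<in>I. act 0 i = i) \<and>
     (\<forall>s t. \<forall>i\<in>I. act (s + t) i = act s (act t i))"

definition gamma_family :: "('u::chilbert_space, 'g::group_add) action_sys \<Rightarrow> ('u, 'g) action_sys \<Rightarrow>
    'i set \<Rightarrow> ('g \<Rightarrow> 'i \<Rightarrow> 'i) \<Rightarrow> ('i \<Rightarrow> 'u op set) \<Rightarrow> ('i \<Rightarrow> 'u op \<Rightarrow> 'u op) \<Rightarrow> bool" where
  "gamma_family M N I act S \<psi> \<longleftrightarrow> (case (M, N) of ((B, \<beta>), (D, \<gamma>)) \<Rightarrow>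
     action_system B \<beta> \<and> action_system D \<gamma> \<and> index_action I act \<and>
     (\<forall>i\<in>I. operator_system (S i) \<and> S i \<subseteq> B \<and> cp_map (S i) D (\<psi> i)) \<and>
     (\<forall>t. \<forall>i\<in>I. \<beta> t ` S i \<subseteq> S (act t i) \<and> (\<forall>x\<in>S i. \<psi> (act t i) (\<beta> t x) = \<gamma> t (\<psi> i x))))"

inductive_set action_additions :: "('u::chilbert_space, 'g::group_add) action_sys \<Rightarrow>
    ('u, 'g) action_sys \<Rightarrow> 'u family \<Rightarrow> 'u family"
  for M N :: "('u, 'g) action_sys" and \<FF> :: "'u family" where
  algebraic: "m \<in> action_additions M N \<FF>" if "m \<in> algebraic_additions (fst M) (fst N) \<FF>"
| act_target: "(S, \<theta>) \<in> action_additions M N \<FF>"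
    if "new_member (fst M) (fst N) S \<theta>" "(S, \<psi>) \<in> \<FF>" "\<And>x. x \<in> S \<Longrightarrow> \<theta> x = snd N t (\<psi> x)"
| act_source: "(S, \<theta>) \<in> action_additions M N \<FF>"
    if "new_member (fst M) (fst N) S \<theta>" "(T, \<psi>) \<in> \<FF>"
      "\<And>x. x \<in> S \<Longrightarrow> snd M t x \<in> T \<and> \<theta> x = \<psi> (snd M t x)"

inductive gamma_admissible :: "'i itself \<Rightarrow> ('u::chilbert_space, 'g::group_add) action_sys \<Rightarrow>
    ('u, 'g) action_sys \<Rightarrow> 'u family \<Rightarrow> bool"
  for ty :: "'i itself" where
  family: "gamma_admissible ty M N (members I S \<psi>)"
    if "gamma_family M N (I :: 'i set) act S \<psi>"
| additions: "gamma_admissible ty M N (\<FF> \<union> \<GG>)"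
    if "gamma_admissible ty M N \<FF>" "\<GG> \<subseteq> action_additions M N \<FF>"
| compose: "gamma_admissible ty L N (composites \<FF> \<GG>)"
    if "gamma_admissible ty L M \<FF>" "gamma_admissible ty M N \<GG>"
| union: "gamma_admissible ty M N (\<FF> \<union> \<GG>)"
    if "gamma_admissible ty M N \<FF>" "gamma_admissible ty M N \<GG>"

subsection \<open>Coactions\<close>

type_synonym ('u, 'g) coaction_sys = "'u op set \<times> ('u op \<Rightarrow> ('g, 'u) ell2 op)"

text \<open>A completely positive map between unital operator systems is non-degenerate iff it is
  unital.\<close>

definition coaction :: "'u::chilbert_space op set \<Rightarrow> ('u op \<Rightarrow> ('g::group_add, 'u) ell2 op) \<Rightarrow> bool" where
  "coaction S \<delta> \<longleftrightarrow> operator_system S \<and> cp_map S (min_tensor S group_alg) \<delta> \<and>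
     (\<forall>p. is_unit S p \<longrightarrow> \<delta> p = ampl p) \<and>
     (cstar_algebra S \<longrightarrow> (\<forall>x\<in>S. \<forall>y\<in>S. \<delta> (x o\<^sub>L y) = \<delta> x o\<^sub>L \<delta> y))"

text \<open>\<open>R = \<psi> \<otimes> id\<close> on \<open>S \<otimes> C\<^sup>*\<^sub>r(\<Gamma>)\<close>\<close>

definition is_amplification :: "'u::chilbert_space op set \<Rightarrow> ('u op \<Rightarrow> 'v::chilbert_space op) \<Rightarrow>
    (('g::group_add, 'u) ell2 op \<Rightarrow> ('g, 'v) ell2 op) \<Rightarrow> bool" where
  "is_amplification S \<psi> R \<longleftrightarrow>
     linear_on (min_tensor S group_alg) R \<and> bounded_on (min_tensor S group_alg) R \<and>
     (\<forall>x\<in>S. \<forall>c\<in>group_alg. \<forall>Y. is_op_tensor Y x c \<longrightarrow> is_op_tensor (R Y) (\<psi> x) c)"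

text \<open>\<open>R = id \<otimes> f\<close> on \<open>S \<otimes> C\<^sup>*\<^sub>r(\<Gamma>)\<close> for some \<open>f\<close> in the dual of \<open>C\<^sup>*\<^sub>r(\<Gamma>)\<close>\<close>

definition is_slice_map :: "'u::chilbert_space op set \<Rightarrow>
    (('g::group_add, 'u) ell2 op \<Rightarrow> 'u op) \<Rightarrow> bool" where
  "is_slice_map S R \<longleftrightarrow>
     linear_on (min_tensor S group_alg) R \<and> bounded_on (min_tensor S group_alg) R \<and>
     (\<exists>f :: ('g, complex) ell2 op \<Rightarrow> complex. linear_on group_alg f \<and> bounded_on group_alg f \<and>
       (\<forall>x\<in>S. \<forall>c\<in>group_alg. \<forall>Y. is_op_tensor Y x c \<longrightarrow> R Y = f c *\<^sub>C x))"

text \<open>\<open>\<CC>\<close> is the class of operator systems with a coaction under consideration.\<close>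

definition gamma_cofamily :: "('u::chilbert_space, 'g::group_add) coaction_sys set \<Rightarrow>
    ('u, 'g) coaction_sys \<Rightarrow> ('u, 'g) coaction_sys \<Rightarrow>
    'i set \<Rightarrow> ('i \<Rightarrow> 'i) \<Rightarrow> ('i \<Rightarrow> 'u op set) \<Rightarrow> ('i \<Rightarrow> 'u op \<Rightarrow> 'u op) \<Rightarrow> bool" where
  "gamma_cofamily \<CC> M N I \<eta> S \<psi> \<longleftrightarrow> (case (M, N) of ((B, \<delta>\<^sub>B), (D, \<delta>\<^sub>D)) \<Rightarrow>
     (B, \<delta>\<^sub>B) \<in> \<CC> \<and> (D, \<delta>\<^sub>D) \<in> \<CC> \<and> \<eta> ` I \<subseteq> I \<and>
     (\<forall>i\<in>I. operator_system (S i) \<and> S i \<subseteq> B \<and> cp_map (S i) D (\<psi> i)) \<and>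
     (\<forall>i\<in>I. \<delta>\<^sub>B ` S i \<subseteq> min_tensor (S (\<eta> i)) group_alg \<and>
        (\<exists>R. is_amplification (S (\<eta> i)) (\<psi> (\<eta> i)) R \<and> (\<forall>x\<in>S i. R (\<delta>\<^sub>B x) = \<delta>\<^sub>D (\<psi> i x)))))"

inductive_set coaction_additions :: "('u::chilbert_space, 'g::group_add) coaction_sys \<Rightarrow>
    ('u, 'g) coaction_sys \<Rightarrow> 'u family \<Rightarrow> 'u family"
  for M N :: "('u, 'g) coaction_sys" and \<FF> :: "'u family" where
  algebraic: "m \<in> coaction_additions M N \<FF>" if "m \<in> algebraic_additions (fst M) (fst N) \<FF>"
| slice_target: "(S, \<theta>) \<in> coaction_additions M N \<FF>"
    if "new_member (fst M) (fst N) S \<theta>" "(S, \<psi>) \<in> \<FF>" "is_slice_map (fst N) R"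
      "\<And>x. x \<in> S \<Longrightarrow> snd N (\<psi> x) \<in> min_tensor (fst N) group_alg \<and> \<theta> x = R (snd N (\<psi> x))"
| slice_source: "(S, \<theta>) \<in> coaction_additions M N \<FF>"
    if "new_member (fst M) (fst N) S \<theta>" "(T, \<psi>) \<in> \<FF>" "is_slice_map T R"
      "\<And>x. x \<in> S \<Longrightarrow> snd M x \<in> min_tensor T group_alg \<and> R (snd M x) \<in> T \<and> \<theta> x = \<psi> (R (snd M x))"

inductive gamma_coadmissible :: "'i itself \<Rightarrow> ('u::chilbert_space, 'g::group_add) coaction_sys set \<Rightarrow>
    ('u, 'g) coaction_sys \<Rightarrow> ('u, 'g) coaction_sys \<Rightarrow> 'u family \<Rightarrow> bool"
  for ty :: "'i itself" and \<CC> :: "('u, 'g) coaction_sys set" where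
  cofamily: "gamma_coadmissible ty \<CC> M N (members I S \<psi>)"
    if "gamma_cofamily \<CC> M N (I :: 'i set) \<eta> S \<psi>"
| additions: "gamma_coadmissible ty \<CC> M N (\<FF> \<union> \<GG>)"
    if "gamma_coadmissible ty \<CC> M N \<FF>" "\<GG> \<subseteq> coaction_additions M N \<FF>"
| compose: "gamma_coadmissible ty \<CC> L N (composites \<FF> \<GG>)"
    if "gamma_coadmissible ty \<CC> L M \<FF>" "gamma_coadmissible ty \<CC> M N \<GG>"
| union: "gamma_coadmissible ty \<CC> M N (\<FF> \<union> \<GG>)"
    if "gamma_coadmissible ty \<CC> M N \<FF>" "gamma_coadmissible ty \<CC> M N \<GG>"


section \<open>Nuclearity\<close>

text \<open>The common Hilbert space \<open>(H \<otimes> \<ell>\<^sup>2(\<Gamma>)) \<oplus> (H \<otimes> \<ell>\<^sup>2(\<Gamma>\<^sup>\<infinity>)) \<oplus> K\<close> has room for the crossed product, for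
  \<open>A \<otimes> B(\<ell>\<^sup>2(\<Gamma>\<^sup>\<infinity>))\<close> and, since \<open>K\<close> is arbitrary, for the operator systems over which a composition of
  admissible maps or families may factor.\<close>

type_synonym ('g, 'h, 'k) universe = "('g, 'h) ell2 \<times> ('g tuples, 'h) ell2 \<times> 'k"

definition in1 :: "('g, 'h::chilbert_space) ell2 \<Rightarrow>\<^sub>L ('g, 'h, 'k::chilbert_space) universe"
  where "in1 = Blinfun (\<lambda>x. (x, 0, 0))"

definition out1 :: "('g, 'h::chilbert_space, 'k::chilbert_space) universe \<Rightarrow>\<^sub>L ('g, 'h) ell2"
  where "out1 = Blinfun (\<lambda>(x, y, z). x)"

definition in2 :: "('g tuples, 'h::chilbert_space) ell2 \<Rightarrow>\<^sub>L ('g, 'h, 'k::chilbert_space) universe"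
  where "in2 = Blinfun (\<lambda>y. (0, y, 0))"

definition out2 :: "('g, 'h::chilbert_space, 'k::chilbert_space) universe \<Rightarrow>\<^sub>L ('g tuples, 'h) ell2"
  where "out2 = Blinfun (\<lambda>(x, y, z). y)"

definition lift1 :: "('g, 'h::chilbert_space) ell2 op \<Rightarrow> ('g, 'h, 'k::chilbert_space) universe op"
  where "lift1 x = in1 o\<^sub>L x o\<^sub>L out1"

definition lift2 :: "('g tuples, 'h::chilbert_space) ell2 op \<Rightarrow> ('g, 'h, 'k::chilbert_space) universe op"
  where "lift2 x = in2 o\<^sub>L x o\<^sub>L out2"

definition univ_crossed :: "'h::chilbert_space op set \<Rightarrow> ('g::group_add \<Rightarrow> 'h op \<Rightarrow> 'h op) \<Rightarrow>
    ('g, 'h, 'k::chilbert_space) universe op set"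
  where "univ_crossed A \<alpha> = lift1 ` crossed_product A \<alpha>"

definition univ_stable ::
    "'h::chilbert_space op set \<Rightarrow> ('g::group_add, 'h, 'k::chilbert_space) universe op set"
  where "univ_stable A = lift2 ` stable_alg A"

definition univ_matrix :: "'h::chilbert_space op set \<Rightarrow> 'g::group_add tuples set \<Rightarrow>
    ('g, 'h, 'k::chilbert_space) universe op set"
  where "univ_matrix A F = lift2 ` matrix_alg A F"

definition crossed_mult :: "('g::group_add \<Rightarrow> 'h::chilbert_space op \<Rightarrow> 'h op) \<Rightarrow>
    ('g, 'h, 'k::chilbert_space) universe op \<Rightarrow> 'h op \<Rightarrow> ('g, 'h, 'k) universe op"
  where "crossed_mult \<alpha> x a = x o\<^sub>L lift1 (cross_embed \<alpha> a)"

definition stable_mult :: "('g::group_add \<Rightarrow> 'h::chilbert_space op \<Rightarrow> 'h op) \<Rightarrow>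
    ('g, 'h, 'k::chilbert_space) universe op \<Rightarrow> 'h op \<Rightarrow> ('g, 'h, 'k) universe op"
  where "stable_mult \<alpha> x a = x o\<^sub>L lift2 (tuple_embed \<alpha> a)"

definition crossed_act :: "'g::group_add \<Rightarrow> ('g, 'h::chilbert_space, 'k::chilbert_space) universe op \<Rightarrow>
    ('g, 'h, 'k) universe op"
  where "crossed_act r x = lift1 (left_reg r) o\<^sub>L x o\<^sub>L lift1 (left_reg (- r))"

definition stable_act :: "'g::group_add \<Rightarrow> ('g, 'h::chilbert_space, 'k::chilbert_space) universe op \<Rightarrow>
    ('g, 'h, 'k) universe op"
  where "stable_act r x = lift2 (tuple_unitary r) o\<^sub>L x o\<^sub>L lift2 (tuple_unitary (- r))"

definition crossed_coact :: "('g::group_add, 'h::chilbert_space, 'k::chilbert_space) universe op \<Rightarrow>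
    ('g, ('g, 'h, 'k) universe) ell2 op"
  where "crossed_coact x = ampl in1 o\<^sub>L grading_coaction (\<lambda>s. s) (out1 o\<^sub>L x o\<^sub>L in1) o\<^sub>L ampl out1"

definition stable_coact :: "('g::group_add, 'h::chilbert_space, 'k::chilbert_space) universe op \<Rightarrow>
    ('g, ('g, 'h, 'k) universe) ell2 op"
  where "stable_coact x = ampl in2 o\<^sub>L grading_coaction tuple_prod (out2 o\<^sub>L x o\<^sub>L in2) o\<^sub>L ampl out2"

text \<open>For infinite \<open>\<Gamma>\<close> the module action and the coaction on \<open>A \<otimes> B(\<ell>\<^sup>2(\<Gamma>\<^sup>\<infinity>))\<close> given by these
  formulas do not take all their values in \<open>A \<otimes> B(\<ell>\<^sup>2(\<Gamma>\<^sup>\<infinity>))\<close> and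
  \<open>A \<otimes> B(\<ell>\<^sup>2(\<Gamma>\<^sup>\<infinity>)) \<otimes> C\<^sup>*\<^sub>r(\<Gamma>)\<close>; they do on the matrix algebras over finite index sets.
  The two structures are therefore included by hand.\<close>

definition module_systems :: "'h::chilbert_space op set \<Rightarrow> ('g::group_add \<Rightarrow> 'h op \<Rightarrow> 'h op) \<Rightarrow>
    (('g, 'h, 'k::chilbert_space) universe, 'h) module_sys set" where
  "module_systems A \<alpha> = insert (univ_stable A, stable_mult \<alpha>)
     {(S, m). operator_system S \<and> right_module A S m}"

definition coaction_systems :: "'h::chilbert_space op set \<Rightarrow>
    (('g::group_add, 'h, 'k::chilbert_space) universe, 'g) coaction_sys set" where
  "coaction_systems A = insert (univ_stable A, stable_coact) {(S, \<delta>). coaction S \<delta>}"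

text \<open>\<open>\<P>\<close> is the class of \<open>\<Gamma>\<close>-(co)admissible families under consideration.\<close>

definition admissible_family :: "'h::chilbert_space op set \<Rightarrow> ('u::chilbert_space, 'h) module_sys set \<Rightarrow>
    ('u family \<Rightarrow> bool) \<Rightarrow> ('u op \<Rightarrow> 'h op \<Rightarrow> 'u op) \<Rightarrow> ('u, 'h) module_sys \<Rightarrow> 'u family \<Rightarrow> bool" where
  "admissible_family A \<MM> \<P> m N \<FF> \<longleftrightarrow> \<P> \<FF> \<and> (\<forall>(S, \<psi>)\<in>\<FF>. A_admissible A \<MM> (S, m) N \<psi>)"

definition nuclear_via :: "'h::chilbert_space op set \<Rightarrow> ('g::group_add \<Rightarrow> 'h op \<Rightarrow> 'h op) \<Rightarrow>
    (('g, 'h, 'k::chilbert_space) universe family \<Rightarrow> bool) \<Rightarrow>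
    (('g, 'h, 'k) universe family \<Rightarrow> bool) \<Rightarrow> bool" where
  "nuclear_via A \<alpha> \<P> \<Q> \<longleftrightarrow> (\<forall>\<epsilon>>0. \<forall>X. finite X \<and> X \<subseteq> univ_crossed A \<alpha> \<longrightarrow>
     (\<exists>\<phi> \<psi>. ccp_map (univ_crossed A \<alpha>) (univ_stable A) \<phi> \<and>
        (\<exists>\<FF>. admissible_family A (module_systems A \<alpha>) \<P>
                (crossed_mult \<alpha>) (univ_stable A, stable_mult \<alpha>) \<FF> \<and>
              (univ_crossed A \<alpha>, restrict \<phi> (univ_crossed A \<alpha>)) \<in> \<FF>) \<and>
        (\<forall>F. finite F \<longrightarrow> ccp_map (univ_matrix A F) (univ_crossed A \<alpha>) (\<psi> F)) \<and>
        admissible_family A (module_systems A \<alpha>) \<Q>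
          (stable_mult \<alpha>) (univ_crossed A \<alpha>, crossed_mult \<alpha>)
          (members {F. finite F} (univ_matrix A) \<psi>) \<and>
        (\<exists>F. finite F \<and> (\<forall>b\<in>X.
           norm (\<psi> F (lift2 (proj_on F) o\<^sub>L \<phi> b o\<^sub>L lift2 (proj_on F)) - b) \<le> \<epsilon>))))"

definition nuclear_as_module :: "'k::chilbert_space itself \<Rightarrow> 'i itself \<Rightarrow>
    'h::chilbert_space op set \<Rightarrow> ('g::group_add \<Rightarrow> 'h op \<Rightarrow> 'h op) \<Rightarrow> bool" where
  "nuclear_as_module _ ty A \<alpha> \<longleftrightarrow>
     (let B = (univ_crossed A \<alpha> :: ('g, 'h, 'k) universe op set, crossed_act);
          D = (univ_stable A, stable_act)
      in nuclear_via A \<alpha> (gamma_admissible ty B D) (gamma_admissible ty D B))"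

definition nuclear_as_comodule :: "'k::chilbert_space itself \<Rightarrow> 'i itself \<Rightarrow>
    'h::chilbert_space op set \<Rightarrow> ('g::group_add \<Rightarrow> 'h op \<Rightarrow> 'h op) \<Rightarrow> bool" where
  "nuclear_as_comodule _ ty A \<alpha> \<longleftrightarrow>
     (let B = (univ_crossed A \<alpha> :: ('g, 'h, 'k) universe op set, crossed_coact);
          D = (univ_stable A, stable_coact);
          \<CC> = coaction_systems A
      in nuclear_via A \<alpha> (gamma_coadmissible ty \<CC> B D) (gamma_coadmissible ty \<CC> D B))"

end

theory Submission
  imports Defs
begin

text \<open>Nuclearity approximates the identity of the crossed product by \<open>\<psi>\<^sub>F \<circ> \<phi>\<^sub>F\<close>, with completely
  positive contractions into and out of matrices over \<open>A\<close>. If \<open>\<Phi>\<close> has finite rank on \<open>A\<close>, then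
  \<open>\<psi>\<^sub>F \<circ> (\<Phi> \<otimes> id) \<circ> \<phi>\<^sub>F\<close> has finite rank on the crossed product and at most the same cb norm, because
  completely positive contractions are completely contractive and \<open>\<Phi> \<otimes> id\<close> acts on matrices over \<open>A\<close>.
  Conversely the canonical embedding of \<open>A\<close> into the crossed product and the compression
  \<open>x \<mapsto> x\<^sub>e\<^sub>e\<close> back to \<open>A\<close> are complete contractions, so a finite rank map on the crossed product
  induces one on \<open>A\<close> with at most the same cb norm. Hence both algebras are approximable with the same
  constants.\<close>

text \<open>The maps approximating the identity of A converge only pointwise, so the order of
  choices matters: nuclearity supplies the finite set F and the two completely positive maps, and
  only then is \<Phi> chosen, almost fixing the finitely many matrix entries that occur. As F is
  finite, \<Phi> \<otimes> id is just \<Phi> applied to entries, and closeness of the entries gives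
  closeness in norm up to the factor |F|^2. In the other direction the embedding of A is block
  diagonal with blocks \<alpha> (- u). The obstacle is that every automorphism has to be completely
  contractive; this is deduced from contractivity of *-homomorphisms, applied to matrix algebras
  over A. Operator systems have a projection as unit, possibly different from the identity operator,
  so positivity arguments have to take place on the range of that projection.\<close>

instance chilbert_space \<subseteq> banach ..

section \<open>Operators on complex Hilbert spaces\<close>

lemma cinner_add_right: "cinner x (y + z) = cinner x y + cinner x z"
  by (simp add: cinner_def inner_add_right complex_eq_iff)

lemma cinner_zero [simp]: "cinner x 0 = 0" "cinner 0 x = 0"
  by (simp_all add: cinner_def complex_eq_iff)

lemma Re_cinner: "Re (cinner x y) = inner x y" and Im_cinner: "Im (cinner x y) = inner (\<i> *\<^sub>C x) y"
  by (simp_all add: cinner_def)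

text \<open>Both coordinates of \<open>cinner\<close> are real inner products, so identities with
  complex scalars are reduced to real scalars and multiplication by i.\<close>

lemma scaleC_split: "c *\<^sub>C x = Re c *\<^sub>R x + Im c *\<^sub>R (\<i> *\<^sub>C (x :: 'h::complex_vector))"
  unfolding scaleR_scaleC scaleC_scaleC scaleC_add_left[symmetric]
  by (metis complex_eq mult.commute)

lemma inner_i_right: "inner (x :: 'h::chilbert_space) (\<i> *\<^sub>C y) = - inner (\<i> *\<^sub>C x) y"
  by (simp add: inner_scaleC_left complex_vector.scale_minus_left)

lemma cinner_scaleC_right: "cinner x (c *\<^sub>C y) = c * cinner x y"
  by (subst scaleC_split)
    (simp add: cinner_def complex_eq_iff inner_add_right inner_i_right scaleC_scaleC
      scaleC_one complex_vector.scale_minus_left)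

lemma cinner_commute: "cinner y x = cnj (cinner x y)"
  by (simp add: cinner_def complex_eq_iff inner_commute inner_i_right[of y x])

lemma cinner_scaleC_left: "cinner (c *\<^sub>C x) y = cnj c * cinner x y"
  by (metis cinner_commute cinner_scaleC_right complex_cnj_mult)

lemma cinner_add_left: "cinner (x + y) z = cinner x z + cinner y z"
  by (metis cinner_commute cinner_add_right complex_cnj_add)

lemma is_adjoint_inner: "is_adjoint T T' \<Longrightarrow> inner (T x) y = inner x (T' y)"
  by (metis is_adjoint_def Re_cinner)

lemma is_adjointI:
  fixes T T' :: "'h::chilbert_space op"
  assumes "clinear_op T" "\<And>x y. inner (T x) y = inner x (T' y)"
  shows "is_adjoint T T'"
  using assms by (simp add: is_adjoint_def cinner_def clinear_op_def flip: assms(2))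

lemma is_adjoint_sym: "is_adjoint T T' \<Longrightarrow> is_adjoint T' T"
  unfolding is_adjoint_def by (metis cinner_commute)

lemma is_adjoint_compose:
  "is_adjoint S S' \<Longrightarrow> is_adjoint T T' \<Longrightarrow> is_adjoint (S o\<^sub>L T) (T' o\<^sub>L S')"
  by (simp add: is_adjoint_def)

lemma is_adjoint_add: "is_adjoint S S' \<Longrightarrow> is_adjoint T T' \<Longrightarrow> is_adjoint (S + T) (S' + T')"
  by (simp add: is_adjoint_def blinfun.add_left cinner_add_left cinner_add_right)

lemma is_adjoint_scaleC: "is_adjoint T T' \<Longrightarrow> is_adjoint (c *\<^sub>C T) (cnj c *\<^sub>C T')"
  by (simp add: is_adjoint_def scaleC_blinfun.rep_eq cinner_scaleC_left cinner_scaleC_right)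

lemma is_adjoint_unique:
  assumes "is_adjoint T S" "is_adjoint T S'" shows "S = S'"
proof (rule blinfun_eqI)
  fix y
  have "inner x (S y - S' y) = 0" for x
    using is_adjoint_inner[OF assms(1), of x y] is_adjoint_inner[OF assms(2), of x y]
    by (simp add: inner_diff_right)
  then show "S y = S' y" by (metis inner_eq_zero_iff right_minus_eq)
qed

lemma norm_adjoint_le:
  assumes "is_adjoint T T'" shows "norm T' \<le> norm T"
proof (rule norm_blinfun_bound)
  fix y
  have "(norm (T' y))\<^sup>2 = inner (T (T' y)) y"
    by (simp add: power2_norm_eq_inner is_adjoint_inner[OF assms])
  also have "\<dots> \<le> norm T * norm (T' y) * norm y"
    by (rule order_trans[OF norm_cauchy_schwarz]) (intro mult_right_mono norm_blinfun norm_ge_zero)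
  finally have "norm (T' y) * norm (T' y) \<le> norm (T' y) * (norm T * norm y)"
    by (simp add: power2_eq_square algebra_simps)
  then show "norm (T' y) \<le> norm T * norm y"
    by (cases "norm (T' y) = 0") (auto simp: mult_le_cancel_left)
qed simp

lemma norm_adjoint: "is_adjoint T T' \<Longrightarrow> norm T' = norm T"
  by (meson antisym is_adjoint_sym norm_adjoint_le)

text \<open>As p is a left unit, p p' = p', and p p' is self-adjoint. So the unit of an operator
  system is a projection, although \<open>is_unit\<close> does not say so.\<close>

lemma unit_self_adjoint:
  assumes "is_unit S p" "p' \<in> S" "is_adjoint p p'" shows "p' = p"
proof -
  have "p o\<^sub>L p' = p'" using assms by (simp add: is_unit_def)
  with is_adjoint_compose[OF assms(3) is_adjoint_sym[OF assms(3)]] have "is_adjoint p' p'" by simp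
  then show ?thesis using assms(3) is_adjoint_sym is_adjoint_unique by blast
qed

lemma projection_norm_sq:
  assumes "is_adjoint p p" "p o\<^sub>L p = p" shows "inner x (p x) = (norm (p x))\<^sup>2"
  using assms by (metis is_adjoint_inner power2_norm_eq_inner blinfun_apply_blinfun_compose comp_apply)

lemma projection_contractive:
  assumes "is_adjoint p p" "p o\<^sub>L p = p" shows "norm (p x) \<le> norm x"
proof -
  have "(norm (p x))\<^sup>2 \<le> norm x * norm (p x)"
    by (metis projection_norm_sq[OF assms] norm_cauchy_schwarz)
  then show ?thesis
    by (cases "norm (p x) = 0") (auto simp: power2_eq_square mult_le_cancel_right)
qed

lemma clinear_op_compose: "clinear_op S \<Longrightarrow> clinear_op T \<Longrightarrow> clinear_op (S o\<^sub>L T)"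
  by (simp add: clinear_op_def)

lemma csubspace_clinear_op: "csubspace {T. clinear_op T}"
  by (rule complex_vector.subspaceI)
    (auto simp: clinear_op_def blinfun.add_left scaleC_add_right scaleC_blinfun.rep_eq
      scaleC_scaleC mult.commute)

lemma closed_clinear_op: "closed {T :: 'k::chilbert_space \<Rightarrow>\<^sub>L 'l::chilbert_space. clinear_op T}"
proof -
  have "closed {T :: 'k \<Rightarrow>\<^sub>L 'l. T (c *\<^sub>C x) = c *\<^sub>C T x}" for c x
    by (intro closed_Collect_eq continuous_intros bounded_linear.continuous_on[OF bounded_linear_scaleC])
  then have "closed (\<Inter>c. \<Inter>x. {T :: 'k \<Rightarrow>\<^sub>L 'l. T (c *\<^sub>C x) = c *\<^sub>C T x})" by blast
  then show ?thesis by (simp add: clinear_op_def INTER_eq)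
qed

lemma csubspace_closure:
  fixes S :: "'a::complex_normed_vector set"
  assumes "csubspace S" shows "csubspace (closure S)"
proof (rule complex_vector.subspaceI)
  show "0 \<in> closure S"
    using closure_subset complex_vector.subspace_0[OF assms] by auto
  fix x y assume "x \<in> closure S" "y \<in> closure S"
  then obtain f g where "\<And>n. f n \<in> S" "f \<longlonglongrightarrow> x" "\<And>n. g n \<in> S" "g \<longlonglongrightarrow> y"
    by (metis closure_sequential)
  then show "x + y \<in> closure S"
    unfolding closure_sequential
    by (intro exI[of _ "\<lambda>n. f n + g n"]) (auto intro: tendsto_add complex_vector.subspace_add[OF assms])
next
  fix c x assume "x \<in> closure S"
  then obtain f where "\<And>n. f n \<in> S" "f \<longlonglongrightarrow> x"
    by (metis closure_sequential)
  then show "c *\<^sub>C x \<in> closure S"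
    unfolding closure_sequential
    by (intro exI[of _ "\<lambda>n. c *\<^sub>C f n"])
      (auto intro: bounded_linear.tendsto[OF bounded_linear_scaleC] complex_vector.subspace_scale[OF assms])
qed

text \<open>Taking adjoints is isometric and conjugate linear, so the adjoints of a sequence
  converging to \<open>x\<close> form a Cauchy sequence, whose limit is the adjoint of
  \<open>x\<close>. The operators form a complete space because Hilbert spaces are Banach
  spaces.\<close>

lemma adjoint_in_closure_span:
  assumes "\<And>g. g \<in> G \<Longrightarrow> \<exists>g'\<in>G. is_adjoint g g'" and "x \<in> closure (cspan G)"
  shows "\<exists>x'\<in>closure (cspan G). is_adjoint x x'"
proof -
  have span: "\<exists>x'\<in>cspan G. is_adjoint x x'" if "x \<in> cspan G" for x
    using that
  proof (induction rule: complex_vector.span_induct_alt)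
    case base
    have "is_adjoint 0 0" by (simp add: is_adjoint_def)
    then show ?case using complex_vector.span_zero by blast
  next
    case (step c g y)
    then obtain g' y' where "g' \<in> G" "is_adjoint g g'" "y' \<in> cspan G" "is_adjoint y y'"
      using assms(1) by blast
    then show ?case
      by (intro bexI[of _ "cnj c *\<^sub>C g' + y'"] is_adjoint_add is_adjoint_scaleC)
        (auto intro: complex_vector.span_add complex_vector.span_scale complex_vector.span_base)
  qed
  obtain f where f: "\<And>n. f n \<in> cspan G" "f \<longlonglongrightarrow> x"
    using assms(2) by (metis closure_sequential)
  have "\<forall>n. \<exists>x'. x' \<in> cspan G \<and> is_adjoint (f n) x'" using span f(1) by blast
  then obtain f' where f': "\<And>n. f' n \<in> cspan G" "\<And>n. is_adjoint (f n) (f' n)" by metis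
  have "norm (f' m - f' n) = norm (f m - f n)" for m n
  proof (rule norm_adjoint)
    have "is_adjoint (f m + (-1) *\<^sub>C f n) (f' m + cnj (-1) *\<^sub>C f' n)"
      by (intro is_adjoint_add is_adjoint_scaleC f')
    then show "is_adjoint (f m - f n) (f' m - f' n)"
      by (simp add: complex_vector.scale_minus_left scaleC_one)
  qed
  moreover have "Cauchy f" using f(2) LIMSEQ_imp_Cauchy by blast
  ultimately have "Cauchy f'" by (simp add: Cauchy_iff)
  then obtain x' where x': "f' \<longlonglongrightarrow> x'" using Cauchy_convergent convergent_def by blast
  have "inner (x u) v = inner u (x' v)" for u v
  proof (rule LIMSEQ_unique)
    show "(\<lambda>n. inner (f n u) v) \<longlonglongrightarrow> inner (x u) v" by (intro tendsto_intros f)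
    have "(\<lambda>n. inner u (f' n v)) \<longlonglongrightarrow> inner u (x' v)" by (intro tendsto_intros x')
    then show "(\<lambda>n. inner (f n u) v) \<longlonglongrightarrow> inner u (x' v)" by (simp add: is_adjoint_inner[OF f'(2)])
  qed
  \<comment> \<open>The imaginary part of \<open>cinner\<close> is a separate real inner product and
    needs its own passage to the limit.\<close>
  moreover have "inner (\<i> *\<^sub>C x u) v = inner (\<i> *\<^sub>C u) (x' v)" for u v
  proof (rule LIMSEQ_unique)
    show "(\<lambda>n. inner (\<i> *\<^sub>C f n u) v) \<longlonglongrightarrow> inner (\<i> *\<^sub>C x u) v"
      by (intro tendsto_intros bounded_linear.tendsto[OF bounded_linear_scaleC] f)
    have "(\<lambda>n. inner (\<i> *\<^sub>C u) (f' n v)) \<longlonglongrightarrow> inner (\<i> *\<^sub>C u) (x' v)" by (intro tendsto_intros x')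
    then show "(\<lambda>n. inner (\<i> *\<^sub>C f n u) v) \<longlonglongrightarrow> inner (\<i> *\<^sub>C u) (x' v)"
      using f'(2) by (simp add: is_adjoint_def cinner_def)
  qed
  ultimately have "is_adjoint x x'" by (simp add: is_adjoint_def cinner_def)
  moreover have "x' \<in> closure (cspan G)" using f'(1) x' closure_sequential by blast
  ultimately show ?thesis by blast
qed

section \<open>Bounded matrices of operators\<close>

text \<open>The matrix has norm at most |M| on the direct sum, stated with squares and without a
  supremum. The index set is arbitrary, so that tuples and pairs can serve as indices, and entries
  may act between different spaces.\<close>

definition mat_bounded ::
    "'i set \<Rightarrow> ('i \<Rightarrow> 'i \<Rightarrow> 'k::real_normed_vector \<Rightarrow>\<^sub>L 'l::real_normed_vector) \<Rightarrow> real \<Rightarrow> bool" where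
  "mat_bounded I X M \<longleftrightarrow>
     (\<forall>\<xi>. (\<Sum>i\<in>I. (norm (\<Sum>j\<in>I. X i j (\<xi> j)))\<^sup>2) \<le> M\<^sup>2 * (\<Sum>j\<in>I. (norm (\<xi> j))\<^sup>2))"

lemma mat_boundedD:
  "mat_bounded I X M \<Longrightarrow>
    (\<Sum>i\<in>I. (norm (\<Sum>j\<in>I. X i j (\<xi> j)))\<^sup>2) \<le> M\<^sup>2 * (\<Sum>j\<in>I. (norm (\<xi> j))\<^sup>2)"
  by (simp add: mat_bounded_def)

lemma mat_bounded_L2_set:
  assumes "M \<ge> 0"
  shows "mat_bounded I X M \<longleftrightarrow>
    (\<forall>\<xi>. L2_set (\<lambda>i. norm (\<Sum>j\<in>I. X i j (\<xi> j))) I \<le> M * L2_set (\<lambda>j. norm (\<xi> j)) I)"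
proof -
  have "M * sqrt b = sqrt (M\<^sup>2 * b)" for b
    using assms by (simp add: real_sqrt_mult)
  then show ?thesis by (simp add: mat_bounded_def L2_set_def)
qed

lemma mat_norm_le_iff:
  fixes X :: "nat \<Rightarrow> nat \<Rightarrow> 'k::chilbert_space op"
  assumes "M \<ge> 0"
  shows "mat_norm n X \<le> M \<longleftrightarrow> mat_bounded {..<n} X M"
proof
  let ?L = "\<lambda>\<xi> :: nat \<Rightarrow> 'k. L2_set (\<lambda>i. norm (\<Sum>j<n. X i j (\<xi> j))) {..<n}"
  let ?N = "\<lambda>\<xi> :: nat \<Rightarrow> 'k. L2_set (\<lambda>j. norm (\<xi> j)) {..<n}"
  {
    assume le: "mat_norm n X \<le> M"
    \<comment> \<open>A real supremum bounds its members only if the set is bounded above; the sum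
      of the norms of the entries is a crude bound.\<close>
    have bdd: "bdd_above (?L ` {\<xi>. ?N \<xi> \<le> 1})"
    proof (rule bdd_aboveI2)
      fix \<xi> assume "\<xi> \<in> {\<xi>. ?N \<xi> \<le> 1}"
      then have 1: "norm (\<xi> j) \<le> 1" if "j < n" for j
        using member_le_L2_set[of "{..<n}" j "\<lambda>j. norm (\<xi> j)"] that by auto
      have "?L \<xi> \<le> (\<Sum>i<n. norm (\<Sum>j<n. X i j (\<xi> j)))"
        by (rule L2_set_le_sum) auto
      also have "\<dots> \<le> (\<Sum>i<n. \<Sum>j<n. norm (X i j))"
      proof (intro sum_mono sum_norm_le)
        fix i j assume "j \<in> {..<n}"
        then show "norm (X i j (\<xi> j)) \<le> norm (X i j)"
          using norm_blinfun[of "X i j" "\<xi> j"] mult_left_mono[OF 1, of j "norm (X i j)"] by simp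
      qed
      finally show "?L \<xi> \<le> (\<Sum>i<n. \<Sum>j<n. norm (X i j))" .
    qed
    have unit: "?L \<xi> \<le> M" if "?N \<xi> \<le> 1" for \<xi>
      using le cSUP_upper[OF _ bdd, of \<xi>] that by (simp add: mat_norm_def)
    show "mat_bounded {..<n} X M"
      unfolding mat_bounded_L2_set[OF assms]
    proof
      fix \<xi> :: "nat \<Rightarrow> 'k"
      show "?L \<xi> \<le> M * ?N \<xi>"
      proof (cases "?N \<xi> = 0")
        case True
        then have "\<xi> j = 0" if "j < n" for j using that by (simp add: L2_set_eq_0_iff)
        then have "?L \<xi> = 0" by (simp add: L2_set_eq_0_iff)
        then show ?thesis using True by simp
      next
        case False
        define r where "r = ?N \<xi>"
        have r: "r > 0" using False L2_set_nonneg[of "\<lambda>j. norm (\<xi> j)" "{..<n}"] unfolding r_def by linarith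
        have scale: "L2_set (\<lambda>j. norm (inverse r *\<^sub>R f j)) {..<n} = inverse r * L2_set (\<lambda>j. norm (f j)) {..<n}"
          for f :: "nat \<Rightarrow> 'k"
          using r by (simp add: L2_set_right_distrib)
        have "?L (\<lambda>j. inverse r *\<^sub>R \<xi> j) \<le> M"
          using r by (intro unit) (simp only: scale, simp add: r_def)
        moreover have "?L (\<lambda>j. inverse r *\<^sub>R \<xi> j) = inverse r * ?L \<xi>"
          unfolding blinfun.scaleR_right scaleR_sum_right[symmetric] by (rule scale)
        ultimately have "inverse r * ?L \<xi> \<le> M" by simp
        then have "?L \<xi> \<le> M * r" using r by (simp only: divide_inverse_commute[symmetric] pos_divide_le_eq)
        then show ?thesis by (simp only: r_def)
      qed
    qed
  }
  {
    assume "mat_bounded {..<n} X M"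
    then have le: "?L \<xi> \<le> M * ?N \<xi>" for \<xi> using mat_bounded_L2_set[OF assms] by blast
    show "mat_norm n X \<le> M"
      unfolding mat_norm_def
    proof (rule cSUP_least)
      show "{\<xi> :: nat \<Rightarrow> 'k. ?N \<xi> \<le> 1} \<noteq> {}" by (auto intro!: exI[of _ "\<lambda>_. 0"] simp: L2_set_def)
      fix \<xi> assume "\<xi> \<in> {\<xi>. ?N \<xi> \<le> 1}"
      then show "?L \<xi> \<le> M" using le[of \<xi>] mult_left_mono[of "?N \<xi>" 1 M] assms by simp
    qed
  }
qed

text \<open>Trades the suprema in \<open>cb_norm\<close> and \<open>mat_norm\<close> for
  \<open>mat_bounded\<close>, the form in which all complete bounds are proved below.\<close>

lemma cb_norm_le_iff:
  assumes "C \<ge> 0"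
  shows "cb_norm S \<Phi> \<le> ennreal C \<longleftrightarrow>
    (\<forall>n X. mat_in n S X \<longrightarrow> mat_bounded {..<n} X 1 \<longrightarrow> mat_bounded {..<n} (\<lambda>i j. \<Phi> (X i j)) C)"
  unfolding cb_norm_def SUP_le_iff
  using assms by (auto simp: ennreal_le_iff mat_norm_le_iff)

lemma mat_bounded_reindex:
  fixes X :: "'i \<Rightarrow> 'i \<Rightarrow> 'k::real_normed_vector \<Rightarrow>\<^sub>L 'l::real_normed_vector" and f :: "'j \<Rightarrow> 'i"
  assumes f: "bij_betw f J I"
  shows "mat_bounded I X M \<longleftrightarrow> mat_bounded J (\<lambda>i j. X (f i) (f j)) M"
proof
  assume I: "mat_bounded I X M"
  show "mat_bounded J (\<lambda>i j. X (f i) (f j)) M"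
    unfolding mat_bounded_def
  proof
    fix \<xi> :: "'j \<Rightarrow> 'k"
    let ?\<eta> = "\<lambda>i. \<xi> (inv_into J f i)"
    have inv: "inv_into J f (f j) = j" if "j \<in> J" for j using f that by (simp add: bij_betw_def)
    have 1: "(\<Sum>j\<in>I. X i j (?\<eta> j)) = (\<Sum>j\<in>J. X i (f j) (\<xi> j))" for i
      by (subst sum.reindex_bij_betw[OF f, symmetric], rule sum.cong) (simp_all add: inv)
    have 2: "(\<Sum>j\<in>I. (norm (?\<eta> j))\<^sup>2) = (\<Sum>j\<in>J. (norm (\<xi> j))\<^sup>2)"
      by (subst sum.reindex_bij_betw[OF f, symmetric], rule sum.cong) (simp_all add: inv)
    show "(\<Sum>i\<in>J. (norm (\<Sum>j\<in>J. X (f i) (f j) (\<xi> j)))\<^sup>2) \<le> M\<^sup>2 * (\<Sum>j\<in>J. (norm (\<xi> j))\<^sup>2)"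
      using mat_boundedD[OF I, of ?\<eta>] unfolding 1 2
      by (simp only: sum.reindex_bij_betw[OF f, of "\<lambda>i. (norm (\<Sum>j\<in>J. X i (f j) (\<xi> j)))\<^sup>2"])
  qed
next
  assume J: "mat_bounded J (\<lambda>i j. X (f i) (f j)) M"
  show "mat_bounded I X M"
    unfolding mat_bounded_def
  proof
    fix \<xi> :: "'i \<Rightarrow> 'k"
    show "(\<Sum>i\<in>I. (norm (\<Sum>j\<in>I. X i j (\<xi> j)))\<^sup>2) \<le> M\<^sup>2 * (\<Sum>j\<in>I. (norm (\<xi> j))\<^sup>2)"
      using mat_boundedD[OF J, of "\<lambda>j. \<xi> (f j)"] by (simp only: sum.reindex_bij_betw[OF f, symmetric])
  qed
qed

text \<open>Complete bounds are defined with indices below n; numbering a finite set by a bijection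
  makes them available for matrices indexed by pairs.\<close>

lemma cb_norm_le_mat_bounded:
  assumes "cb_norm S \<Phi> \<le> ennreal C" "C \<ge> 0" "finite I"
    and X: "\<And>i j. i \<in> I \<Longrightarrow> j \<in> I \<Longrightarrow> X i j \<in> S" "mat_bounded I X 1"
  shows "mat_bounded I (\<lambda>i j. \<Phi> (X i j)) C"
proof -
  obtain f where f: "bij_betw f {..<card I} I"
    using ex_bij_betw_nat_finite[OF \<open>finite I\<close>] by (auto simp: atLeast0LessThan)
  have "mat_in (card I) S (\<lambda>i j. X (f i) (f j))"
    using X(1) f by (auto simp: mat_in_def bij_betw_def)
  moreover have "mat_bounded {..<card I} (\<lambda>i j. X (f i) (f j)) 1"
    using X(2) mat_bounded_reindex[OF f] by blast
  ultimately show ?thesis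
    using assms(1) mat_bounded_reindex[OF f] unfolding cb_norm_le_iff[OF assms(2)] by blast
qed

text \<open>Conjugating every entry multiplies the matrix on both sides by block diagonal
  contractions. Hence passing between a space and a corner of a larger one preserves complete
  bounds.\<close>

lemma mat_bounded_conj:
  assumes X: "mat_bounded I X M" and V: "norm V \<le> 1" and W: "norm W \<le> 1"
  shows "mat_bounded I (\<lambda>i j. V o\<^sub>L X i j o\<^sub>L W) M"
  unfolding mat_bounded_def
proof
  fix \<xi>
  have contr: "norm (T x) \<le> norm x" if "norm T \<le> 1" for T :: "'x::real_normed_vector \<Rightarrow>\<^sub>L 'y::real_normed_vector" and x
    using order_trans[OF norm_blinfun mult_right_mono[OF that]] by (metis mult_1 norm_ge_zero)
  have "(\<Sum>i\<in>I. (norm (\<Sum>j\<in>I. (V o\<^sub>L X i j o\<^sub>L W) (\<xi> j)))\<^sup>2)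
      = (\<Sum>i\<in>I. (norm (V (\<Sum>j\<in>I. X i j (W (\<xi> j)))))\<^sup>2)"
    by (simp add: blinfun.sum_right)
  also have "\<dots> \<le> (\<Sum>i\<in>I. (norm (\<Sum>j\<in>I. X i j (W (\<xi> j))))\<^sup>2)"
    by (intro sum_mono power_mono contr V) auto
  also have "\<dots> \<le> M\<^sup>2 * (\<Sum>j\<in>I. (norm (W (\<xi> j)))\<^sup>2)" by (rule mat_boundedD[OF X])
  also have "\<dots> \<le> M\<^sup>2 * (\<Sum>j\<in>I. (norm (\<xi> j))\<^sup>2)"
    by (intro mult_left_mono sum_mono power_mono contr W) auto
  finally show "(\<Sum>i\<in>I. (norm (\<Sum>j\<in>I. (V o\<^sub>L X i j o\<^sub>L W) (\<xi> j)))\<^sup>2) \<le> M\<^sup>2 * (\<Sum>j\<in>I. (norm (\<xi> j))\<^sup>2)" .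
qed

section \<open>The approximation property in terms of finite sets\<close>

definition cb_finite_rank :: "'k::chilbert_space op set \<Rightarrow> real \<Rightarrow> ('k op \<Rightarrow> 'k op) \<Rightarrow> bool" where
  "cb_finite_rank A C \<Phi> \<longleftrightarrow>
     \<Phi> ` A \<subseteq> A \<and> linear_on A \<Phi> \<and> finite_rank A \<Phi> \<and> cb_norm A \<Phi> \<le> ennreal C"

text \<open>The pairs (X, \<epsilon>) form a directed set, and the filter generated by the sets
  \<open>G (X, \<epsilon>)\<close> is the required net. Afterwards only one map for finitely many
  elements has to be found at a time.\<close>

lemma approximable_with_iff:
  "approximable_with A C \<longleftrightarrow> (\<forall>\<epsilon>>0. \<forall>X. finite X \<and> X \<subseteq> A \<longrightarrow>
     (\<exists>\<Phi>. cb_finite_rank A C \<Phi> \<and> (\<forall>x\<in>X. norm (\<Phi> x - x) < \<epsilon>)))" (is "?L \<longleftrightarrow> ?R")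
proof
  assume ?L
  then obtain \<N> where N: "\<N> \<noteq> bot" "\<forall>\<^sub>F \<Phi> in \<N>. cb_finite_rank A C \<Phi>"
      "\<And>a. a \<in> A \<Longrightarrow> ((\<lambda>\<Phi>. norm (\<Phi> a - a)) \<longlongrightarrow> 0) \<N>"
    unfolding approximable_with_def cb_finite_rank_def by blast
  show ?R
  proof (intro allI impI)
    fix \<epsilon> :: real and X assume "\<epsilon> > 0" and X: "finite X \<and> X \<subseteq> A"
    then have "\<forall>x\<in>X. \<forall>\<^sub>F \<Phi> in \<N>. norm (\<Phi> x - x) < \<epsilon>"
      using order_tendstoD(2)[OF N(3)] by blast
    then have "\<forall>\<^sub>F \<Phi> in \<N>. \<forall>x\<in>X. norm (\<Phi> x - x) < \<epsilon>"
      using X by (simp add: eventually_ball_finite)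
    with N(2) have "\<forall>\<^sub>F \<Phi> in \<N>. cb_finite_rank A C \<Phi> \<and> (\<forall>x\<in>X. norm (\<Phi> x - x) < \<epsilon>)"
      by (rule eventually_conj)
    then show "\<exists>\<Phi>. cb_finite_rank A C \<Phi> \<and> (\<forall>x\<in>X. norm (\<Phi> x - x) < \<epsilon>)"
      using eventually_happens N(1) by blast
  qed
next
  assume R: ?R
  define G where "G = (\<lambda>(X, \<epsilon>). {\<Phi>. cb_finite_rank A C \<Phi> \<and> (\<forall>x\<in>X. norm (\<Phi> x - x) < \<epsilon>)})"
  define J where "J = {(X, \<epsilon>::real). finite X \<and> X \<subseteq> A \<and> \<epsilon> > 0}"
  define \<N> where "\<N> = (INF j\<in>J. principal (G j))"
  have ev: "eventually P \<N>" if "(X, \<epsilon>) \<in> J" "\<And>\<Phi>. \<Phi> \<in> G (X, \<epsilon>) \<Longrightarrow> P \<Phi>" for P X \<epsilon>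
    unfolding \<N>_def by (rule eventually_INF1[OF that(1)]) (use that(2) in \<open>simp add: eventually_principal\<close>)
  \<comment> \<open>In a directed family of principal filters the infimum is trivial only if some
    member is.\<close>
  have "(INF j\<in>J. principal (G j)) = bot \<longleftrightarrow> (\<exists>j\<in>J. principal (G j) = bot)"
  proof (rule INF_filter_bot_base[where F = "\<lambda>j. principal (G j)" and I = J])
    fix i j assume "i \<in> J" "j \<in> J"
    moreover obtain X Y d e where [simp]: "i = (X, d)" "j = (Y, e)"
      by (metis surj_pair)
    ultimately have "(X \<union> Y, min d e) \<in> J" by (simp add: J_def)
    moreover have "G (X \<union> Y, min d e) \<subseteq> G i \<inter> G j" by (auto simp: G_def)
    ultimately show "\<exists>k\<in>J. principal (G k) \<le> inf (principal (G i)) (principal (G j))"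
      by (metis inf_principal principal_le_iff)
  qed
  moreover have "principal (G j) \<noteq> bot" if "j \<in> J" for j
  proof -
    obtain X e where j: "j = (X, e)" by (cases j)
    then have "\<exists>\<Phi>. cb_finite_rank A C \<Phi> \<and> (\<forall>x\<in>X. norm (\<Phi> x - x) < e)"
      using that R by (simp add: J_def)
    then show ?thesis unfolding j G_def principal_eq_bot_iff by blast
  qed
  ultimately have "\<N> \<noteq> bot" unfolding \<N>_def by blast
  moreover have "\<forall>\<^sub>F \<Phi> in \<N>. cb_finite_rank A C \<Phi>"
    by (rule ev[of "{}" 1]) (auto simp: J_def G_def)
  moreover have "((\<lambda>\<Phi>. norm (\<Phi> a - a)) \<longlongrightarrow> 0) \<N>" if "a \<in> A" for a
  proof (rule order_tendstoI)
    fix e :: real assume "e > 0"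
    then show "\<forall>\<^sub>F \<Phi> in \<N>. norm (\<Phi> a - a) < e"
      using that by (intro ev[of "{a}" e]) (auto simp: J_def G_def)
  next
    fix e :: real assume "e < 0"
    then show "\<forall>\<^sub>F \<Phi> in \<N>. e < norm (\<Phi> a - a)" by (simp add: less_le_trans[OF _ norm_ge_zero])
  qed
  ultimately show ?L unfolding approximable_with_def cb_finite_rank_def by blast
qed

text \<open>An arbitrary spanning set may lie outside the domain on which a further map is linear.
  Vectors taken from the image do not, which is what \<open>finite_rank_compose\<close>
  needs.\<close>

lemma finite_rank_basis:
  assumes "finite_rank S \<phi>"
  obtains E where "finite E" "E \<subseteq> \<phi> ` S" "\<phi> ` S \<subseteq> cspan E"
proof -
  obtain E' where E': "finite E'" "\<phi> ` S \<subseteq> cspan E'" using assms by (auto simp: finite_rank_def)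
  obtain E where E: "E \<subseteq> \<phi> ` S" "complex_vector.independent E" "\<phi> ` S \<subseteq> cspan E"
    by (rule complex_vector.basis_exists[of "\<phi> ` S"])
  have "finite E" using complex_vector.independent_span_bound[OF E'(1) E(2)] E(1) E'(2) by blast
  with E that show ?thesis by blast
qed

lemma linear_on_span:
  assumes "linear_on T \<psi>" "csubspace T" "E \<subseteq> T" "x \<in> cspan E"
  shows "\<psi> x \<in> cspan (\<psi> ` E)"
proof -
  have zero: "\<psi> 0 = 0"
    using assms(1) complex_vector.subspace_0[OF assms(2)] unfolding linear_on_def
    by (metis complex_vector.scale_zero_left)
  \<comment> \<open>Membership in \<open>T\<close> is carried through the induction, since
    \<open>\<psi>\<close> is known to be linear only there.\<close>
  have "x \<in> T \<and> \<psi> x \<in> cspan (\<psi> ` E)"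
    using assms(4)
  proof (induction rule: complex_vector.span_induct_alt)
    case base
    then show ?case using zero complex_vector.subspace_0[OF assms(2)] complex_vector.span_zero by metis
  next
    case (step c x y)
    then have "x \<in> T" using assms(3) by blast
    then have cx: "c *\<^sub>C x \<in> T" using complex_vector.subspace_scale[OF assms(2)] by blast
    have "\<psi> (c *\<^sub>C x + y) = c *\<^sub>C \<psi> x + \<psi> y"
      using assms(1) cx step \<open>x \<in> T\<close> by (simp add: linear_on_def)
    then show ?case
      using cx step complex_vector.subspace_add[OF assms(2)]
      by (auto intro: complex_vector.span_add complex_vector.span_scale complex_vector.span_base)
  qed
  then show ?thesis by blast
qed

lemma finite_rank_compose:
  assumes "finite_rank S \<phi>" "\<phi> ` S \<subseteq> T" "linear_on T \<psi>" "csubspace T"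
  shows "finite_rank S (\<lambda>x. \<psi> (\<phi> x))"
proof -
  obtain E where E: "finite E" "E \<subseteq> \<phi> ` S" "\<phi> ` S \<subseteq> cspan E" using assms(1) finite_rank_basis by blast
  have "\<psi> (\<phi> x) \<in> cspan (\<psi> ` E)" if "x \<in> S" for x
    using linear_on_span[OF assms(3,4)] E assms(2) that by blast
  then show ?thesis unfolding finite_rank_def using E(1) by blast
qed

lemma finite_rank_sum:
  assumes "finite I" "\<And>i. i \<in> I \<Longrightarrow> finite_rank S (\<phi> i)"
  shows "finite_rank S (\<lambda>x. \<Sum>i\<in>I. \<phi> i x)"
proof -
  have "\<forall>i\<in>I. \<exists>E. finite E \<and> \<phi> i ` S \<subseteq> cspan E" using assms(2) by (simp add: finite_rank_def)
  then obtain E where E: "\<And>i. i \<in> I \<Longrightarrow> finite (E i)" "\<And>i. i \<in> I \<Longrightarrow> \<phi> i ` S \<subseteq> cspan (E i)" by metis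
  have "(\<Sum>i\<in>I. \<phi> i x) \<in> cspan (\<Union>i\<in>I. E i)" if "x \<in> S" for x
  proof (rule complex_vector.span_sum)
    fix i assume "i \<in> I"
    then show "\<phi> i x \<in> cspan (\<Union>i\<in>I. E i)"
      using E(2)[of i] that complex_vector.span_mono[of "E i" "\<Union>i\<in>I. E i"] by (meson UN_upper image_subset_iff subsetD)
  qed
  then show ?thesis unfolding finite_rank_def using assms(1) E(1) by blast
qed

lemma finite_rank_precompose:
  "finite_rank T \<psi> \<Longrightarrow> \<phi> ` S \<subseteq> T \<Longrightarrow> finite_rank S (\<lambda>x. \<psi> (\<phi> x))"
  unfolding finite_rank_def by blast

section \<open>Completely positive contractions are completely contractive\<close>

text \<open>In block form [[diag q, X], [Y, diag q]], the second block row and column starting at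
  index n. With Y the adjoint of X this is Paulsen's device for turning a norm bound into
  positivity.\<close>

definition block_matrix :: "nat \<Rightarrow> 'a \<Rightarrow> (nat \<Rightarrow> nat \<Rightarrow> 'a) \<Rightarrow> (nat \<Rightarrow> nat \<Rightarrow> 'a) \<Rightarrow> nat \<Rightarrow> nat \<Rightarrow> 'a::zero" where
  "block_matrix n q X Y i j =
     (if i < n then if j < n then if i = j then q else 0 else X i (j - n)
      else if j < n then Y (i - n) j else if i = j then q else 0)"

lemma sum_lessThan_add:
  "(\<Sum>i<n + m. f i) = (\<Sum>i<n. f i) + (\<Sum>i<m. f (n + i))" for f :: "nat \<Rightarrow> 'a::comm_monoid_add"
  by (induction m) (simp_all add: add.assoc)

lemma quadratic_form_block_matrix:
  fixes q :: "'k::chilbert_space op" and \<zeta> :: "nat \<Rightarrow> 'k"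
  shows "(\<Sum>i<n + n. \<Sum>j<n + n. cinner (\<zeta> i) (block_matrix n q X Y i j (\<zeta> j))) =
    (\<Sum>i<n. cinner (\<zeta> i) (q (\<zeta> i))) + (\<Sum>i<n. cinner (\<zeta> (n + i)) (q (\<zeta> (n + i)))) +
    (\<Sum>i<n. \<Sum>j<n. cinner (\<zeta> i) (X i j (\<zeta> (n + j)))) +
    (\<Sum>i<n. \<Sum>j<n. cinner (\<zeta> (n + i)) (Y i j (\<zeta> j)))"
proof -
  have delta: "(\<Sum>j<n. cinner (\<zeta>' i) ((if i = j then q else 0) (\<zeta>' j))) = cinner (\<zeta>' i) (q (\<zeta>' i))"
    if "i < n" for i and \<zeta>' :: "nat \<Rightarrow> 'k"
    using that by (subst sum.cong[OF refl, where h = "\<lambda>j. if j = i then cinner (\<zeta>' i) (q (\<zeta>' i)) else 0"]) auto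
  show ?thesis
    using delta[of _ \<zeta>] delta[of _ "\<lambda>i. \<zeta> (n + i)"]
    by (simp add: sum_lessThan_add block_matrix_def sum.distrib add_ac)
qed

text \<open>Expand 0 \<le> |M u + v|^2 and divide by M. With these weights an off-diagonal block of
  norm at most M is absorbed by a diagonal equal to M times a projection.\<close>

lemma inner_ge_weighted:
  fixes u v :: "'a::real_inner"
  assumes "M > 0"
  shows "- (M * (norm u)\<^sup>2 + (norm v)\<^sup>2 / M) \<le> 2 * inner u v"
proof -
  have "0 \<le> (norm (M *\<^sub>R u + v))\<^sup>2 / M" using assms by simp
  also have "(norm (M *\<^sub>R u + v))\<^sup>2 = M\<^sup>2 * (norm u)\<^sup>2 + 2 * M * inner u v + (norm v)\<^sup>2"
    unfolding power2_norm_eq_inner inner_add_left inner_add_right inner_scaleR_left inner_scaleR_right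
    by (simp add: inner_commute[of v u] power2_eq_square[of M] algebra_simps)
  also have "\<dots> / M = M * (norm u)\<^sup>2 + 2 * inner u v + (norm v)\<^sup>2 / M"
    using assms by (simp add: field_simps power2_eq_square)
  finally show ?thesis by simp
qed

text \<open>The proof applies \<open>\<phi>\<close> to the positive block matrix with \<open>M p\<close> on the diagonal and \<open>X\<close>, \<open>X\<^sup>*\<close> off it.
  Complex linearity on \<open>T\<close> is what makes the two off-diagonal blocks of the image mutually adjoint.\<close>

lemma ccp_mat_bounded:
  fixes \<phi> :: "'k::chilbert_space op \<Rightarrow> 'l::chilbert_space op"
  assumes S: "operator_system S" and ccp: "ccp_map S T \<phi>" and T: "\<And>y. y \<in> T \<Longrightarrow> clinear_op y"
    and X: "mat_in n S X" "mat_bounded {..<n} X M" and M: "M > 0"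
  shows "mat_bounded {..<n} (\<lambda>i j. \<phi> (X i j)) M"
proof -
  have sub: "csubspace S" using S by (simp add: operator_system_def)
  obtain p where unit: "is_unit S p" using S by (auto simp: operator_system_def)
  then have p: "p \<in> S" and pp: "p o\<^sub>L p = p" by (auto simp: is_unit_def)
  obtain p' where "p' \<in> S" "is_adjoint p p'" using S p by (auto simp: operator_system_def)
  then have sa: "is_adjoint p p" using unit_self_adjoint[OF unit] by blast
  note proj = projection_norm_sq[OF sa pp] projection_contractive[OF sa pp]
  have norm_p: "norm p \<le> 1" by (rule norm_blinfun_bound) (simp_all add: proj)
  have "\<forall>i j. \<exists>X'. i < n \<longrightarrow> j < n \<longrightarrow> X' \<in> S \<and> is_adjoint (X j i) X'"
    using S X(1) by (auto simp: operator_system_def mat_in_def)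
  then obtain Y where Y: "\<And>i j. i < n \<Longrightarrow> j < n \<Longrightarrow> Y i j \<in> S \<and> is_adjoint (X j i) (Y i j)" by metis
  define q where "q = complex_of_real M *\<^sub>C p"
  have q: "q \<in> S" unfolding q_def using sub p by (rule complex_vector.subspace_scale)
  let ?Z = "block_matrix n q X Y"
  have Z_in: "mat_in (n + n) S ?Z"
    using X(1) Y q complex_vector.subspace_0[OF sub] by (auto simp: mat_in_def block_matrix_def)
  have "mat_pos (n + n) ?Z"
    unfolding mat_pos_def quadratic_form_block_matrix
  proof
    fix \<zeta> :: "nat \<Rightarrow> 'k"
    define a where "a = \<zeta>"
    define b where "b = (\<lambda>i. \<zeta> (n + i))"
    define s where "s = (\<Sum>i<n. \<Sum>j<n. cinner (a i) (X i j (b j)))"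
    define v where "v = (\<lambda>i. \<Sum>j<n. X i j (p (b j)))"
    have qq: "cinner x (q x) = complex_of_real (M * (norm (p x))\<^sup>2)" for x
    proof -
      have "cinner x (p x) = cinner x (p (p x))" by (metis blinfun_apply_blinfun_compose comp_apply pp)
      also have "\<dots> = cinner (p x) (p x)" using sa by (simp add: is_adjoint_def)
      finally have "cinner x (p x) = of_real ((norm (p x))\<^sup>2)"
        by (simp add: complex_eq_iff Re_cinner Im_cinner power2_norm_eq_inner)
          (metis inner_i_right inner_commute add.inverse_neutral neg_equal_zero)
      then show ?thesis by (simp add: q_def scaleC_blinfun.rep_eq cinner_scaleC_right)
    qed
    have "(\<Sum>i<n. \<Sum>j<n. cinner (b i) (Y i j (a j))) = (\<Sum>i<n. \<Sum>j<n. cnj (cinner (a j) (X j i (b i))))"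
      using Y by (intro sum.cong refl) (metis lessThan_iff cinner_commute is_adjoint_def)
    also have "\<dots> = cnj s" unfolding s_def cnj_sum by (rule sum.swap)
    finally have Ys: "(\<Sum>i<n. \<Sum>j<n. cinner (b i) (Y i j (a j))) = cnj s" .
    have "Re s = (\<Sum>i<n. inner (p (a i)) (v i))"
    proof -
      \<comment> \<open>The diagonal controls only the components of vectors in the range of p.
        Every entry is unchanged by multiplication with p on both sides, so s depends only on these
        components too.\<close>
      have 1: "inner x (X i j y) = inner (p x) (X i j (p y))" if "i < n" "j < n" for i j x y
      proof -
        have "p o\<^sub>L X i j o\<^sub>L p = X i j"
          using unit X(1) that by (auto simp: is_unit_def mat_in_def)
        then show ?thesis
          by (metis is_adjoint_inner[OF sa] blinfun_apply_blinfun_compose comp_apply)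
      qed
      show ?thesis
        unfolding s_def v_def Re_sum Re_cinner inner_sum_right by (intro sum.cong refl 1) simp_all
    qed
    then have "2 * Re s \<ge> (\<Sum>i<n. - (M * (norm (p (a i)))\<^sup>2 + (norm (v i))\<^sup>2 / M))"
      unfolding sum_distrib_left by (simp only: sum_distrib_left) (intro sum_mono inner_ge_weighted M)
    moreover have "(\<Sum>i<n. (norm (v i))\<^sup>2) \<le> M\<^sup>2 * (\<Sum>i<n. (norm (p (b i)))\<^sup>2)"
      unfolding v_def by (rule mat_boundedD[OF X(2)])
    then have "(\<Sum>i<n. (norm (v i))\<^sup>2) / M \<le> M * (\<Sum>i<n. (norm (p (b i)))\<^sup>2)"
      using M by (simp add: field_simps power2_eq_square)
    ultimately have "0 \<le> M * (\<Sum>i<n. (norm (p (a i)))\<^sup>2) + M * (\<Sum>i<n. (norm (p (b i)))\<^sup>2) + 2 * Re s"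
      by (simp add: sum_negf sum_subtractf sum_distrib_left sum_divide_distrib)
    then have "(\<Sum>i<n. cinner (a i) (q (a i))) + (\<Sum>i<n. cinner (b i) (q (b i))) + s + cnj s \<in> \<real>\<^sub>\<ge>\<^sub>0"
      by (simp add: qq complex_nonneg_Reals_iff sum_distrib_left)
    then show "(\<Sum>i<n. cinner (\<zeta> i) (q (\<zeta> i))) + (\<Sum>i<n. cinner (\<zeta> (n + i)) (q (\<zeta> (n + i)))) +
        (\<Sum>i<n. \<Sum>j<n. cinner (\<zeta> i) (X i j (\<zeta> (n + j)))) +
        (\<Sum>i<n. \<Sum>j<n. cinner (\<zeta> (n + i)) (Y i j (\<zeta> j))) \<in> \<real>\<^sub>\<ge>\<^sub>0"
      unfolding Ys[symmetric] unfolding a_def b_def s_def .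
  qed
  then have "mat_pos (n + n) (\<lambda>i j. \<phi> (?Z i j))"
    using ccp Z_in unfolding ccp_map_def cp_map_def by blast
  moreover have "\<phi> 0 = 0"
    using ccp complex_vector.subspace_0[OF sub] unfolding ccp_map_def cp_map_def linear_on_def
    by (metis complex_vector.scale_zero_left)
  then have "(\<lambda>i j. \<phi> (?Z i j)) = block_matrix n (\<phi> q) (\<lambda>i j. \<phi> (X i j)) (\<lambda>i j. \<phi> (Y i j))"
    by (auto simp: block_matrix_def fun_eq_iff)
  ultimately have pos: "mat_pos (n + n) (block_matrix n (\<phi> q) (\<lambda>i j. \<phi> (X i j)) (\<lambda>i j. \<phi> (Y i j)))" by simp
  have cl: "clinear_op (\<phi> x)" if "x \<in> S" for x
    using T ccp that by (auto simp: ccp_map_def cp_map_def)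
  define D where "D = (\<lambda>a. \<Sum>i<n. cinner (a i) (\<phi> q (a i)))"
  define s where "s = (\<lambda>a b. \<Sum>i<n. \<Sum>j<n. cinner (a i) (\<phi> (X i j) (b j)))"
  define t where "t = (\<lambda>a b. \<Sum>i<n. \<Sum>j<n. cinner (b i) (\<phi> (Y i j) (a j)))"
  have Q: "D a + D b + s a b + t a b \<in> \<real>\<^sub>\<ge>\<^sub>0" for a b
  proof -
    define \<zeta> where "\<zeta> = (\<lambda>i. if i < n then a i else b (i - n))"
    have \<zeta>: "\<zeta> i = a i" "\<zeta> (n + i) = b i" if "i < n" for i using that by (auto simp: \<zeta>_def)
    have "D a = (\<Sum>i<n. cinner (\<zeta> i) (\<phi> q (\<zeta> i)))"
      "D b = (\<Sum>i<n. cinner (\<zeta> (n + i)) (\<phi> q (\<zeta> (n + i))))"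
      "s a b = (\<Sum>i<n. \<Sum>j<n. cinner (\<zeta> i) (\<phi> (X i j) (\<zeta> (n + j))))"
      "t a b = (\<Sum>i<n. \<Sum>j<n. cinner (\<zeta> (n + i)) (\<phi> (Y i j) (\<zeta> j)))"
      unfolding D_def s_def t_def by (intro sum.cong refl; simp add: \<zeta>)+
    then show ?thesis
      using pos unfolding mat_pos_def quadratic_form_block_matrix by simp
  qed
  have zero: "D (\<lambda>_. 0) = 0" "s a (\<lambda>_. 0) = 0" "t a (\<lambda>_. 0) = 0" for a by (simp_all add: D_def s_def t_def)
  have imD: "Im (D a) = 0" for a
    using Q[of a "\<lambda>_. 0"] by (simp add: zero complex_nonneg_Reals_iff)
  have s_i: "s a (\<lambda>i. \<i> *\<^sub>C b i) = \<i> * s a b" for a b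
    unfolding s_def sum_distrib_left
    using cl X(1) by (intro sum.cong refl) (simp add: clinear_op_def mat_in_def cinner_scaleC_right)
  have t_i: "t a (\<lambda>i. \<i> *\<^sub>C b i) = - \<i> * t a b" for a b
    unfolding t_def sum_distrib_left by (intro sum.cong refl) (simp add: cinner_scaleC_left)
  \<comment> \<open>A nonnegative form has no imaginary part. Replacing b by i b turns s + t into i
    s - i t, whose imaginary part is Re s - Re t.\<close>
  have re: "Re (t a b) = Re (s a b)" for a b
    using Q[of a "\<lambda>i. \<i> *\<^sub>C b i"] imD by (simp add: s_i t_i complex_nonneg_Reals_iff)
  have "norm (\<phi> q) \<le> M"
  proof -
    have "norm (\<phi> q) \<le> norm q" using ccp q by (simp add: ccp_map_def)
    also have "\<dots> \<le> M" using norm_p M by (simp add: q_def norm_scaleC)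
    finally show ?thesis .
  qed
  then have qx: "inner x (\<phi> q x) \<le> M * (norm x)\<^sup>2" for x
  proof -
    have "inner x (\<phi> q x) \<le> norm x * (norm (\<phi> q) * norm x)"
      by (rule order_trans[OF norm_cauchy_schwarz]) (intro mult_left_mono norm_blinfun norm_ge_zero)
    also have "\<dots> = norm (\<phi> q) * (norm x)\<^sup>2" by (simp add: power2_eq_square)
    also have "\<dots> \<le> M * (norm x)\<^sup>2" using \<open>norm (\<phi> q) \<le> M\<close> by (rule mult_right_mono) simp
    finally show ?thesis .
  qed
  have ReD: "Re (D a) \<le> M * (\<Sum>i<n. (norm (a i))\<^sup>2)" for a
    unfolding D_def sum_distrib_left by (simp add: Re_cinner sum_mono qx)
  show ?thesis
    unfolding mat_bounded_def
  proof
    fix \<eta> :: "nat \<Rightarrow> 'l"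
    define v where "v = (\<lambda>i. \<Sum>j<n. \<phi> (X i j) (\<eta> j))"
    \<comment> \<open>This choice minimizes M |a|^2 + 2 Re <a, v>; the minimum is - V / M.\<close>
    define a where "a = (\<lambda>i. (- 1 / M) *\<^sub>R v i)"
    define V where "V = (\<Sum>i<n. (norm (v i))\<^sup>2)"
    have "Re (s a \<eta>) = (\<Sum>i<n. inner (a i) (v i))"
      by (simp add: s_def v_def Re_cinner inner_sum_right)
    also have "\<dots> = - V / M"
      by (simp add: a_def V_def power2_norm_eq_inner sum_divide_distrib sum_negf)
    finally have s: "Re (s a \<eta>) = - V / M" .
    have "(\<Sum>i<n. (norm (a i))\<^sup>2) = V / M\<^sup>2"
      using M by (simp add: a_def V_def power_divide sum_divide_distrib power_mult_distrib)
    then have "Re (D a) \<le> V / M" using ReD[of a] M by (simp add: power2_eq_square)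
    moreover have "0 \<le> Re (D a) + Re (D \<eta>) + 2 * Re (s a \<eta>)"
      using Q[of a \<eta>] re[of a \<eta>] by (simp add: complex_nonneg_Reals_iff)
    ultimately have "V / M \<le> M * (\<Sum>i<n. (norm (\<eta> i))\<^sup>2)"
      using ReD[of \<eta>] s by simp
    then show "(\<Sum>i<n. (norm (\<Sum>j<n. \<phi> (X i j) (\<eta> j)))\<^sup>2) \<le> M\<^sup>2 * (\<Sum>j<n. (norm (\<eta> j))\<^sup>2)"
      using M by (simp add: V_def v_def field_simps power2_eq_square)
  qed
qed

section \<open>Homomorphisms of C*-algebras are contractive\<close>

text \<open>The Neumann series of the terms p h^k, started at the unit p of A, which need not be the
  identity operator. The products of its terms with p - h telescope, and closedness of A keeps the
  sum in A.\<close>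

lemma neumann_inverse:
  fixes h :: "'k::chilbert_space op"
  assumes A: "cstar_algebra A" and unit: "is_unit A p" and h: "h \<in> A" "norm h < 1"
  obtains b where "b \<in> A" "b o\<^sub>L (p - h) = p"
proof -
  have sub: "csubspace A" and clA: "closed A" and mult: "\<And>a b. a \<in> A \<Longrightarrow> b \<in> A \<Longrightarrow> a o\<^sub>L b \<in> A"
    using A by (auto simp: cstar_algebra_def)
  have p: "p \<in> A" and up: "\<And>x. x \<in> A \<Longrightarrow> x o\<^sub>L p = x" using unit by (auto simp: is_unit_def)
  define P where "P = rec_nat p (\<lambda>_ x. x o\<^sub>L h)"
  have P_simps: "P 0 = p" "P (Suc k) = P k o\<^sub>L h" for k by (simp_all add: P_def)
  have P_in: "P k \<in> A" for k by (induction k) (simp_all add: P_simps p h mult)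
  have P_le: "norm (P k) \<le> norm p * norm h ^ k" for k
  proof (induction k)
    case (Suc k)
    then show ?case
      using order_trans[OF norm_blinfun_compose mult_right_mono[OF Suc norm_ge_zero]]
      by (simp add: P_simps mult_ac)
  qed (simp add: P_simps)
  have geo: "summable (\<lambda>k. norm p * norm h ^ k)"
    using h by (intro summable_mult summable_geometric) simp
  have summ: "summable P" by (rule summable_comparison_test'[OF geo P_le])
  have bil: "bounded_linear (\<lambda>x. x o\<^sub>L (p - h))"
    by (rule bounded_bilinear.bounded_linear_left[OF bounded_bilinear_blinfun_compose])
  show thesis
  proof (rule that)
    have "(\<lambda>n. \<Sum>k<n. P k) \<longlonglongrightarrow> suminf P" using summ by (simp add: summable_LIMSEQ)
    moreover have "(\<Sum>k<n. P k) \<in> A" for n by (intro complex_vector.subspace_sum[OF sub] P_in)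
    ultimately show "suminf P \<in> A" using closed_sequentially[OF clA] by metis
    have "P k o\<^sub>L (p - h) = P k - P (Suc k)" for k
      by (simp add: P_simps bounded_bilinear.diff_right[OF bounded_bilinear_blinfun_compose] up P_in)
    then have "(\<lambda>k. P k - P (Suc k)) sums (suminf P o\<^sub>L (p - h))"
      using bounded_linear.sums[OF bil summable_sums[OF summ]] by simp
    moreover have "(\<lambda>k. P k - P (Suc k)) sums (P 0 - 0)"
      by (rule telescope_sums') (rule summable_LIMSEQ_zero[OF summ])
    ultimately show "suminf P o\<^sub>L (p - h) = p" by (metis P_simps(1) diff_zero sums_unique2)
  qed
qed

text \<open>If \<open>c = \<theta>(a)\<close> had norm greater than \<open>a\<close>, then \<open>p - a\<^sup>*a/\<parallel>c\<parallel>\<^sup>2\<close> would be invertible, hence so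
  would be its image; but \<open>\<parallel>c\<parallel>\<^sup>2 - c\<^sup>*c\<close> is not bounded below on vectors where \<open>c\<close> nearly attains its
  norm.\<close>

lemma star_hom_contractive:
  fixes \<theta> :: "'k::chilbert_space op \<Rightarrow> 'l::chilbert_space op"
  assumes A: "cstar_algebra A" and unit: "is_unit A p" and lin: "linear_on A \<theta>"
    and mult: "\<And>a b. a \<in> A \<Longrightarrow> b \<in> A \<Longrightarrow> \<theta> (a o\<^sub>L b) = \<theta> a o\<^sub>L \<theta> b"
    and star: "\<And>a b. a \<in> A \<Longrightarrow> b \<in> A \<Longrightarrow> is_adjoint a b \<Longrightarrow> is_adjoint (\<theta> a) (\<theta> b)"
    and a: "a \<in> A"
  shows "norm (\<theta> a) \<le> norm a"
proof (rule ccontr)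
  assume "\<not> norm (\<theta> a) \<le> norm a"
  define c where "c = \<theta> a"
  define q where "q = \<theta> p"
  define \<kappa> where "\<kappa> = (norm c)\<^sup>2"
  have less: "norm a < norm c" using \<open>\<not> norm (\<theta> a) \<le> norm a\<close> by (simp add: c_def)
  then have c0: "norm c > 0" using norm_ge_zero[of a] by linarith
  then have \<kappa>: "\<kappa> > 0" by (simp add: \<kappa>_def)
  have sub: "csubspace A" and multA: "\<And>a b. a \<in> A \<Longrightarrow> b \<in> A \<Longrightarrow> a o\<^sub>L b \<in> A"
    and adj: "\<And>a. a \<in> A \<Longrightarrow> \<exists>a'\<in>A. is_adjoint a a'"
    using A by (auto simp: cstar_algebra_def)
  have p: "p \<in> A" and pp: "p o\<^sub>L p = p" and ap: "a o\<^sub>L p = a" using unit a by (auto simp: is_unit_def)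
  have sa: "is_adjoint p p" using unit_self_adjoint[OF unit] adj[OF p] by blast
  have qq: "q o\<^sub>L q = q" using mult[OF p p] by (simp add: q_def pp)
  have qsa: "is_adjoint q q" using star[OF p p sa] by (simp add: q_def)
  obtain a' where a': "a' \<in> A" "is_adjoint a a'" using adj a by blast
  define c' where "c' = \<theta> a'"
  have c': "is_adjoint c c'" using star[OF a a'] by (simp add: c_def c'_def)
  define h where "h = complex_of_real (1 / \<kappa>) *\<^sub>C (a' o\<^sub>L a)"
  have aa: "a' o\<^sub>L a \<in> A" using a a' multA by blast
  then have h: "h \<in> A" unfolding h_def by (rule complex_vector.subspace_scale[OF sub])
  have "norm (a' o\<^sub>L a) \<le> norm a * norm a"
    using norm_blinfun_compose[of a' a] norm_adjoint[OF a'(2)] by simp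
  also have "\<dots> < \<kappa>"
    using less norm_ge_zero[of a] by (simp add: \<kappa>_def power2_eq_square mult_strict_mono')
  finally have "norm h < 1" using \<kappa> by (simp add: h_def norm_scaleC norm_divide field_simps)
  then obtain b where b: "b \<in> A" "b o\<^sub>L (p - h) = p" using neumann_inverse[OF A unit h] by blast
  have \<theta>h: "\<theta> h = complex_of_real (1 / \<kappa>) *\<^sub>C (c' o\<^sub>L c)"
    using lin aa mult[OF a'(1) a] by (simp add: h_def linear_on_def c_def c'_def)
  have "\<theta> (p - h) = q - \<theta> h"
  proof -
    have "(-1) *\<^sub>C h \<in> A" by (rule complex_vector.subspace_scale[OF sub h])
    then have "\<theta> (p + (-1) *\<^sub>C h) = q + (-1) *\<^sub>C \<theta> h"
      using lin p h unfolding linear_on_def q_def by metis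
    then show ?thesis by (simp add: complex_vector.scale_minus_left scaleC_one)
  qed
  moreover have "p - h \<in> A" by (rule complex_vector.subspace_diff[OF sub p h])
  ultimately have bq: "\<theta> b o\<^sub>L (q - \<theta> h) = q" using mult b by (metis q_def)
  \<comment> \<open>Adding 1 makes \<beta> at least 1, so that 1 - 1 / \<beta>^2 is nonnegative and
    below 1, and the final bound on |c|^2 is strictly less than \<kappa>.\<close>
  define \<beta> where "\<beta> = norm (\<theta> b) + 1"
  have \<beta>: "\<beta> \<ge> 1" by (simp add: \<beta>_def)
  have "(norm (c x))\<^sup>2 \<le> \<kappa> * (1 - 1 / \<beta>\<^sup>2) * (norm x)\<^sup>2" for x
  proof -
    \<comment> \<open>The left inverse \<theta>(b) of q - \<theta>(h) works only on the range of the
      projection q. Passing from x to q x costs nothing, as c = c q.\<close>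
    define y where "y = q x"
    have qy: "q y = y" unfolding y_def by (metis blinfun_apply_blinfun_compose comp_apply qq)
    have cy: "c y = c x"
      unfolding y_def q_def c_def by (metis blinfun_apply_blinfun_compose comp_apply ap mult[OF a p])
    \<comment> \<open>This is (q - \<theta>(h)) y. Since \<theta>(b) recovers y from it, the norm of
      y is at most \<beta> |z|.\<close>
    define z where "z = y - (1 / \<kappa>) *\<^sub>R c' (c y)"
    have "y = \<theta> b z"
    proof -
      have "\<theta> b ((q - \<theta> h) y) = q y" by (metis blinfun_apply_blinfun_compose comp_apply bq)
      then show ?thesis
        by (simp add: z_def \<theta>h blinfun.diff_left qy scaleC_blinfun.rep_eq scaleR_scaleC)
    qed
    then have "norm y \<le> norm (\<theta> b) * norm z" using norm_blinfun by metis
    also have "\<dots> \<le> \<beta> * norm z" by (simp add: \<beta>_def mult_right_mono)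
    finally have "(norm y)\<^sup>2 \<le> (\<beta> * norm z)\<^sup>2" by (rule power_mono) simp
    then have 1: "(norm y)\<^sup>2 \<le> \<beta>\<^sup>2 * (norm z)\<^sup>2" by (simp add: power_mult_distrib)
    have "(norm (c' (c y)))\<^sup>2 \<le> (norm c' * norm (c y))\<^sup>2" by (intro power_mono norm_blinfun) simp
    then have 2: "(norm (c' (c y)))\<^sup>2 \<le> \<kappa> * (norm (c y))\<^sup>2"
      by (simp add: power_mult_distrib norm_adjoint[OF c'] \<kappa>_def)
    have "inner y (c' (c y)) = (norm (c y))\<^sup>2"
      by (simp add: power2_norm_eq_inner flip: is_adjoint_inner[OF c'])
    then have "(norm z)\<^sup>2 = (norm y)\<^sup>2 - 2 / \<kappa> * (norm (c y))\<^sup>2 + (norm (c' (c y)))\<^sup>2 / \<kappa>\<^sup>2"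
      unfolding z_def power2_norm_eq_inner inner_diff_left inner_diff_right inner_scaleR_left inner_scaleR_right
      by (simp add: inner_commute[of "c' (c y)" y] power2_eq_square[of \<kappa>] diff_divide_distrib)
    also have "\<dots> \<le> (norm y)\<^sup>2 - (norm (c y))\<^sup>2 / \<kappa>"
      using 2 \<kappa> by (simp add: field_simps power2_eq_square[of \<kappa>])
    finally have "(norm z)\<^sup>2 \<le> (norm y)\<^sup>2 - (norm (c y))\<^sup>2 / \<kappa>" .
    then have "(norm y)\<^sup>2 \<le> \<beta>\<^sup>2 * ((norm y)\<^sup>2 - (norm (c y))\<^sup>2 / \<kappa>)"
      using 1 mult_left_mono[of "(norm z)\<^sup>2" _ "\<beta>\<^sup>2"] by (meson order_trans zero_le_power2)
    then have "(norm (c y))\<^sup>2 \<le> \<kappa> * (1 - 1 / \<beta>\<^sup>2) * (norm y)\<^sup>2"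
      using \<kappa> \<beta> by (simp add: field_simps)
    also have "\<dots> \<le> \<kappa> * (1 - 1 / \<beta>\<^sup>2) * (norm x)\<^sup>2"
      using \<kappa> \<beta> projection_contractive[OF qsa qq, of x]
      by (intro mult_left_mono power_mono) (simp_all add: y_def)
    finally show ?thesis by (simp add: cy)
  qed
  note sq = this
  have le: "norm (c x) \<le> sqrt (\<kappa> * (1 - 1 / \<beta>\<^sup>2)) * norm x" for x
    using real_sqrt_le_mono[OF sq[of x]] by (simp add: real_sqrt_mult)
  have "norm c \<le> sqrt (\<kappa> * (1 - 1 / \<beta>\<^sup>2))"
    using \<kappa> \<beta> by (intro norm_blinfun_bound le) simp
  then have "(norm c)\<^sup>2 \<le> \<kappa> * (1 - 1 / \<beta>\<^sup>2)"
    by (intro sqrt_ge_absD) simp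
  then show False using \<kappa> \<beta> by (simp add: \<kappa>_def field_simps)
qed

section \<open>Matrix entries of operators on \<open>H \<otimes> \<ell>\<^sup>2(X)\<close>\<close>

text \<open>The isometry v -> v \<otimes> \<delta>_s, whose adjoint is \<open>coord s\<close>. Both
  are contractions, so passing to a matrix entry is completely contractive.\<close>

definition ket :: "'x \<Rightarrow> 'h::chilbert_space \<Rightarrow>\<^sub>L ('x, 'h) ell2"
  where "ket s = Blinfun (\<lambda>v. Abs_ell2 (\<lambda>x. if x = s then v else 0))"

definition coord :: "'x \<Rightarrow> ('x, 'h::chilbert_space) ell2 \<Rightarrow>\<^sub>L 'h"
  where "coord s = Blinfun (\<lambda>\<xi>. Rep_ell2 \<xi> s)"

definition entry :: "('x, 'h::chilbert_space) ell2 op \<Rightarrow> 'x \<Rightarrow> 'x \<Rightarrow> 'h op"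
  where "entry x s t = coord s o\<^sub>L x o\<^sub>L ket t"

definition mat_op :: "'x set \<Rightarrow> ('x \<Rightarrow> 'x \<Rightarrow> 'h::chilbert_space op) \<Rightarrow> ('x, 'h) ell2 op"
  where "mat_op F X = (\<Sum>s\<in>F. \<Sum>t\<in>F. matrix_unit (X s t) s t)"

lemma ell2_eqI: "(\<And>x. Rep_ell2 \<xi> x = Rep_ell2 \<eta> x) \<Longrightarrow> \<xi> = \<eta>"
  by (metis Rep_ell2_inject ext)

lemma Rep_zero [simp]: "Rep_ell2 0 x = 0"
  by transfer simp

lemma Rep_sum: "Rep_ell2 (sum f S) x = (\<Sum>i\<in>S. Rep_ell2 (f i) x)"
  by (induction S rule: infinite_finite_induct) (simp_all add: Rep_simps)

lemma coord_apply:
  fixes \<xi> :: "('x, 'h::chilbert_space) ell2"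
  shows "coord s \<xi> = Rep_ell2 \<xi> s"
proof -
  have "bounded_linear (\<lambda>\<xi> :: ('x, 'h) ell2. Rep_ell2 \<xi> s)"
    by (rule bounded_linear_intro[where K = 1]) (simp_all add: Rep_simps norm_Rep_ell2_le)
  then show ?thesis by (simp add: coord_def bounded_linear_Blinfun_apply)
qed

lemma ket_exists:
  fixes v :: "'h::chilbert_space"
  shows "Rep_ell2 (Abs_ell2 (\<lambda>x. if x = s then v else 0)) x = (if x = s then v else 0)"
    and "norm (Abs_ell2 (\<lambda>x. if x = s then v else 0) :: ('x, 'h) ell2) = norm v"
proof -
  have R: "Rep_ell2 (Abs_ell2 (\<lambda>x. if x = s then v else 0)) = (\<lambda>x. if x = s then v else 0)" for s :: 'x
    by (rule Rep_Abs, rule finite_nonzero_values_imp_summable_on)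
      (auto intro: finite_subset[of _ "{s}"])
  show "Rep_ell2 (Abs_ell2 (\<lambda>x. if x = s then v else 0)) x = (if x = s then v else 0)" for s x :: 'x
    by (simp add: R)
  have "(\<Sum>\<^sub>\<infinity>x. (norm (if x = s then v else 0))\<^sup>2) = (\<Sum>\<^sub>\<infinity>x\<in>{s}. (norm v)\<^sup>2)"
    by (rule infsum_cong_neutral) auto
  then have "(norm (Abs_ell2 (\<lambda>x. if x = s then v else 0) :: ('x, 'h) ell2))\<^sup>2 = (norm v)\<^sup>2"
    unfolding norm_ell2_sq R by simp
  then show "norm (Abs_ell2 (\<lambda>x. if x = s then v else 0) :: ('x, 'h) ell2) = norm v" by simp
qed

lemma ket_apply:
  fixes v :: "'h::chilbert_space" and s :: 'x
  shows "ket s v = Abs_ell2 (\<lambda>x. if x = s then v else 0)"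
proof -
  have "bounded_linear (\<lambda>v :: 'h. Abs_ell2 (\<lambda>x :: 'x. if x = s then v else 0))"
    by (rule bounded_linear_intro[where K = 1])
      (auto intro!: ell2_eqI simp: Rep_simps ket_exists)
  then show ?thesis by (simp add: ket_def bounded_linear_Blinfun_apply)
qed

lemma Rep_ket: "Rep_ell2 (ket s v) x = (if x = s then v else 0)"
  and norm_ket_apply: "norm (ket s v) = norm v"
  by (simp_all add: ket_apply ket_exists)

lemma norm_ket: "norm (ket s) \<le> 1"
  by (rule norm_blinfun_bound) (simp_all add: norm_ket_apply)

lemma norm_coord: "norm (coord s) \<le> 1"
  by (rule norm_blinfun_bound) (simp_all add: coord_apply norm_Rep_ell2_le)

lemma ket_scaleC: "ket s (c *\<^sub>C v) = c *\<^sub>C ket s v"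
  by (auto intro!: ell2_eqI simp: Rep_ket Rep_simps)

lemma clinear_ket: "clinear_op (ket s)"
  by (simp add: clinear_op_def ket_scaleC)

lemma clinear_coord: "clinear_op (coord s)"
  by (simp add: clinear_op_def coord_apply Rep_simps)

lemma inner_ell2_infsum: "inner \<xi> \<eta> = (\<Sum>\<^sub>\<infinity>x. inner (Rep_ell2 \<xi> x) (Rep_ell2 \<eta> x))"
  by (rule inner_ell2.rep_eq)

lemma inner_ket: "inner (ket s v) \<xi> = inner v (Rep_ell2 \<xi> s)"
proof -
  have "inner (ket s v) \<xi> = (\<Sum>\<^sub>\<infinity>x\<in>{s}. inner v (Rep_ell2 \<xi> x))"
    unfolding inner_ell2_infsum by (rule infsum_cong_neutral) (auto simp: Rep_ket)
  then show ?thesis by simp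
qed

lemma cinner_ket: "cinner (ket s v) \<xi> = cinner v (Rep_ell2 \<xi> s)" "cinner \<xi> (ket s v) = cinner (Rep_ell2 \<xi> s) v"
proof -
  show 1: "cinner (ket s v) \<xi> = cinner v (Rep_ell2 \<xi> s)"
    by (simp add: cinner_def inner_ket flip: ket_scaleC)
  show "cinner \<xi> (ket s v) = cinner (Rep_ell2 \<xi> s) v"
    by (metis 1 cinner_commute)
qed

lemma Rep_sum_ket:
  "finite F \<Longrightarrow> Rep_ell2 (\<Sum>s\<in>F. ket s (f s)) x = (if x \<in> F then f x else 0)"
  by (simp add: Rep_sum Rep_ket)

lemma norm_sum_ket:
  assumes "finite F"
  shows "(norm (\<Sum>s\<in>F. ket s (f s)))\<^sup>2 = (\<Sum>s\<in>F. (norm (f s))\<^sup>2)"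
proof -
  have "(norm (\<Sum>s\<in>F. ket s (f s)))\<^sup>2 = (\<Sum>\<^sub>\<infinity>s\<in>F. (norm (f s))\<^sup>2)"
    unfolding norm_ell2_sq by (rule infsum_cong_neutral) (auto simp: Rep_sum_ket assms)
  then show ?thesis using assms by simp
qed

lemma Rep_proj_on: "Rep_ell2 (proj_on F \<xi>) x = (if x \<in> F then Rep_ell2 \<xi> x else 0)"
  unfolding proj_on_def by (subst Rep_diag[where M = 1]) (auto simp: norm_blinfun_id_le)

lemma proj_on_eq_sum: "finite F \<Longrightarrow> proj_on F \<xi> = (\<Sum>s\<in>F. ket s (Rep_ell2 \<xi> s))"
  by (rule ell2_eqI) (simp add: Rep_proj_on Rep_sum_ket)

lemma norm_proj_on: "finite F \<Longrightarrow> norm (proj_on F) \<le> 1"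
proof (rule norm_blinfun_bound)
  fix \<xi> :: "('a, 'b) ell2" assume "finite F"
  then have "(norm (proj_on F \<xi>))\<^sup>2 \<le> (norm \<xi>)\<^sup>2"
    by (simp add: proj_on_eq_sum norm_sum_ket sum_le_norm_ell2)
  then show "norm (proj_on F \<xi>) \<le> 1 * norm \<xi>" by (simp add: power2_le_iff_abs_le)
qed simp

lemma matrix_unit_eq: "matrix_unit a s t = ket s o\<^sub>L a o\<^sub>L coord t"
  by (intro blinfun_eqI ell2_eqI) (simp add: Rep_matrix_unit Rep_ket coord_apply)

lemma mat_op_apply: "mat_op F X \<xi> = (\<Sum>s\<in>F. ket s (\<Sum>t\<in>F. X s t (Rep_ell2 \<xi> t)))"
  by (simp add: mat_op_def matrix_unit_eq blinfun.sum_left blinfun.sum_right coord_apply)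

lemma Rep_mat_op:
  "finite F \<Longrightarrow> Rep_ell2 (mat_op F X \<xi>) s = (if s \<in> F then \<Sum>t\<in>F. X s t (Rep_ell2 \<xi> t) else 0)"
  by (simp add: mat_op_apply Rep_sum_ket)

lemma entry_mat_op: "finite F \<Longrightarrow> s \<in> F \<Longrightarrow> t \<in> F \<Longrightarrow> entry (mat_op F X) s t = X s t"
  by (rule blinfun_eqI) (simp add: entry_def coord_apply Rep_mat_op Rep_ket if_distrib sum.delta cong: if_cong)

lemma mat_op_entry:
  assumes "finite F" shows "mat_op F (entry x) = proj_on F o\<^sub>L x o\<^sub>L proj_on F"
proof (intro blinfun_eqI ell2_eqI)
  fix \<xi> s
  show "Rep_ell2 (mat_op F (entry x) \<xi>) s = Rep_ell2 ((proj_on F o\<^sub>L x o\<^sub>L proj_on F) \<xi>) s"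
    using assms by (simp add: Rep_mat_op Rep_proj_on entry_def coord_apply proj_on_eq_sum[of F \<xi>]
      blinfun.sum_right Rep_sum)
qed

lemma mat_op_cong: "(\<And>s t. s \<in> F \<Longrightarrow> t \<in> F \<Longrightarrow> X s t = Y s t) \<Longrightarrow> mat_op F X = mat_op F Y"
  by (simp add: mat_op_def)

lemma mat_op_add: "mat_op F (\<lambda>s t. X s t + Y s t) = mat_op F X + mat_op F Y"
  by (rule blinfun_eqI) (simp add: mat_op_apply blinfun.add_left blinfun.add_right sum.distrib)

lemma mat_op_scaleC: "mat_op F (\<lambda>s t. c *\<^sub>C X s t) = c *\<^sub>C mat_op F X"
  by (rule blinfun_eqI)
    (simp add: mat_op_apply scaleC_blinfun.rep_eq ket_scaleC flip: complex_vector.scale_sum_right)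

lemma mat_op_compose:
  "finite F \<Longrightarrow> mat_op F X o\<^sub>L mat_op F Y = mat_op F (\<lambda>s t. \<Sum>u\<in>F. X s u o\<^sub>L Y u t)"
  by (rule blinfun_eqI, simp add: mat_op_apply[of F X] mat_op_apply[of F "\<lambda>s t. \<Sum>u\<in>F. X s u o\<^sub>L Y u t"]
      Rep_mat_op blinfun.sum_left blinfun.sum_right)
    (intro sum.cong refl arg_cong[where f = "ket _"] sum.swap)

lemma is_adjoint_sum:
  "(\<And>i. i \<in> I \<Longrightarrow> is_adjoint (f i) (g i)) \<Longrightarrow> is_adjoint (sum f I) (sum g I)"
proof (induction I rule: infinite_finite_induct)
  case (insert i I) then show ?case by (simp add: is_adjoint_add)
qed (simp_all add: is_adjoint_def)

lemma is_adjoint_mat_op: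
  assumes "\<And>s t. s \<in> F \<Longrightarrow> t \<in> F \<Longrightarrow> is_adjoint (X s t) (Y t s)"
  shows "is_adjoint (mat_op F X) (mat_op F Y)"
proof -
  have "is_adjoint (matrix_unit a s t) (matrix_unit b t s)" if "is_adjoint a b" for a b :: "'b op" and s t :: 'a
    using that unfolding is_adjoint_def matrix_unit_eq by (simp add: cinner_ket coord_apply)
  then have "is_adjoint (mat_op F X) (\<Sum>s\<in>F. \<Sum>t\<in>F. matrix_unit (Y t s) t s)"
    unfolding mat_op_def using assms by (intro is_adjoint_sum) blast
  also have "(\<Sum>s\<in>F. \<Sum>t\<in>F. matrix_unit (Y t s) t s) = mat_op F Y"
    unfolding mat_op_def by (rule sum.swap)
  finally show ?thesis .
qed

lemma clinear_op_mat_op: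
  assumes "\<And>s t. s \<in> F \<Longrightarrow> t \<in> F \<Longrightarrow> clinear_op (X s t)"
  shows "clinear_op (mat_op F X)"
proof -
  have "mat_op F X \<in> {T. clinear_op T}"
    unfolding mat_op_def matrix_unit_eq
    by (intro complex_vector.subspace_sum[OF csubspace_clinear_op])
      (simp add: clinear_op_compose clinear_ket clinear_coord assms)
  then show ?thesis by simp
qed

text \<open>Identifies a matrix with a single operator, so that results on elements of a C*-algebra
  apply to matrices. One direction discards coordinates outside F, the other tests on vectors
  supported in F.\<close>

lemma mat_bounded_iff_norm_mat_op:
  assumes F: "finite F" and M: "M \<ge> 0"
  shows "mat_bounded F X M \<longleftrightarrow> norm (mat_op F X) \<le> M"
proof
  assume X: "mat_bounded F X M"
  show "norm (mat_op F X) \<le> M"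
  proof (rule norm_blinfun_bound[OF M])
    fix \<xi> :: "('a, 'b) ell2"
    have "(norm (mat_op F X \<xi>))\<^sup>2 \<le> M\<^sup>2 * (\<Sum>t\<in>F. (norm (Rep_ell2 \<xi> t))\<^sup>2)"
      using mat_boundedD[OF X] by (simp add: mat_op_apply norm_sum_ket F)
    also have "\<dots> \<le> M\<^sup>2 * (norm \<xi>)\<^sup>2" by (intro mult_left_mono sum_le_norm_ell2 F) simp
    finally have "(norm (mat_op F X \<xi>))\<^sup>2 \<le> (M * norm \<xi>)\<^sup>2" by (simp add: power_mult_distrib)
    then show "norm (mat_op F X \<xi>) \<le> M * norm \<xi>" by (rule power2_le_imp_le) (simp add: M)
  qed
next
  assume X: "norm (mat_op F X) \<le> M"
  show "mat_bounded F X M"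
    unfolding mat_bounded_def
  proof
    fix \<xi> :: "'a \<Rightarrow> 'b"
    let ?\<zeta> = "\<Sum>t\<in>F. ket t (\<xi> t)"
    have "(\<Sum>s\<in>F. (norm (\<Sum>t\<in>F. X s t (\<xi> t)))\<^sup>2) = (norm (mat_op F X ?\<zeta>))\<^sup>2"
      by (simp add: mat_op_apply norm_sum_ket F Rep_sum_ket)
    also have "\<dots> \<le> (M * norm ?\<zeta>)\<^sup>2"
      by (intro power_mono order_trans[OF norm_blinfun] mult_right_mono X) auto
    also have "\<dots> = M\<^sup>2 * (\<Sum>t\<in>F. (norm (\<xi> t))\<^sup>2)" by (simp add: power_mult_distrib norm_sum_ket F)
    finally show "(\<Sum>s\<in>F. (norm (\<Sum>t\<in>F. X s t (\<xi> t)))\<^sup>2) \<le> M\<^sup>2 * (\<Sum>t\<in>F. (norm (\<xi> t))\<^sup>2)" .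
  qed
qed

lemma bounded_linear_entry: "bounded_linear (\<lambda>x. entry x s t)"
  using bounded_linear_compose[OF
      bounded_bilinear.bounded_linear_left[OF bounded_bilinear_blinfun_compose, of "ket t"]
      bounded_bilinear.bounded_linear_right[OF bounded_bilinear_blinfun_compose, of "coord s"]]
  by (simp add: entry_def)

lemma entry_scaleC: "entry (c *\<^sub>C x) s t = c *\<^sub>C entry x s t"
  by (rule blinfun_eqI) (simp add: entry_def scaleC_blinfun.rep_eq coord_apply Rep_simps)

lemmas entry_add = linear_add[OF bounded_linear.linear[OF bounded_linear_entry]]

section \<open>Matrix algebras over finite index sets\<close>

text \<open>Replaces a span by conditions on entries that survive limits when \<open>A\<close> is
  closed; closedness and the algebra operations of M_F(A) are read off from it.\<close>

lemma matrix_alg_iff: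
  assumes F: "finite F" and A: "csubspace A"
  shows "x \<in> matrix_alg A F \<longleftrightarrow>
    proj_on F o\<^sub>L x o\<^sub>L proj_on F = x \<and> (\<forall>s\<in>F. \<forall>t\<in>F. entry x s t \<in> A)"
proof
  assume "x \<in> matrix_alg A F"
  then have "\<exists>X. (\<forall>s t. X s t \<in> A) \<and> x = mat_op F X"
    unfolding matrix_alg_def
  proof (induction rule: complex_vector.span_induct_alt)
    case base
    show ?case
      by (intro exI[of _ "\<lambda>_ _. 0"]) (simp add: complex_vector.subspace_0[OF A] mat_op_def matrix_unit_eq)
  next
    case (step c x y)
    then obtain a s t Y where x: "x = matrix_unit a s t" "a \<in> A" "s \<in> F" "t \<in> F"
      and Y: "\<And>s t. Y s t \<in> A" "y = mat_op F Y" by blast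
    let ?X = "\<lambda>u v. if u = s \<and> v = t then a else 0"
    have "x = mat_op F ?X"
    proof (intro blinfun_eqI ell2_eqI)
      fix \<xi> u
      have "(\<Sum>v\<in>F. ?X u v (Rep_ell2 \<xi> v)) = (if u = s then a (Rep_ell2 \<xi> t) else 0)"
        using x F by (cases "u = s") (simp_all add: if_distrib[of "\<lambda>f. blinfun_apply f _"] cong: if_cong)
      then show "Rep_ell2 (x \<xi>) u = Rep_ell2 (mat_op F ?X \<xi>) u"
        using x F by (simp add: Rep_matrix_unit Rep_mat_op)
    qed
    then have "c *\<^sub>C x + y = mat_op F (\<lambda>u v. c *\<^sub>C ?X u v + Y u v)"
      by (simp only: mat_op_add mat_op_scaleC Y)
    moreover have "c *\<^sub>C ?X u v + Y u v \<in> A" for u v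
      using x Y complex_vector.subspace_0[OF A]
      by (intro complex_vector.subspace_add[OF A] complex_vector.subspace_scale[OF A]) auto
    ultimately show ?case by (intro exI[of _ "\<lambda>u v. c *\<^sub>C ?X u v + Y u v"]) simp
  qed
  then obtain X where X: "\<And>s t. X s t \<in> A" "x = mat_op F X" by blast
  then have e: "entry x s t = X s t" if "s \<in> F" "t \<in> F" for s t using that F by (simp add: entry_mat_op)
  then have "mat_op F (entry x) = x" using X(2) by (metis mat_op_cong)
  with e X(1) F show "proj_on F o\<^sub>L x o\<^sub>L proj_on F = x \<and> (\<forall>s\<in>F. \<forall>t\<in>F. entry x s t \<in> A)"
    by (simp add: mat_op_entry)
next
  assume x: "proj_on F o\<^sub>L x o\<^sub>L proj_on F = x \<and> (\<forall>s\<in>F. \<forall>t\<in>F. entry x s t \<in> A)"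
  then have "x = mat_op F (entry x)" using F by (simp add: mat_op_entry)
  moreover have "mat_op F (entry x) \<in> matrix_alg A F"
    unfolding mat_op_def matrix_alg_def
    using x by (intro complex_vector.span_sum complex_vector.span_base) blast
  ultimately show "x \<in> matrix_alg A F" by simp
qed

lemma mat_op_in_matrix_alg:
  assumes "\<And>s t. s \<in> F \<Longrightarrow> t \<in> F \<Longrightarrow> X s t \<in> A"
  shows "mat_op F X \<in> matrix_alg A F"
  unfolding mat_op_def matrix_alg_def
  using assms by (intro complex_vector.span_sum complex_vector.span_base) blast

lemma matrix_alg_mat_op:
  assumes "finite F" "csubspace A" "x \<in> matrix_alg A F"
  shows "mat_op F (entry x) = x" and "s \<in> F \<Longrightarrow> t \<in> F \<Longrightarrow> entry x s t \<in> A"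
  using assms by (simp_all add: matrix_alg_iff mat_op_entry)

lemma csubspace_matrix_alg: "csubspace (matrix_alg A F)"
  unfolding matrix_alg_def by (rule complex_vector.subspace_span)

lemma cstar_algebra_matrix_alg:
  fixes A :: "'h::chilbert_space op set" and F :: "'x set"
  assumes A: "cstar_algebra A" and F: "finite F"
  shows "cstar_algebra (matrix_alg A F)"
  unfolding cstar_algebra_def
proof (intro conjI ballI)
  have sub: "csubspace A" and clA: "closed A" and multA: "\<And>a b. a \<in> A \<Longrightarrow> b \<in> A \<Longrightarrow> a o\<^sub>L b \<in> A"
    and adj: "\<And>a. a \<in> A \<Longrightarrow> \<exists>a'\<in>A. is_adjoint a a'" and cl: "\<And>a. a \<in> A \<Longrightarrow> clinear_op a"
    using A by (auto simp: cstar_algebra_def)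
  note ent = matrix_alg_mat_op[OF F sub]
  show "csubspace (matrix_alg A F)" by (rule csubspace_matrix_alg)
  show "clinear_op x" if "x \<in> matrix_alg A F" for x
    using ent[OF that] clinear_op_mat_op[of F "entry x"] cl by metis
  show "x o\<^sub>L y \<in> matrix_alg A F" if xy: "x \<in> matrix_alg A F" "y \<in> matrix_alg A F" for x y
  proof -
    have "x o\<^sub>L y = mat_op F (\<lambda>s t. \<Sum>u\<in>F. entry x s u o\<^sub>L entry y u t)"
      using mat_op_compose[OF F, of "entry x" "entry y"] by (simp add: ent(1)[OF xy(1)] ent(1)[OF xy(2)])
    moreover have "mat_op F (\<lambda>s t. \<Sum>u\<in>F. entry x s u o\<^sub>L entry y u t) \<in> matrix_alg A F"
      by (intro mat_op_in_matrix_alg complex_vector.subspace_sum[OF sub] multA ent(2) xy)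
    ultimately show ?thesis by simp
  qed
  show "\<exists>x'\<in>matrix_alg A F. is_adjoint x x'" if x: "x \<in> matrix_alg A F" for x
  proof -
    have "\<forall>s t. \<exists>a'. s \<in> F \<longrightarrow> t \<in> F \<longrightarrow> a' \<in> A \<and> is_adjoint (entry x t s) a'"
      using adj ent(2)[OF x] by blast
    then obtain Y where Y: "\<And>s t. s \<in> F \<Longrightarrow> t \<in> F \<Longrightarrow> Y s t \<in> A \<and> is_adjoint (entry x t s) (Y s t)" by metis
    then have "is_adjoint (mat_op F (entry x)) (mat_op F Y)" by (intro is_adjoint_mat_op) blast
    then show ?thesis using ent(1)[OF x] Y mat_op_in_matrix_alg[of F Y A] by auto
  qed
  have "matrix_alg A F = {x. proj_on F o\<^sub>L x o\<^sub>L proj_on F = x} \<inter> (\<Inter>s\<in>F. \<Inter>t\<in>F. (\<lambda>x. entry x s t) -` A)"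
    using F sub by (auto simp: matrix_alg_iff)
  moreover have "closed {x :: ('x, 'h) ell2 op. proj_on F o\<^sub>L x o\<^sub>L proj_on F = x}"
    by (intro closed_Collect_eq continuous_intros)
  moreover have "closed ((\<lambda>x. entry x s t) -` A)" for s t
    using clA by (intro continuous_closed_vimage linear_continuous_at bounded_linear_entry)
  ultimately show "closed (matrix_alg A F)" by (auto intro!: closed_Int closed_INT)
qed

lemma blinfun_compose_assoc: "(x o\<^sub>L y) o\<^sub>L z = x o\<^sub>L (y o\<^sub>L z)"
  by (rule blinfun_eqI) simp

lemma is_unit_matrix_alg:
  fixes A :: "'h::chilbert_space op set" and F :: "'x set"
  assumes A: "unital_cstar_algebra A" and F: "finite F"
  shows "is_unit (matrix_alg A F) (proj_on F)"
proof -
  have sub: "csubspace A" and 1: "id_blinfun \<in> A" using A by (auto simp: unital_cstar_algebra_def cstar_algebra_def)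
  have PP: "proj_on F o\<^sub>L proj_on F = (proj_on F :: ('x, 'h) ell2 op)"
    by (intro blinfun_eqI ell2_eqI) (simp add: Rep_proj_on)
  have PP': "x o\<^sub>L proj_on F o\<^sub>L proj_on F = x o\<^sub>L proj_on F" for x :: "('x, 'h) ell2 op"
    using PP by (metis blinfun_compose_assoc)
  have PP'': "proj_on F o\<^sub>L (proj_on F o\<^sub>L x) = proj_on F o\<^sub>L x" for x :: "('x, 'h) ell2 op"
    using PP by (metis blinfun_compose_assoc)
  have "entry (proj_on F :: ('x, 'h) ell2 op) s t = (if s = t then id_blinfun else 0)" if "s \<in> F" "t \<in> F" for s t :: 'x
    using that by (intro blinfun_eqI) (simp add: entry_def coord_apply Rep_proj_on Rep_ket)
  then have "proj_on F \<in> matrix_alg A F"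
    using 1 complex_vector.subspace_0[OF sub] F sub by (simp add: matrix_alg_iff PP PP')
  moreover have "proj_on F o\<^sub>L x = x \<and> x o\<^sub>L proj_on F = x" if "x \<in> matrix_alg A F" for x
    using that F sub unfolding matrix_alg_iff[OF F sub] by (metis PP' PP'' blinfun_compose_assoc)
  ultimately show ?thesis by (simp add: is_unit_def)
qed

lemma operator_systemI:
  "cstar_algebra S \<Longrightarrow> is_unit S p \<Longrightarrow> operator_system S"
  by (auto simp: cstar_algebra_def operator_system_def)

lemma is_unit_id: "id_blinfun \<in> A \<Longrightarrow> is_unit A id_blinfun"
  by (simp add: is_unit_def blinfun_eqI)

text \<open>Applying \<theta> to entries is a *-homomorphism of the C*-algebra M_F(A). Its
  contractivity there is complete contractivity of \<theta>.\<close>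

lemma star_automorphism_mat_bounded:
  assumes A: "unital_cstar_algebra A" and \<theta>: "star_automorphism A \<theta>" and F: "finite F"
    and X: "\<And>s t. s \<in> F \<Longrightarrow> t \<in> F \<Longrightarrow> X s t \<in> A" and M: "mat_bounded F X M" "M \<ge> 0"
  shows "mat_bounded F (\<lambda>s t. \<theta> (X s t)) M"
proof -
  have cA: "cstar_algebra A" and sub: "csubspace A" and multA: "\<And>a b. a \<in> A \<Longrightarrow> b \<in> A \<Longrightarrow> a o\<^sub>L b \<in> A"
    using A by (auto simp: cstar_algebra_def unital_cstar_algebra_def)
  have lin: "linear_on A \<theta>" and mult: "\<And>a b. a \<in> A \<Longrightarrow> b \<in> A \<Longrightarrow> \<theta> (a o\<^sub>L b) = \<theta> a o\<^sub>L \<theta> b"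
    and star: "\<And>a b. a \<in> A \<Longrightarrow> b \<in> A \<Longrightarrow> is_adjoint a b \<Longrightarrow> is_adjoint (\<theta> a) (\<theta> b)"
    using \<theta> by (auto simp: star_automorphism_def)
  have zero: "\<theta> 0 = 0"
    using lin complex_vector.subspace_0[OF sub] unfolding linear_on_def
    by (metis complex_vector.scale_zero_left)
  have sum: "f ` I \<subseteq> A \<Longrightarrow> \<theta> (sum f I) = (\<Sum>i\<in>I. \<theta> (f i))" for f :: "'x \<Rightarrow> _" and I
  proof (induction I rule: infinite_finite_induct)
    case (insert i I)
    then have "f i \<in> A" "sum f I \<in> A" by (auto intro: complex_vector.subspace_sum[OF sub])
    then show ?case using insert lin by (simp add: linear_on_def)
  qed (simp_all add: zero)
  define \<Theta> where "\<Theta> x = mat_op F (\<lambda>s t. \<theta> (entry x s t))" for x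
  note ent = matrix_alg_mat_op[OF F sub]
  have "norm (\<Theta> x) \<le> norm x" if "x \<in> matrix_alg A F" for x
  proof (rule star_hom_contractive[OF cstar_algebra_matrix_alg[OF cA F] is_unit_matrix_alg[OF A F] _ _ _ that])
    show "linear_on (matrix_alg A F) \<Theta>"
      unfolding linear_on_def \<Theta>_def
    proof (intro conjI ballI allI)
      fix x y assume "x \<in> matrix_alg A F" "y \<in> matrix_alg A F"
      then show "mat_op F (\<lambda>s t. \<theta> (entry (x + y) s t)) =
          mat_op F (\<lambda>s t. \<theta> (entry x s t)) + mat_op F (\<lambda>s t. \<theta> (entry y s t))"
        using lin ent(2) unfolding mat_op_add[symmetric]
        by (intro mat_op_cong) (simp add: entry_add linear_on_def)
    next
      fix x c assume "x \<in> matrix_alg A F"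
      then show "mat_op F (\<lambda>s t. \<theta> (entry (c *\<^sub>C x) s t)) = c *\<^sub>C mat_op F (\<lambda>s t. \<theta> (entry x s t))"
        using lin ent(2) unfolding mat_op_scaleC[symmetric]
        by (intro mat_op_cong) (simp add: entry_scaleC linear_on_def)
    qed
  next
    fix x y assume xy: "x \<in> matrix_alg A F" "y \<in> matrix_alg A F"
    have "x o\<^sub>L y = mat_op F (\<lambda>s t. \<Sum>u\<in>F. entry x s u o\<^sub>L entry y u t)"
      using mat_op_compose[OF F, of "entry x" "entry y"] by (simp add: ent(1)[OF xy(1)] ent(1)[OF xy(2)])
    then have "entry (x o\<^sub>L y) s t = (\<Sum>u\<in>F. entry x s u o\<^sub>L entry y u t)" if "s \<in> F" "t \<in> F" for s t
      using that F by (simp add: entry_mat_op)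
    then show "\<Theta> (x o\<^sub>L y) = \<Theta> x o\<^sub>L \<Theta> y"
      unfolding \<Theta>_def mat_op_compose[OF F]
      using multA ent(2)[OF xy(1)] ent(2)[OF xy(2)]
      by (intro mat_op_cong) (simp add: sum image_subset_iff mult)
  next
    fix x y assume xy: "x \<in> matrix_alg A F" "y \<in> matrix_alg A F" "is_adjoint x y"
    have "is_adjoint (entry x s t) (entry y t s)" for s t
      using xy(3) unfolding is_adjoint_def
      by (simp add: entry_def coord_apply flip: cinner_ket)
    then show "is_adjoint (\<Theta> x) (\<Theta> y)"
      unfolding \<Theta>_def by (intro is_adjoint_mat_op star ent(2) xy)
  qed
  from this[OF mat_op_in_matrix_alg[OF X]] have "norm (\<Theta> (mat_op F X)) \<le> norm (mat_op F X)" .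
  moreover have "\<Theta> (mat_op F X) = mat_op F (\<lambda>s t. \<theta> (X s t))"
    unfolding \<Theta>_def using F by (intro mat_op_cong) (simp add: entry_mat_op)
  ultimately show ?thesis
    using M mat_bounded_iff_norm_mat_op[OF F M(2)] by (metis order_trans)
qed

text \<open>An n by n matrix over M_F(A) is a matrix over A indexed by pairs, and the complete bound
  of \<Phi> holds at every matrix size. So entrywise application of \<Phi> has the same
  constant.\<close>

lemma mat_bounded_matrix_amplification:
  fixes Y :: "nat \<Rightarrow> nat \<Rightarrow> ('x, 'h::chilbert_space) ell2 op" and \<Phi> :: "'h op \<Rightarrow> 'h op"
  assumes cb: "cb_norm A \<Phi> \<le> ennreal C" "C \<ge> 0" and F: "finite F"
    and Y: "\<And>i j s t. i < n \<Longrightarrow> j < n \<Longrightarrow> s \<in> F \<Longrightarrow> t \<in> F \<Longrightarrow> entry (Y i j) s t \<in> A"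
      "mat_bounded {..<n} Y 1"
  shows "mat_bounded {..<n} (\<lambda>i j. mat_op F (\<lambda>s t. \<Phi> (entry (Y i j) s t))) C"
proof -
  define Z where "Z = (\<lambda>(i, s) (j, t). entry (Y i j) s t)"
  have fin: "finite ({..<n} \<times> F)" using F by simp
  have "mat_bounded ({..<n} \<times> F) Z 1"
    unfolding mat_bounded_def
  proof
    fix \<xi> :: "nat \<times> 'x \<Rightarrow> 'h"
    define \<zeta> where "\<zeta> = (\<lambda>j. \<Sum>t\<in>F. ket t (\<xi> (j, t)))"
    have "(\<Sum>k\<in>{..<n} \<times> F. (norm (\<Sum>l\<in>{..<n} \<times> F. Z k l (\<xi> l)))\<^sup>2)
        = (\<Sum>i<n. \<Sum>s\<in>F. (norm (Rep_ell2 (\<Sum>j<n. Y i j (\<zeta> j)) s))\<^sup>2)"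
      by (simp add: Z_def \<zeta>_def entry_def coord_apply Rep_sum blinfun.sum_right sum.cartesian_product' split_def
          flip: sum.cartesian_product)
    \<comment> \<open>Coordinates outside F are dropped: \<open>Y i j\<close> may move vectors
      supported in F out of F.\<close>
    also have "\<dots> \<le> (\<Sum>i<n. (norm (\<Sum>j<n. Y i j (\<zeta> j)))\<^sup>2)"
      by (intro sum_mono sum_le_norm_ell2 F)
    also have "\<dots> \<le> 1\<^sup>2 * (\<Sum>j<n. (norm (\<zeta> j))\<^sup>2)" by (rule mat_boundedD[OF Y(2)])
    also have "\<dots> = 1\<^sup>2 * (\<Sum>l\<in>{..<n} \<times> F. (norm (\<xi> l))\<^sup>2)"
      by (simp add: \<zeta>_def norm_sum_ket F sum.cartesian_product)
    finally show "(\<Sum>k\<in>{..<n} \<times> F. (norm (\<Sum>l\<in>{..<n} \<times> F. Z k l (\<xi> l)))\<^sup>2)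
        \<le> 1\<^sup>2 * (\<Sum>l\<in>{..<n} \<times> F. (norm (\<xi> l))\<^sup>2)" .
  qed
  then have \<Phi>Z: "mat_bounded ({..<n} \<times> F) (\<lambda>k l. \<Phi> (Z k l)) C"
    using Y(1) by (intro cb_norm_le_mat_bounded[OF cb fin]) (auto simp: Z_def)
  show ?thesis
    unfolding mat_bounded_def
  proof
    fix \<xi> :: "nat \<Rightarrow> ('x, 'h) ell2"
    define \<zeta> where "\<zeta> = (\<lambda>(j, t). Rep_ell2 (\<xi> j) t)"
    have "(\<Sum>j<n. mat_op F (\<lambda>s t. \<Phi> (entry (Y i j) s t)) (\<xi> j))
        = (\<Sum>s\<in>F. ket s (\<Sum>l\<in>{..<n} \<times> F. \<Phi> (Z (i, s) l) (\<zeta> l)))" for i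
      unfolding mat_op_apply Z_def \<zeta>_def
      by (subst sum.swap) (simp add: blinfun.sum_right sum.cartesian_product split_def)
    then have "(\<Sum>i<n. (norm (\<Sum>j<n. mat_op F (\<lambda>s t. \<Phi> (entry (Y i j) s t)) (\<xi> j)))\<^sup>2)
        = (\<Sum>k\<in>{..<n} \<times> F. (norm (\<Sum>l\<in>{..<n} \<times> F. \<Phi> (Z k l) (\<zeta> l)))\<^sup>2)"
      by (simp add: norm_sum_ket F sum.cartesian_product split_def)
    also have "\<dots> \<le> C\<^sup>2 * (\<Sum>l\<in>{..<n} \<times> F. (norm (\<zeta> l))\<^sup>2)" by (rule mat_boundedD[OF \<Phi>Z])
    also have "\<dots> = C\<^sup>2 * (\<Sum>j<n. \<Sum>t\<in>F. (norm (Rep_ell2 (\<xi> j) t))\<^sup>2)"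
      by (simp add: \<zeta>_def sum.cartesian_product split_def)
    also have "\<dots> \<le> C\<^sup>2 * (\<Sum>j<n. (norm (\<xi> j))\<^sup>2)"
      by (intro mult_left_mono sum_mono sum_le_norm_ell2 F) simp
    finally show "(\<Sum>i<n. (norm (\<Sum>j<n. mat_op F (\<lambda>s t. \<Phi> (entry (Y i j) s t)) (\<xi> j)))\<^sup>2)
        \<le> C\<^sup>2 * (\<Sum>j<n. (norm (\<xi> j))\<^sup>2)" .
  qed
qed

section \<open>The coefficient algebra inside the crossed product\<close>

lemma linear_on_compose:
  "linear_on S f \<Longrightarrow> f ` S \<subseteq> T \<Longrightarrow> linear_on T g \<Longrightarrow> linear_on S (\<lambda>x. g (f x))"
  by (simp add: linear_on_def image_subset_iff)

lemma linear_on_conj: "linear_on S (\<lambda>x. V o\<^sub>L x o\<^sub>L W)" if "clinear_op V"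
  using that unfolding linear_on_def clinear_op_def
  by (auto intro!: blinfun_eqI simp: blinfun.add_left blinfun.add_right scaleC_blinfun.rep_eq)

lemma norm_conj_le:
  fixes V :: "'b::real_normed_vector \<Rightarrow>\<^sub>L 'c::real_normed_vector" and W :: "'d::real_normed_vector \<Rightarrow>\<^sub>L 'a::real_normed_vector"
  assumes "norm V \<le> 1" "norm W \<le> 1" shows "norm (V o\<^sub>L x o\<^sub>L W) \<le> norm x"
proof -
  have "norm (V o\<^sub>L x o\<^sub>L W) \<le> norm V * norm x * norm W"
    by (rule order_trans[OF norm_blinfun_compose mult_right_mono[OF norm_blinfun_compose norm_ge_zero]])
  also have "\<dots> \<le> 1 * norm x * 1" using assms by (intro mult_mono) auto
  finally show ?thesis by simp
qed

lemma closure_span_subset: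
  "G \<subseteq> S \<Longrightarrow> csubspace S \<Longrightarrow> closed S \<Longrightarrow> closure (cspan G) \<subseteq> S"
  by (meson closure_minimal complex_vector.span_minimal)

lemma entry_zero: "entry 0 s t = 0"
  by (rule blinfun_eqI) (simp add: entry_def coord_apply)

lemma csubspace_entry_vimage: "csubspace A \<Longrightarrow> csubspace {x. entry x s t \<in> A}"
  by (simp add: complex_vector.subspace_def entry_add entry_scaleC entry_zero)

lemma closed_entry_vimage: "closed A \<Longrightarrow> closed {x. entry x s t \<in> A}"
  unfolding vimage_def[symmetric]
  by (intro continuous_closed_vimage linear_continuous_at bounded_linear_entry)

lemma has_sum_sum:
  fixes f :: "'i \<Rightarrow> 'a \<Rightarrow> 'b::topological_comm_monoid_add"
  shows "(\<And>i. i \<in> I \<Longrightarrow> (f i has_sum s i) S) \<Longrightarrow> ((\<lambda>x. \<Sum>i\<in>I. f i x) has_sum (\<Sum>i\<in>I. s i)) S"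
  by (induction I rule: infinite_finite_induct) (simp_all add: has_sum_add)

context
  fixes A :: "'h::chilbert_space op set" and \<alpha> :: "'g::group_add \<Rightarrow> 'h op \<Rightarrow> 'h op"
  assumes A: "unital_cstar_algebra A" and \<alpha>: "cstar_action A \<alpha>"
begin

lemma A_facts:
  shows cstar_A: "cstar_algebra A" and csubspace_A: "csubspace A" and closed_A: "closed A"
    and clinear_A: "\<And>a. a \<in> A \<Longrightarrow> clinear_op a" and adjoint_A: "\<And>a. a \<in> A \<Longrightarrow> \<exists>a'\<in>A. is_adjoint a a'"
    and id_A: "id_blinfun \<in> A"
  using A by (auto simp: unital_cstar_algebra_def cstar_algebra_def)

lemma action_in: "a \<in> A \<Longrightarrow> \<alpha> s a \<in> A"
  using \<alpha> unfolding cstar_action_def star_automorphism_def by (metis bij_betwE)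

lemma action_facts:
  shows auto_action: "star_automorphism A (\<alpha> s)"
    and action_zero: "a \<in> A \<Longrightarrow> \<alpha> 0 a = a" and action_add: "a \<in> A \<Longrightarrow> \<alpha> (s + t) a = \<alpha> s (\<alpha> t a)"
    and action_linear: "linear_on A (\<alpha> s)"
    and action_adjoint: "a \<in> A \<Longrightarrow> a' \<in> A \<Longrightarrow> is_adjoint a a' \<Longrightarrow> is_adjoint (\<alpha> s a) (\<alpha> s a')"
  using \<alpha> by (auto simp: cstar_action_def star_automorphism_def bij_betw_def)

lemma norm_action_le: "a \<in> A \<Longrightarrow> norm (\<alpha> s a) \<le> norm a"
  using auto_action[of s] unfolding star_automorphism_def
  by (intro star_hom_contractive[OF cstar_A is_unit_id[OF id_A]]) auto

text \<open>Multiplicativity makes the image of 1 a left unit for the range, and surjectivity puts 1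
  into the range.\<close>

lemma action_id: "\<alpha> s id_blinfun = id_blinfun"
proof -
  obtain e where e: "e \<in> A" "\<alpha> s e = id_blinfun"
    using auto_action[of s] id_A unfolding star_automorphism_def bij_betw_def by (metis imageE)
  have "\<alpha> s (id_blinfun o\<^sub>L e) = \<alpha> s id_blinfun o\<^sub>L \<alpha> s e"
    using auto_action[of s] id_A e(1) by (simp add: star_automorphism_def)
  moreover have "id_blinfun o\<^sub>L e = e" "\<alpha> s id_blinfun o\<^sub>L id_blinfun = \<alpha> s id_blinfun"
    by (auto intro: blinfun_eqI)
  ultimately show ?thesis using e(2) by simp
qed

lemma Rep_cross_embed: "a \<in> A \<Longrightarrow> Rep_ell2 (cross_embed \<alpha> a \<xi>) u = \<alpha> (- u) a (Rep_ell2 \<xi> u)"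
  unfolding cross_embed_def by (rule Rep_diag[where M = "norm a"]) (rule norm_action_le)

lemma Rep_generator:
  "a \<in> A \<Longrightarrow> Rep_ell2 ((cross_embed \<alpha> a o\<^sub>L left_reg s) \<xi>) u = \<alpha> (- u) a (Rep_ell2 \<xi> (- s + u))"
  by (simp add: Rep_cross_embed Rep_left_reg)

lemma left_reg_zero: "left_reg 0 = id_blinfun"
  by (intro blinfun_eqI ell2_eqI) (simp add: Rep_left_reg)

lemma clinear_generator: "a \<in> A \<Longrightarrow> clinear_op (cross_embed \<alpha> a o\<^sub>L left_reg s)"
  unfolding clinear_op_def
  using clinear_A action_in
  by (auto intro!: ell2_eqI simp: Rep_cross_embed Rep_left_reg Rep_simps clinear_op_def)

text \<open>With a' the adjoint of a, the adjoint of a s is s^-1 a', which is \<alpha>(s^-1)(a')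
  s^-1 by the covariance relation.\<close>

lemma adjoint_generator:
  assumes a: "a \<in> A" "a' \<in> A" "is_adjoint a a'"
  shows "is_adjoint (cross_embed \<alpha> a o\<^sub>L left_reg s) (cross_embed \<alpha> (\<alpha> (- s) a') o\<^sub>L left_reg (- s))"
proof (rule is_adjointI)
  show "clinear_op (cross_embed \<alpha> a o\<^sub>L left_reg s)" using a(1) by (rule clinear_generator)
  fix \<xi> \<eta> :: "('g, 'h) ell2"
  have "inner ((cross_embed \<alpha> a o\<^sub>L left_reg s) \<xi>) \<eta>
      = (\<Sum>\<^sub>\<infinity>u. inner (\<alpha> (- u) a (Rep_ell2 \<xi> (- s + u))) (Rep_ell2 \<eta> u))"
    unfolding inner_ell2_infsum Rep_generator[OF a(1)] ..
  also have "\<dots> = (\<Sum>\<^sub>\<infinity>u. inner (Rep_ell2 \<xi> (- s + u)) (\<alpha> (- u) a' (Rep_ell2 \<eta> u)))"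
    by (simp add: is_adjoint_inner[OF action_adjoint[OF a]])
  \<comment> \<open>Substitute u = s + w. Then - u = - w - s, in this order because the group need
    not be abelian.\<close>
  also have "\<dots> = (\<Sum>\<^sub>\<infinity>w. inner (Rep_ell2 \<xi> w) (\<alpha> (- w) (\<alpha> (- s) a') (Rep_ell2 \<eta> (s + w))))"
  proof -
    have "\<alpha> (- w - s) a' = \<alpha> (- w) (\<alpha> (- s) a')" for w
      using action_add[OF a(2), of "- w" "- s"] by simp
    then show ?thesis
      using infsum_reindex_bij_betw[OF bij_shift[of "- s"],
          of "\<lambda>u. inner (Rep_ell2 \<xi> (- s + u)) (\<alpha> (- u) a' (Rep_ell2 \<eta> u))"]
      by (simp add: minus_add flip: add.assoc)
  qed
  also have "\<dots> = inner \<xi> ((cross_embed \<alpha> (\<alpha> (- s) a') o\<^sub>L left_reg (- s)) \<eta>)"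
    unfolding inner_ell2_infsum Rep_generator[OF action_in[OF a(2)]] by simp
  finally show "inner ((cross_embed \<alpha> a o\<^sub>L left_reg s) \<xi>) \<eta>
      = inner \<xi> ((cross_embed \<alpha> (\<alpha> (- s) a') o\<^sub>L left_reg (- s)) \<eta>)" .
qed

lemma csubspace_crossed_product: "csubspace (crossed_product A \<alpha>)"
  unfolding crossed_product_def by (intro csubspace_closure complex_vector.subspace_span)

lemma clinear_crossed_product: "x \<in> crossed_product A \<alpha> \<Longrightarrow> clinear_op x"
  using closure_span_subset[OF _ csubspace_clinear_op closed_clinear_op,
      of "{cross_embed \<alpha> a o\<^sub>L left_reg s |a s. a \<in> A}"] clinear_generator
  unfolding crossed_product_def by blast

lemma cross_embed_in_crossed_product: "a \<in> A \<Longrightarrow> cross_embed \<alpha> a \<in> crossed_product A \<alpha>"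
proof -
  assume "a \<in> A"
  then have "cross_embed \<alpha> a o\<^sub>L left_reg 0 \<in> crossed_product A \<alpha>"
    unfolding crossed_product_def
    by (intro subsetD[OF closure_subset] complex_vector.span_base) blast
  moreover have "cross_embed \<alpha> a o\<^sub>L left_reg 0 = cross_embed \<alpha> a"
    by (rule blinfun_eqI) (simp add: left_reg_zero)
  ultimately show ?thesis by simp
qed

lemma operator_system_crossed_product: "operator_system (crossed_product A \<alpha>)"
  unfolding operator_system_def
proof (intro conjI ballI)
  show "csubspace (crossed_product A \<alpha>)" by (rule csubspace_crossed_product)
  show "clinear_op x" if "x \<in> crossed_product A \<alpha>" for x using that by (rule clinear_crossed_product)
  show "\<exists>x'\<in>crossed_product A \<alpha>. is_adjoint x x'" if "x \<in> crossed_product A \<alpha>" for x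
    using that unfolding crossed_product_def
  proof (rule adjoint_in_closure_span[rotated])
    fix g assume "g \<in> {cross_embed \<alpha> a o\<^sub>L left_reg s |a s. a \<in> A}"
    then obtain a s where g: "g = cross_embed \<alpha> a o\<^sub>L left_reg s" "a \<in> A" by blast
    obtain a' where "a' \<in> A" "is_adjoint a a'" using adjoint_A g(2) by blast
    then show "\<exists>g'\<in>{cross_embed \<alpha> a o\<^sub>L left_reg s |a s. a \<in> A}. is_adjoint g g'"
      using adjoint_generator[OF g(2)] action_in unfolding g(1) by blast
  qed
  have "cross_embed \<alpha> id_blinfun = id_blinfun"
    by (intro blinfun_eqI ell2_eqI) (simp add: Rep_cross_embed id_A action_id)
  then have "id_blinfun \<in> crossed_product A \<alpha>" using cross_embed_in_crossed_product[OF id_A] by simp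
  then show "\<exists>p. is_unit (crossed_product A \<alpha>) p" using is_unit_id by blast
qed

text \<open>The compression to this entry is the canonical conditional expectation onto A: the
  generator a s is sent to a if s is the identity and to 0 otherwise. As A is closed, membership in
  A passes to the closed span.\<close>

lemma entry_crossed_product:
  assumes "x \<in> crossed_product A \<alpha>" shows "entry x 0 0 \<in> A"
proof -
  have "{cross_embed \<alpha> a o\<^sub>L left_reg s |a s. a \<in> A} \<subseteq> {x. entry x 0 0 \<in> A}"
  proof clarify
    fix a s assume a: "a \<in> A"
    have "entry (cross_embed \<alpha> a o\<^sub>L left_reg s) 0 0 = (if s = 0 then a else 0)"
      by (rule blinfun_eqI)
        (simp add: entry_def coord_apply Rep_cross_embed Rep_left_reg Rep_ket a action_zero)
    then show "entry (cross_embed \<alpha> a o\<^sub>L left_reg s) 0 0 \<in> A"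
      using a complex_vector.subspace_0[OF csubspace_A] by simp
  qed
  then have "crossed_product A \<alpha> \<subseteq> {x. entry x 0 0 \<in> A}"
    unfolding crossed_product_def
    by (rule closure_span_subset[OF _ csubspace_entry_vimage[OF csubspace_A] closed_entry_vimage[OF closed_A]])
  then show ?thesis using assms by blast
qed

lemma entry_cross_embed: "a \<in> A \<Longrightarrow> entry (cross_embed \<alpha> a) 0 0 = a"
  by (rule blinfun_eqI) (simp add: entry_def coord_apply Rep_cross_embed Rep_ket action_zero)

lemma linear_on_cross_embed: "linear_on A (cross_embed \<alpha>)"
  using action_linear complex_vector.subspace_add[OF csubspace_A] complex_vector.subspace_scale[OF csubspace_A]
  unfolding linear_on_def
  by (auto intro!: blinfun_eqI ell2_eqI
      simp: Rep_cross_embed Rep_simps blinfun.add_left scaleC_blinfun.rep_eq)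

text \<open>The embedding is block diagonal, with \<alpha> (- u) acting in coordinate u. Each block
  is completely contractive, and the squared norms are summed over u.\<close>

lemma cross_embed_mat_bounded:
  assumes X: "mat_in n A X" and M: "mat_bounded {..<n} X M" "M \<ge> 0"
  shows "mat_bounded {..<n} (\<lambda>i j. cross_embed \<alpha> (X i j)) M"
  unfolding mat_bounded_def
proof
  fix \<xi> :: "nat \<Rightarrow> ('g, 'h) ell2"
  define \<eta> where "\<eta> i = (\<Sum>j<n. cross_embed \<alpha> (X i j) (\<xi> j))" for i
  have R: "Rep_ell2 (\<eta> i) u = (\<Sum>j<n. \<alpha> (- u) (X i j) (Rep_ell2 (\<xi> j) u))" if "i < n" for i u
    unfolding \<eta>_def Rep_sum using X that by (intro sum.cong refl Rep_cross_embed) (simp add: mat_in_def)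
  have hs: "((\<lambda>u. \<Sum>i<n. (norm (Rep_ell2 (f i) u))\<^sup>2) has_sum (\<Sum>i<n. (norm (f i))\<^sup>2)) UNIV"
    for f :: "nat \<Rightarrow> ('g, 'h) ell2"
    by (intro has_sum_sum) (simp add: norm_ell2_sq has_sum_infsum summable_ell2)
  have "(\<Sum>i<n. (norm (\<eta> i))\<^sup>2) \<le> M\<^sup>2 * (\<Sum>j<n. (norm (\<xi> j))\<^sup>2)"
  proof (rule has_sum_mono[OF hs has_sum_cmult_right[OF hs]])
    fix u
    have "mat_bounded {..<n} (\<lambda>i j. \<alpha> (- u) (X i j)) M"
      using X by (intro star_automorphism_mat_bounded[OF A auto_action _ _ M]) (auto simp: mat_in_def)
    from mat_boundedD[OF this, of "\<lambda>j. Rep_ell2 (\<xi> j) u"]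
    show "(\<Sum>i<n. (norm (Rep_ell2 (\<eta> i) u))\<^sup>2) \<le> M\<^sup>2 * (\<Sum>j<n. (norm (Rep_ell2 (\<xi> j) u))\<^sup>2)"
      by (simp add: R)
  qed
  then show "(\<Sum>i<n. (norm (\<Sum>j<n. cross_embed \<alpha> (X i j) (\<xi> j)))\<^sup>2) \<le> M\<^sup>2 * (\<Sum>j<n. (norm (\<xi> j))\<^sup>2)"
    unfolding \<eta>_def .
qed

lemma approximable_of_crossed_product:
  assumes B: "approximable_with (crossed_product A \<alpha>) C" and C: "C > 0"
  shows "approximable_with A C"
  unfolding approximable_with_iff
proof (intro allI impI)
  let ?B = "crossed_product A \<alpha>"
  fix \<epsilon> :: real and X assume "\<epsilon> > 0" and X: "finite X \<and> X \<subseteq> A"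
  then have "finite (cross_embed \<alpha> ` X) \<and> cross_embed \<alpha> ` X \<subseteq> ?B"
    using cross_embed_in_crossed_product by blast
  then obtain \<Phi> where \<Phi>: "cb_finite_rank ?B C \<Phi>" "\<And>x. x \<in> X \<Longrightarrow> norm (\<Phi> (cross_embed \<alpha> x) - cross_embed \<alpha> x) < \<epsilon>"
    using B \<open>\<epsilon> > 0\<close> unfolding approximable_with_iff by (metis imageI)
  define \<Psi> where "\<Psi> a = entry (\<Phi> (cross_embed \<alpha> a)) 0 0" for a
  have embed: "cross_embed \<alpha> ` A \<subseteq> ?B" using cross_embed_in_crossed_product by blast
  have lin_entry: "linear_on UNIV (\<lambda>x. entry x 0 0)" by (simp add: linear_on_def entry_add entry_scaleC)
  have "\<Psi> ` A \<subseteq> A" "linear_on A \<Psi>" "finite_rank A \<Psi>"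
    using \<Phi>(1) embed unfolding cb_finite_rank_def \<Psi>_def
    by (auto intro!: entry_crossed_product linear_on_compose[OF _ _ lin_entry] finite_rank_compose[OF _ _ lin_entry]
        linear_on_compose[OF linear_on_cross_embed embed] finite_rank_precompose[OF _ embed])
  moreover have "cb_norm A \<Psi> \<le> ennreal C"
    unfolding cb_norm_le_iff[OF less_imp_le[OF C]]
  proof (intro allI impI)
    fix n X assume X: "mat_in n A X" "mat_bounded {..<n} X 1"
    have "mat_in n ?B (\<lambda>i j. cross_embed \<alpha> (X i j))"
      using X(1) cross_embed_in_crossed_product by (auto simp: mat_in_def)
    moreover have "mat_bounded {..<n} (\<lambda>i j. cross_embed \<alpha> (X i j)) 1"
      using X by (intro cross_embed_mat_bounded) auto
    ultimately have "mat_bounded {..<n} (\<lambda>i j. \<Phi> (cross_embed \<alpha> (X i j))) C"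
      using \<Phi>(1) unfolding cb_finite_rank_def cb_norm_le_iff[OF less_imp_le[OF C]] by blast
    then show "mat_bounded {..<n} (\<lambda>i j. \<Psi> (X i j)) C"
      unfolding \<Psi>_def entry_def by (rule mat_bounded_conj[OF _ norm_coord norm_ket])
  qed
  moreover have "norm (\<Psi> a - a) < \<epsilon>" if "a \<in> X" for a
  proof -
    \<comment> \<open>The compression undoes the embedding, so the error is the compression of the
      error in the crossed product.\<close>
    have "\<Psi> a - a = entry (\<Phi> (cross_embed \<alpha> a) - cross_embed \<alpha> a) 0 0"
      using that X unfolding \<Psi>_def linear_diff[OF bounded_linear.linear[OF bounded_linear_entry]]
      by (auto simp: entry_cross_embed)
    also have "norm \<dots> \<le> norm (\<Phi> (cross_embed \<alpha> a) - cross_embed \<alpha> a)"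
      unfolding entry_def by (rule norm_conj_le[OF norm_coord norm_ket])
    also have "\<dots> < \<epsilon>" using \<Phi>(2) that by blast
    finally show ?thesis .
  qed
  ultimately show "\<exists>\<Phi>. cb_finite_rank A C \<Phi> \<and> (\<forall>x\<in>X. norm (\<Phi> x - x) < \<epsilon>)"
    unfolding cb_finite_rank_def by blast
qed

end

section \<open>Factorization through matrix algebras\<close>

text \<open>An isometry V with adjoint W. The adjoint relation is spelled out because
  \<open>is_adjoint\<close> compares operators on one space, whereas here the spaces differ.\<close>

definition corner_embedding :: "('a::chilbert_space \<Rightarrow>\<^sub>L 'b::chilbert_space) \<Rightarrow> ('b \<Rightarrow>\<^sub>L 'a) \<Rightarrow> bool" where
  "corner_embedding V W \<longleftrightarrow> W o\<^sub>L V = id_blinfun \<and> norm V \<le> 1 \<and> norm W \<le> 1 \<and>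
     clinear_op V \<and> clinear_op W \<and> (\<forall>x y. cinner (V x) y = cinner x (W y))"

lemma corner_embeddingD:
  assumes "corner_embedding V W"
  shows "W (V x) = x" "norm V \<le> 1" "norm W \<le> 1" "clinear_op V" "clinear_op W"
    "cinner (V x) y = cinner x (W y)" "cinner y (V x) = cinner (W y) x"
proof -
  show "W (V x) = x"
    using assms unfolding corner_embedding_def by (metis blinfun_apply_blinfun_compose comp_apply id_blinfun.rep_eq id_apply)
  show "cinner y (V x) = cinner (W y) x"
    using assms unfolding corner_embedding_def by (metis cinner_commute)
qed (use assms in \<open>auto simp: corner_embedding_def\<close>)

text \<open>Since W V = 1, the map x -> V x W respects products and adjoints. The unit of the image
  is V p W, in general a proper projection.\<close>

lemma operator_system_corner:
  assumes VW: "corner_embedding V W" and S: "operator_system S"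
  shows "operator_system ((\<lambda>x. V o\<^sub>L x o\<^sub>L W) ` S)"
  unfolding operator_system_def
proof (intro conjI ballI)
  note D = corner_embeddingD[OF VW]
  have sub: "csubspace S" and cl: "\<And>x. x \<in> S \<Longrightarrow> clinear_op x" using S by (auto simp: operator_system_def)
  have lin: "linear_on UNIV (\<lambda>x. V o\<^sub>L x o\<^sub>L W)" by (rule linear_on_conj[OF D(4)])
  show "clinear_op y" if "y \<in> (\<lambda>x. V o\<^sub>L x o\<^sub>L W) ` S" for y
    using that cl D by (auto intro!: clinear_op_compose)
  show "csubspace ((\<lambda>x. V o\<^sub>L x o\<^sub>L W) ` S)"
  proof (rule complex_vector.subspaceI)
    have "V o\<^sub>L 0 o\<^sub>L W = 0" by (rule blinfun_eqI) simp
    then show "0 \<in> (\<lambda>x. V o\<^sub>L x o\<^sub>L W) ` S" using complex_vector.subspace_0[OF sub] by (metis imageI)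
  next
    fix x y assume "x \<in> (\<lambda>x. V o\<^sub>L x o\<^sub>L W) ` S" "y \<in> (\<lambda>x. V o\<^sub>L x o\<^sub>L W) ` S"
    then obtain a b where ab: "a \<in> S" "b \<in> S" "x = V o\<^sub>L a o\<^sub>L W" "y = V o\<^sub>L b o\<^sub>L W" by blast
    then have "x + y = V o\<^sub>L (a + b) o\<^sub>L W" using lin by (simp add: linear_on_def)
    then show "x + y \<in> (\<lambda>x. V o\<^sub>L x o\<^sub>L W) ` S" using complex_vector.subspace_add[OF sub] ab by blast
  next
    fix c x assume "x \<in> (\<lambda>x. V o\<^sub>L x o\<^sub>L W) ` S"
    then obtain a where a: "a \<in> S" "x = V o\<^sub>L a o\<^sub>L W" by blast
    then have "c *\<^sub>C x = V o\<^sub>L (c *\<^sub>C a) o\<^sub>L W" using lin by (simp add: linear_on_def)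
    then show "c *\<^sub>C x \<in> (\<lambda>x. V o\<^sub>L x o\<^sub>L W) ` S" using complex_vector.subspace_scale[OF sub] a by blast
  qed
  show "\<exists>y'\<in>(\<lambda>x. V o\<^sub>L x o\<^sub>L W) ` S. is_adjoint y y'" if y: "y \<in> (\<lambda>x. V o\<^sub>L x o\<^sub>L W) ` S" for y
  proof -
    obtain x where x: "x \<in> S" "y = V o\<^sub>L x o\<^sub>L W" using y by blast
    obtain x' where x': "x' \<in> S" "is_adjoint x x'" using S x(1) by (auto simp: operator_system_def)
    have "is_adjoint y (V o\<^sub>L x' o\<^sub>L W)" using x'(2) by (simp add: x(2) is_adjoint_def D)
    then show ?thesis using x'(1) by blast
  qed
  obtain p where p: "is_unit S p" using S by (auto simp: operator_system_def)
  have "(V o\<^sub>L x o\<^sub>L W) o\<^sub>L (V o\<^sub>L y o\<^sub>L W) = V o\<^sub>L (x o\<^sub>L y) o\<^sub>L W" for x y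
    by (rule blinfun_eqI) (simp add: D)
  then have "is_unit ((\<lambda>x. V o\<^sub>L x o\<^sub>L W) ` S) (V o\<^sub>L p o\<^sub>L W)"
    using p by (auto simp: is_unit_def)
  then show "\<exists>p. is_unit ((\<lambda>x. V o\<^sub>L x o\<^sub>L W) ` S) p" by blast
qed

lemma corner_embedding_in1: "corner_embedding in1 (out1 :: ('g, 'h::chilbert_space, 'k::chilbert_space) universe \<Rightarrow>\<^sub>L _)"
  and corner_embedding_in2: "corner_embedding in2 (out2 :: ('g, 'h, 'k) universe \<Rightarrow>\<^sub>L _)"
proof -
  have i1: "in1 x = (x, 0, 0 :: 'k)" for x :: "('g, 'h) ell2"
    unfolding in1_def by (subst bounded_linear_Blinfun_apply) (auto intro!: bounded_linear_Pair bounded_linear_ident bounded_linear_zero)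
  have i2: "in2 x = (0, x, 0 :: 'k)" for x :: "('g tuples, 'h) ell2"
    unfolding in2_def by (subst bounded_linear_Blinfun_apply) (auto intro!: bounded_linear_Pair bounded_linear_ident bounded_linear_zero)
  have n1: "norm (x, 0 :: ('g tuples, 'h) ell2, 0 :: 'k) = norm x" for x :: "('g, 'h) ell2"
    by (simp add: norm_Pair)
  have n2: "norm (0 :: ('g, 'h) ell2, x, 0 :: 'k) = norm x" for x :: "('g tuples, 'h) ell2"
    by (simp add: norm_Pair)
  have o1: "out1 u = fst u" for u :: "('g, 'h, 'k) universe"
    unfolding out1_def case_prod_unfold by (subst bounded_linear_Blinfun_apply) (auto intro: bounded_linear_fst)
  have o2: "out2 u = fst (snd u)" for u :: "('g, 'h, 'k) universe"
    unfolding out2_def case_prod_unfold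
    by (subst bounded_linear_Blinfun_apply) (auto intro: bounded_linear_compose[OF bounded_linear_fst bounded_linear_snd])
  show "corner_embedding in1 (out1 :: ('g, 'h, 'k) universe \<Rightarrow>\<^sub>L _)"
    unfolding corner_embedding_def clinear_op_def
    by (auto intro!: blinfun_eqI norm_blinfun_bound
        simp: i1 o1 n1 scaleC_prod_def cinner_def inner_prod_def norm_fst_le)
  show "corner_embedding in2 (out2 :: ('g, 'h, 'k) universe \<Rightarrow>\<^sub>L _)"
    unfolding corner_embedding_def clinear_op_def
    by (auto intro!: blinfun_eqI norm_blinfun_bound order_trans[OF norm_fst_le norm_snd_le]
        simp: i2 o2 n2 scaleC_prod_def cinner_def inner_prod_def)
qed

text \<open>Entries of an elementary tensor a \<otimes> T are scalar multiples of a, and having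
  entries in a closed subspace passes to closed linear spans.\<close>

lemma compress_stable_alg:
  fixes A :: "'h::chilbert_space op set" and F :: "'x set"
  assumes A: "csubspace A" "closed A" and F: "finite F" and w: "w \<in> stable_alg A"
  shows "proj_on F o\<^sub>L w o\<^sub>L proj_on F \<in> matrix_alg A F"
proof -
  have "entry w s t \<in> A" for s t
  proof -
    have "entry R s t \<in> A" if R: "a \<in> A" "is_op_tensor R a T" for R a T
    proof -
      have "ket t v = tens v (ket t 1)" for v :: 'h
        by (rule ell2_eqI) (simp add: Rep_tens Rep_ket scaleC_one)
      then have "entry R s t = Rep_ell2 (T (ket t 1)) s *\<^sub>C a"
        using R(2) by (intro blinfun_eqI) (simp add: entry_def coord_apply is_op_tensor_def Rep_tens scaleC_blinfun.rep_eq)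
      then show ?thesis using R(1) complex_vector.subspace_scale[OF A(1)] by simp
    qed
    then have "{R. \<exists>a\<in>A. \<exists>T\<in>{T. clinear_op T}. is_op_tensor R a T} \<subseteq> {x. entry x s t \<in> A}" by blast
    from closure_span_subset[OF this csubspace_entry_vimage[OF A(1)] closed_entry_vimage[OF A(2)]]
    show ?thesis using w unfolding stable_alg_def min_tensor_def by blast
  qed
  then show ?thesis unfolding mat_op_entry[OF F, symmetric] by (intro mat_op_in_matrix_alg)
qed

lemma mat_pos_conj:
  fixes V W :: "'k::chilbert_space op"
  assumes X: "mat_pos n X" and W: "\<And>x y. cinner x (V y) = cinner (W x) y"
  shows "mat_pos n (\<lambda>i j. V o\<^sub>L X i j o\<^sub>L W)"
  using X unfolding mat_pos_def by (simp add: W)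

text \<open>The classes \<open>\<P>\<close> and \<open>\<Q>\<close> stay arbitrary, so that the
  module and the comodule version of nuclearity yield the same factorization.\<close>

lemma nuclear_via_factorization:
  fixes A :: "'h::chilbert_space op set" and \<alpha> :: "'g::group_add \<Rightarrow> 'h op \<Rightarrow> 'h op"
    and \<P> :: "('g, 'h, 'k::chilbert_space) universe family \<Rightarrow> bool"
    and X :: "('g, 'h, 'k) universe op set"
  assumes "nuclear_via A \<alpha> \<P> \<Q>" "\<epsilon> > 0" "finite X" "X \<subseteq> univ_crossed A \<alpha>"
  shows "\<exists>(\<phi> :: ('g, 'h, 'k) universe op \<Rightarrow> ('g, 'h, 'k) universe op) \<psi> F. ccp_map (univ_crossed A \<alpha>) (univ_stable A) \<phi> \<and>
    ccp_map (univ_matrix A F) (univ_crossed A \<alpha>) \<psi> \<and> finite F \<and>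
    (\<forall>b\<in>X. norm (\<psi> (lift2 (proj_on F) o\<^sub>L \<phi> b o\<^sub>L lift2 (proj_on F)) - b) \<le> \<epsilon>)"
proof -
  obtain \<phi> :: "('g, 'h, 'k) universe op \<Rightarrow> ('g, 'h, 'k) universe op" and \<psi> F
    where 1: "ccp_map (univ_crossed A \<alpha>) (univ_stable A) \<phi>"
      and 2: "\<forall>F. finite F \<longrightarrow> ccp_map (univ_matrix A F) (univ_crossed A \<alpha>) (\<psi> F)"
      and F: "finite F" "\<forall>b\<in>X. norm (\<psi> F (lift2 (proj_on F) o\<^sub>L \<phi> b o\<^sub>L lift2 (proj_on F)) - b) \<le> \<epsilon>"
    using assms(1)[unfolded nuclear_via_def, THEN spec, THEN mp, OF assms(2), THEN spec, THEN mp,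
        OF conjI, OF assms(3,4)]
    by (elim exE conjE) (rule that)
  show ?thesis
    by (rule exI[of _ \<phi>], rule exI[of _ "\<psi> F"], rule exI[of _ F]) (intro conjI 1 2[rule_format] F)
qed

lemma approximable_crossed_product:
  fixes A :: "'h::chilbert_space op set" and \<alpha> :: "'g::group_add \<Rightarrow> 'h op \<Rightarrow> 'h op"
    and \<P> :: "('g, 'h, 'k::chilbert_space) universe family \<Rightarrow> bool"
  assumes A: "unital_cstar_algebra A" and \<alpha>: "cstar_action A \<alpha>"
    and nuclear: "nuclear_via A \<alpha> \<P> \<Q>" and appr: "approximable_with A C" and C: "C > 0"
  shows "approximable_with (crossed_product A \<alpha>) C"
  unfolding approximable_with_iff
proof (intro allI impI)
  let ?B = "crossed_product A \<alpha>"
  let ?UB = "univ_crossed A \<alpha> :: ('g, 'h, 'k) universe op set"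
  note cA = cstar_A[OF A \<alpha>] and sA = csubspace_A[OF A \<alpha>]
  note D1 = corner_embeddingD[OF corner_embedding_in1[where 'g = 'g and 'h = 'h and 'k = 'k]]
  note D2 = corner_embeddingD[OF corner_embedding_in2[where 'g = 'g and 'h = 'h and 'k = 'k]]
  fix \<epsilon> :: real and X assume \<epsilon>: "\<epsilon> > 0" and X: "finite X \<and> X \<subseteq> ?B"
  have "\<epsilon> / 2 > 0" "finite (lift1 ` X)" "lift1 ` X \<subseteq> ?UB" using X \<epsilon> by (auto simp: univ_crossed_def)
  from nuclear_via_factorization[OF nuclear this]
  obtain \<phi> :: "('g, 'h, 'k) universe op \<Rightarrow> ('g, 'h, 'k) universe op" and \<psi> F
    where \<phi>: "ccp_map ?UB (univ_stable A) \<phi>" and \<psi>: "ccp_map (univ_matrix A F) ?UB \<psi>"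
    and F: "finite F"
    and close: "\<forall>b\<in>lift1 ` X. norm (\<psi> (lift2 (proj_on F) o\<^sub>L \<phi> b o\<^sub>L lift2 (proj_on F)) - b) \<le> \<epsilon> / 2"
    by (elim exE conjE) (rule that)
  let ?P = "lift2 (proj_on F) :: ('g, 'h, 'k) universe op"
  let ?UM = "univ_matrix A F :: ('g, 'h, 'k) universe op set"

  \<comment> \<open>Compression of \<phi> to the matrix algebra over F\<close>
  define \<phi>' where "\<phi>' x = ?P o\<^sub>L \<phi> x o\<^sub>L ?P" for x
  define y where "y b = out2 o\<^sub>L \<phi>' (lift1 b) o\<^sub>L in2" for b
  have P_apply: "?P v = in2 (proj_on F (out2 v))" for v by (simp add: lift2_def)
  have norm_P: "norm ?P \<le> 1"
    unfolding lift2_def by (rule order_trans[OF norm_conj_le[OF D2(2,3)] norm_proj_on[OF F]])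
  have P_selfadj: "cinner u (?P v) = cinner (?P u) v" for u v
  proof -
    \<comment> \<open>The projection is the unit of the C*-algebra M_F(A), hence
      self-adjoint.\<close>
    have "is_adjoint (proj_on F :: ('g tuples, 'h) ell2 op) (proj_on F)"
      using unit_self_adjoint[OF is_unit_matrix_alg[OF A F]]
        cstar_algebra_matrix_alg[OF cA F] is_unit_matrix_alg[OF A F]
      unfolding cstar_algebra_def is_unit_def by metis
    then show ?thesis by (simp add: P_apply D2 is_adjoint_def)
  qed
  have \<phi>'_lift: "\<phi>' x = lift2 (proj_on F o\<^sub>L w o\<^sub>L proj_on F)" if "\<phi> x = lift2 w" for x w
    unfolding \<phi>'_def that by (rule blinfun_eqI) (simp add: lift2_def D2)
  have \<phi>'_in: "\<phi>' x \<in> ?UM" if x: "x \<in> ?UB" for x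
  proof -
    obtain w where w: "w \<in> stable_alg A" "\<phi> x = lift2 w"
      using x \<phi> unfolding ccp_map_def cp_map_def univ_stable_def by blast
    show ?thesis
      unfolding \<phi>'_lift[OF w(2)] univ_matrix_def
      by (intro imageI compress_stable_alg sA closed_A[OF A \<alpha>] F w(1))
  qed
  have \<phi>'_linear: "linear_on ?UB \<phi>'"
    unfolding \<phi>'_def
  proof (rule linear_on_compose[of _ \<phi> UNIV])
    show "linear_on ?UB \<phi>" using \<phi> by (simp add: ccp_map_def cp_map_def)
    have "clinear_op (proj_on F :: ('g tuples, 'h) ell2 op)"
      using is_unit_matrix_alg[OF A F] cstar_algebra_matrix_alg[OF cA F]
      unfolding cstar_algebra_def is_unit_def by blast
    then have "clinear_op ?P" unfolding lift2_def by (intro clinear_op_compose D2)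
    then show "linear_on UNIV (\<lambda>x. ?P o\<^sub>L x o\<^sub>L ?P)" by (rule linear_on_conj)
  qed simp
  have \<phi>'_ccp: "ccp_map ?UB ?UM \<phi>'"
    unfolding ccp_map_def cp_map_def
  proof (intro conjI allI impI ballI)
    show "\<phi>' ` ?UB \<subseteq> ?UM" using \<phi>'_in by blast
    show "linear_on ?UB \<phi>'" by (rule \<phi>'_linear)
    show "mat_pos n (\<lambda>i j. \<phi>' (Z i j))" if "mat_in n ?UB Z \<and> mat_pos n Z" for n Z
      unfolding \<phi>'_def by (rule mat_pos_conj) (use that \<phi> P_selfadj in \<open>auto simp: ccp_map_def cp_map_def\<close>)
    show "norm (\<phi>' x) \<le> norm x" if "x \<in> ?UB" for x
      using norm_conj_le[OF norm_P norm_P, of "\<phi> x"] \<phi> that unfolding \<phi>'_def ccp_map_def by force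
  qed
  have y_in: "y b \<in> matrix_alg A F" and lift_y: "lift2 (y b) = \<phi>' (lift1 b)" if b: "b \<in> ?B" for b
  proof -
    have "\<phi>' (lift1 b) \<in> ?UM" using b by (intro \<phi>'_in) (simp add: univ_crossed_def)
    then obtain m where m: "m \<in> matrix_alg A F" "\<phi>' (lift1 b) = lift2 m" unfolding univ_matrix_def by blast
    have "y b = m" unfolding y_def m(2) by (rule blinfun_eqI) (simp add: lift2_def D2)
    with m show "y b \<in> matrix_alg A F" "lift2 (y b) = \<phi>' (lift1 b)" by simp_all
  qed

  \<comment> \<open>Choice of the finite rank map on A\<close>
  note ent = matrix_alg_mat_op[OF F sA y_in]
  define E where "E = (\<lambda>(b, s, t). entry (y b) s t) ` (X \<times> F \<times> F)"
  \<comment> \<open>The |F|^2 entries contribute at most |F|^2 \<delta>, which must stay below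
    \<epsilon> / 2; the summand 1 makes this strict and covers empty F.\<close>
  define \<delta> where "\<delta> = \<epsilon> / 2 / (real (card F) * real (card F) + 1)"
  have E: "finite E \<and> E \<subseteq> A" using X F ent(2) by (auto simp: E_def)
  have \<delta>: "\<delta> > 0" using \<epsilon> by (simp add: \<delta>_def add_nonneg_pos)
  obtain \<Phi> where \<Phi>: "cb_finite_rank A C \<Phi>" "\<And>e. e \<in> E \<Longrightarrow> norm (\<Phi> e - e) < \<delta>"
    using appr[unfolded approximable_with_iff, THEN spec, THEN mp, OF \<delta>, THEN spec, THEN mp, OF E] by blast
  have \<Phi>_facts: "\<Phi> ` A \<subseteq> A" "linear_on A \<Phi>" "finite_rank A \<Phi>" "cb_norm A \<Phi> \<le> ennreal C"
    using \<Phi>(1) by (auto simp: cb_finite_rank_def)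
  define M where "M b = mat_op F (\<lambda>s t. \<Phi> (entry (y b) s t))" for b
  have M_in: "M b \<in> matrix_alg A F" if "b \<in> ?B" for b
    unfolding M_def using \<Phi>_facts(1) ent(2)[OF that] by (intro mat_op_in_matrix_alg) blast
  \<comment> \<open>Here \<open>M b\<close> is \<Phi> \<otimes> id applied to the matrix
    \<open>y b\<close>; \<open>out1\<close> and \<open>in1\<close> lead back from the common Hilbert
    space to that of the crossed product.\<close>
  define \<Theta> where "\<Theta> b = out1 o\<^sub>L \<psi> (lift2 (M b)) o\<^sub>L in1" for b

  \<comment> \<open>Range, linearity and finite rank of the approximating map\<close>
  have lift1_linear: "linear_on S (lift1 :: _ \<Rightarrow> ('g, 'h, 'k) universe op)" for S
    unfolding lift1_def by (rule linear_on_conj[OF D1(4)])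
  have lift2_linear: "linear_on S (lift2 :: _ \<Rightarrow> ('g, 'h, 'k) universe op)" for S
    unfolding lift2_def by (rule linear_on_conj[OF D2(4)])
  have out1_linear: "linear_on S (\<lambda>x :: ('g, 'h, 'k) universe op. out1 o\<^sub>L x o\<^sub>L in1)" for S
    by (rule linear_on_conj[OF D1(5)])
  have out1_lift1: "out1 o\<^sub>L lift1 x o\<^sub>L (in1 :: _ \<Rightarrow>\<^sub>L ('g, 'h, 'k) universe) = x" for x
    by (rule blinfun_eqI) (simp add: lift1_def D1)
  have lift1_B: "lift1 ` ?B \<subseteq> ?UB" by (simp add: univ_crossed_def)
  have lift2_M: "lift2 ` matrix_alg A F \<subseteq> ?UM" by (simp add: univ_matrix_def)
  have sys_UB: "operator_system ?UB"
    using operator_system_corner[OF corner_embedding_in1 operator_system_crossed_product[OF A \<alpha>]]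
    unfolding univ_crossed_def lift1_def .
  have sys_UM: "operator_system ?UM"
    using operator_system_corner[OF corner_embedding_in2
        operator_systemI[OF cstar_algebra_matrix_alg[OF cA F] is_unit_matrix_alg[OF A F]]]
    unfolding univ_matrix_def lift2_def .
  have \<psi>_facts: "\<psi> ` ?UM \<subseteq> ?UB" "linear_on ?UM (\<psi>)" "\<And>x. x \<in> ?UM \<Longrightarrow> norm (\<psi> x) \<le> norm x"
    using \<psi> by (auto simp: ccp_map_def cp_map_def)
  have sub_UM: "csubspace ?UM" using sys_UM by (simp add: operator_system_def)
  have lin_y: "linear_on ?B y"
    unfolding y_def
    by (rule linear_on_compose[OF linear_on_compose[OF lift1_linear lift1_B \<phi>'_linear] subset_UNIV])
      (rule linear_on_conj[OF D2(5)])
  have lin_ent: "linear_on ?B (\<lambda>b. \<Phi> (entry (y b) s t))" if "s \<in> F" "t \<in> F" for s t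
  proof (rule linear_on_compose[OF _ _ \<Phi>_facts(2)])
    show "linear_on ?B (\<lambda>b. entry (y b) s t)"
      by (rule linear_on_compose[OF lin_y subset_UNIV]) (simp add: linear_on_def entry_add entry_scaleC)
    show "(\<lambda>b. entry (y b) s t) ` ?B \<subseteq> A" using ent(2) that by blast
  qed
  have lin_M: "linear_on ?B M"
    unfolding linear_on_def
  proof (intro conjI ballI allI)
    fix a b assume "a \<in> ?B" "b \<in> ?B"
    then show "M (a + b) = M a + M b"
      unfolding M_def mat_op_add[symmetric] using lin_ent by (intro mat_op_cong) (simp add: linear_on_def)
  next
    fix a c assume "a \<in> ?B"
    then show "M (c *\<^sub>C a) = c *\<^sub>C M a"
      unfolding M_def mat_op_scaleC[symmetric] using lin_ent by (intro mat_op_cong) (simp add: linear_on_def)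
  qed
  have M_B: "M ` ?B \<subseteq> matrix_alg A F" using M_in by blast
  have lift_M_B: "(\<lambda>b. lift2 (M b)) ` ?B \<subseteq> ?UM" using M_in by (auto simp: univ_matrix_def)
  have lin_lift_M: "linear_on ?B (\<lambda>b. lift2 (M b) :: ('g, 'h, 'k) universe op)"
    by (rule linear_on_compose[OF lin_M subset_UNIV lift2_linear])
  have \<Theta>_B: "\<Theta> ` ?B \<subseteq> ?B"
  proof clarify
    fix b assume "b \<in> ?B"
    then have "\<psi> (lift2 (M b)) \<in> ?UB" using \<psi>_facts(1) lift_M_B by blast
    then show "\<Theta> b \<in> ?B" unfolding univ_crossed_def \<Theta>_def by (auto simp: out1_lift1)
  qed
  have \<Theta>_linear: "linear_on ?B \<Theta>"
    unfolding \<Theta>_def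
    by (rule linear_on_compose[OF linear_on_compose[OF lin_lift_M lift_M_B \<psi>_facts(2)] subset_UNIV out1_linear])
  \<comment> \<open>A finite sum over pairs from F of finite rank maps into A, each followed by
    placing the value at one matrix position.\<close>
  have rank_M: "finite_rank ?B M"
    unfolding M_def mat_op_def
  proof (intro finite_rank_sum F)
    fix s t assume st: "s \<in> F" "t \<in> F"
    have "finite_rank ?B (\<lambda>b. \<Phi> (entry (y b) s t))"
      by (rule finite_rank_precompose[OF \<Phi>_facts(3)]) (use ent(2) st in blast)
    moreover have "linear_on UNIV (\<lambda>a :: 'h op. matrix_unit a s t)"
      unfolding matrix_unit_eq by (rule linear_on_conj[OF clinear_ket])
    ultimately show "finite_rank ?B (\<lambda>b. matrix_unit (\<Phi> (entry (y b) s t)) s t)"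
      using finite_rank_compose[OF _ subset_UNIV _ complex_vector.subspace_UNIV] by blast
  qed
  have \<Theta>_rank: "finite_rank ?B \<Theta>"
    unfolding \<Theta>_def
    by (rule finite_rank_compose[OF finite_rank_compose[OF finite_rank_compose[OF rank_M subset_UNIV lift2_linear
          complex_vector.subspace_UNIV] lift_M_B \<psi>_facts(2) sub_UM] subset_UNIV out1_linear complex_vector.subspace_UNIV])

  \<comment> \<open>Complete bound of the approximating map\<close>
  have \<Theta>_cb: "cb_norm ?B \<Theta> \<le> ennreal C"
    unfolding cb_norm_le_iff[OF less_imp_le[OF C]]
  proof (intro allI impI)
    fix n Z assume Z: "mat_in n ?B Z" "mat_bounded {..<n} Z 1"
    have ZB: "Z i j \<in> ?B" if "i < n" "j < n" for i j using Z(1) that by (simp add: mat_in_def)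
    have 1: "mat_bounded {..<n} (\<lambda>i j. lift1 (Z i j) :: ('g, 'h, 'k) universe op) 1"
      unfolding lift1_def by (rule mat_bounded_conj[OF Z(2) D1(2,3)])
    have 2: "mat_bounded {..<n} (\<lambda>i j. \<phi>' (lift1 (Z i j))) 1"
    proof (rule ccp_mat_bounded[OF sys_UB \<phi>'_ccp _ _ 1])
      show "mat_in n ?UB (\<lambda>i j. lift1 (Z i j))" using ZB lift1_B by (auto simp: mat_in_def)
    qed (use sys_UM in \<open>auto simp: operator_system_def\<close>)
    have 3: "mat_bounded {..<n} (\<lambda>i j. y (Z i j)) 1"
      unfolding y_def by (rule mat_bounded_conj[OF 2 D2(3,2)])
    \<comment> \<open>The only passage at which the bound changes, from 1 to C.\<close>
    have 4: "mat_bounded {..<n} (\<lambda>i j. M (Z i j)) C"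
      unfolding M_def
      by (rule mat_bounded_matrix_amplification[OF \<Phi>_facts(4) less_imp_le[OF C] F _ 3])
        (simp add: ent(2) ZB)
    have 5: "mat_bounded {..<n} (\<lambda>i j. lift2 (M (Z i j)) :: ('g, 'h, 'k) universe op) C"
      unfolding lift2_def by (rule mat_bounded_conj[OF 4 D2(2,3)])
    have 6: "mat_bounded {..<n} (\<lambda>i j. \<psi> (lift2 (M (Z i j)))) C"
    proof (rule ccp_mat_bounded[OF sys_UM \<psi> _ _ 5 C])
      show "mat_in n ?UM (\<lambda>i j. lift2 (M (Z i j)))" using ZB lift_M_B by (auto simp: mat_in_def)
    qed (use sys_UB in \<open>auto simp: operator_system_def\<close>)
    show "mat_bounded {..<n} (\<lambda>i j. \<Theta> (Z i j)) C"
      unfolding \<Theta>_def by (rule mat_bounded_conj[OF 6 D1(3,2)])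
  qed

  \<comment> \<open>Error of the approximation\<close>
  have \<Theta>_close: "norm (\<Theta> b - b) < \<epsilon>" if b: "b \<in> X" for b
  proof -
    have bB: "b \<in> ?B" using b X by blast
    have "norm (\<Theta> b - b) = norm (out1 o\<^sub>L (\<psi> (lift2 (M b)) - lift1 b) o\<^sub>L (in1 :: _ \<Rightarrow>\<^sub>L ('g, 'h, 'k) universe))"
      using out1_lift1[of b] unfolding \<Theta>_def
      by (simp add: bounded_bilinear.diff_left[OF bounded_bilinear_blinfun_compose]
          bounded_bilinear.diff_right[OF bounded_bilinear_blinfun_compose])
    also have "\<dots> \<le> norm (\<psi> (lift2 (M b)) - lift1 b)" by (rule norm_conj_le[OF D1(3,2)])
    \<comment> \<open>The second term is the error of the factorization without \<Phi>. The first is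
      at most the distance of \<open>M b\<close> from \<open>y b\<close>, because
      \<open>\<psi>\<close> is linear and contractive on the matrix algebra.\<close>
    also have "\<dots> \<le> norm (\<psi> (lift2 (M b)) - \<psi> (lift2 (y b))) + norm (\<psi> (lift2 (y b)) - lift1 b)"
      using norm_triangle_ineq[of "\<psi> (lift2 (M b)) - \<psi> (lift2 (y b))" "\<psi> (lift2 (y b)) - lift1 b"] by simp
    also have "\<psi> (lift2 (M b)) - \<psi> (lift2 (y b)) = \<psi> (lift2 (M b - y b))"
    proof -
      have "M b - y b \<in> matrix_alg A F"
        by (rule complex_vector.subspace_diff[OF csubspace_matrix_alg M_in[OF bB] y_in[OF bB]])
      then have "lift2 (M b - y b) \<in> ?UM" "lift2 (y b) \<in> ?UM" using lift2_M y_in[OF bB] by blast+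
      then have "\<psi> (lift2 (M b - y b) + lift2 (y b)) = \<psi> (lift2 (M b - y b)) + \<psi> (lift2 (y b))"
        using \<psi>_facts(2) by (simp add: linear_on_def)
      moreover have "lift2 (M b - y b) + lift2 (y b) = (lift2 (M b) :: ('g, 'h, 'k) universe op)"
        using lift2_linear[of UNIV] unfolding linear_on_def by (metis UNIV_I diff_add_cancel)
      ultimately show ?thesis by (simp add: algebra_simps)
    qed
    also have "norm (\<psi> (lift2 (M b - y b))) \<le> norm (M b - y b)"
    proof -
      have "lift2 (M b - y b) \<in> ?UM"
        using complex_vector.subspace_diff[OF csubspace_matrix_alg M_in[OF bB] y_in[OF bB]] lift2_M by blast
      from \<psi>_facts(3)[OF this] show ?thesis
        unfolding lift2_def by (rule order_trans[OF _ norm_conj_le[OF D2(2,3)]])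
    qed
    also have "norm (M b - y b) \<le> real (card F) * real (card F) * \<delta>"
    proof -
      have "M b - y b = (\<Sum>s\<in>F. \<Sum>t\<in>F. ket s o\<^sub>L (\<Phi> (entry (y b) s t) - entry (y b) s t) o\<^sub>L coord t)"
        unfolding M_def by (subst ent(1)[OF bB, symmetric])
          (simp add: mat_op_def matrix_unit_eq sum_subtractf[symmetric]
            bounded_bilinear.diff_left[OF bounded_bilinear_blinfun_compose]
            bounded_bilinear.diff_right[OF bounded_bilinear_blinfun_compose])
      also have "norm \<dots> \<le> (\<Sum>s\<in>F. \<Sum>t\<in>F. \<delta>)"
      proof (intro sum_norm_le)
        fix s t assume st: "s \<in> F" "t \<in> F"
        have "norm (ket s o\<^sub>L (\<Phi> (entry (y b) s t) - entry (y b) s t) o\<^sub>L coord t)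
            \<le> norm (\<Phi> (entry (y b) s t) - entry (y b) s t)"
          by (rule norm_conj_le[OF norm_ket norm_coord])
        also have "\<dots> \<le> \<delta>" using \<Phi>(2) b st by (intro less_imp_le) (force simp: E_def)
        finally show "norm (ket s o\<^sub>L (\<Phi> (entry (y b) s t) - entry (y b) s t) o\<^sub>L coord t) \<le> \<delta>" .
      qed
      finally show ?thesis by (simp add: mult.assoc)
    qed
    also have "norm (\<psi> (lift2 (y b)) - lift1 b) \<le> \<epsilon> / 2"
      using close b unfolding lift_y[OF bB] \<phi>'_def by blast
    also have "real (card F) * real (card F) * \<delta> + \<epsilon> / 2 < \<epsilon>"
    proof -
      have "real (card F) * real (card F) + 1 > 0" by (simp add: add_nonneg_pos)
      then have "(real (card F) * real (card F) + 1) * \<delta> = \<epsilon> / 2"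
        unfolding \<delta>_def by (metis nonzero_mult_div_cancel_left times_divide_eq_right less_irrefl)
      then show ?thesis using \<delta> by (simp add: distrib_right)
    qed
    finally show ?thesis by simp
  qed
  show "\<exists>\<Phi>. cb_finite_rank ?B C \<Phi> \<and> (\<forall>x\<in>X. norm (\<Phi> x - x) < \<epsilon>)"
    using \<Theta>_B \<Theta>_linear \<Theta>_rank \<Theta>_cb \<Theta>_close unfolding cb_finite_rank_def by blast
qed

theorem theorem3p12:
  fixes A :: "'h::chilbert_space op set" and \<alpha> :: "'g::group_add \<Rightarrow> 'h op \<Rightarrow> 'h op"
  assumes "unital_cstar_algebra A" and "cstar_action A \<alpha>"
    and "nuclear_as_module TYPE('k::chilbert_space) TYPE('i) A \<alpha> \<or>
         nuclear_as_comodule TYPE('k) TYPE('i) A \<alpha>"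
    and "CBAP A"
  shows "CBAP (crossed_product A \<alpha>) \<and>
         Haagerup_constant (crossed_product A \<alpha>) = Haagerup_constant A"
proof -
  obtain \<P> \<Q> :: "('g, 'h, 'k) universe family \<Rightarrow> bool" where "nuclear_via A \<alpha> \<P> \<Q>"
    using assms(3) unfolding nuclear_as_module_def nuclear_as_comodule_def Let_def by blast
  then have "approximable_with (crossed_product A \<alpha>) C \<longleftrightarrow> approximable_with A C" if "C > 0" for C
    using approximable_crossed_product[OF assms(1,2)] approximable_of_crossed_product[OF assms(1,2)] that
    by blast
  \<comment> \<open>Both the CBAP and the Haagerup constant are determined by this set of positive
    constants.\<close>
  then have "{C. C > 0 \<and> approximable_with (crossed_product A \<alpha>) C} = {C. C > 0 \<and> approximable_with A C}"
    by blast
  then show ?thesis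
    using assms(4) unfolding CBAP_def Haagerup_constant_def by auto
qed

end
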